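(* Let $G$ be a connected graph such that $J_G$ is strongly unmixed. Let $B$ be a block of $G$ and $V$ the set of cut vertices of $G$ belonging to $V(B)$. Then for any $W\subseteq V$, $J_{\overline{B}^{W}}$ is strongly unmixed. In particular, $J_{\overline{B}}$ is strongly unmixed, where $\overline{B}=\overline{B}^{V}$.
   Context: All graphs are finite and simple. For a graph $G$ on $[n]=\{1,\dots,n\}$ and a field $K$, the binomial edge ideal $J_G\subseteq K[x_1,\dots,x_n,y_1,\dots,y_n]$ is generated by all $x_iy_j-x_jy_i$ with $\{i,j\}\in E(G)$, $i<j$. For $T\subseteq V(G)$, $G\setminus T$ is the induced subgraph on $V(G)\setminus T$ and $c_G(T)$ is its number of connected components. A cut vertex is a vertex whose removal increases the number of connected components. A set $T\subseteq V(G)$ is a cutset if each $t\in T$ is a cut vertex of $G\setminus(T\setminus\{t\})$; $\mathfrak{C}(G)$ is the set of all cutsets. $J_G$ is unmixed if all its minimal primes have the same height; equivalently $c_G(T)=|T|+c$ for all $T\in\mathfrak{C}(G)$, where $c$ is the number of connected components of $G$. For a vertex $v$, $G_v$ is the graph with $V(G_v)=V(G)$ and $E(G_v)=E(G)\cup\{\{i,j\}: i,j\in\mathcal{N}_G(v),\, i\ne j\}$, where $\mathcal{N}_G(v)$ is the set of neighbours of $v$. Recursively, $J_G$ is strongly unmixed if every connected component of $G$ is complete, or if $J_G$ is unmixed and there exists a cut vertex $v$ of $G$ such that $J_{G\setminus\{v\}}$, $J_{G_v}$ and $J_{G_v\setminus\{v\}}$ are all strongly unmixed. A block of a connected graph $G$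 is a maximal connected induced subgraph having no cut vertex of its own. Let $G$ be connected with $J_G$ unmixed, $B$ a block of $G$, and $V=\{v_1,\dots,v_k\}$ the cut vertices of $G$ in $V(B)$. Then $G=B\cup\bigcup_{i=1}^kG_i$, where $V(G_i)\cap V(B)=\{v_i\}$ and $G_i\setminus\{v_i\}$ is the connected component of $G\setminus\{v_i\}$ not meeting $B$ ($G_i$ is the induced subgraph on this component together with $v_i$). For $W\subseteq V$, $\overline{B}^{W}$ is the graph with vertex set $V(B)\cup\bigcup_{v_i\notin W}V(G_i)\cup\{f_v: v\in W\}$, the $f_v$ being new vertices, and edge set $E(B)\cup\bigcup_{v_i\in V\setminus W}E(G_i)\cup\{\{v,f_v\}: v\in W\}$; that is, for each $v_i\in W$ the part $G_i$ is replaced by a whisker at $v_i$. $\overline{B}=\overline{B}^{V}$. *)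

theory Defs
  imports
    "HOL-Algebra.Ideal"
    "HOL-Library.Poly_Mapping"
    "HOL-Library.Extended_Nat"
begin

section \<open>Finite simple graphs\<close>

datatype 'a ugraph = Graph (verts: "'a set") (edges: "'a set set")

definition fin_simple_graph :: "'a ugraph \<Rightarrow> bool" where
  "fin_simple_graph G \<longleftrightarrow>
     finite (verts G) \<and> (\<forall>e\<in>edges G. e \<subseteq> verts G \<and> card e = 2)"

definition induced :: "'a ugraph \<Rightarrow> 'a set \<Rightarrow> 'a ugraph" where
  "induced G S = Graph (verts G \<inter> S) {e \<in> edges G. e \<subseteq> S}"

definition delete_verts :: "'a ugraph \<Rightarrow> 'a set \<Rightarrow> 'a ugraph" where
  "delete_verts G T = induced G (verts G - T)"

definition adj_rel :: "'a ugraph \<Rightarrow> ('a \<times> 'a) set" where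
  "adj_rel G = {(u, v). {u, v} \<in> edges G}"

text \<open>Connected components are represented by their vertex sets.\<close>

definition components :: "'a ugraph \<Rightarrow> 'a set set" where
  "components G = (\<lambda>u. {v \<in> verts G. (u, v) \<in> (adj_rel G)\<^sup>*}) ` verts G"

definition connected_graph :: "'a ugraph \<Rightarrow> bool" where
  "connected_graph G \<longleftrightarrow>
     verts G \<noteq> {} \<and> (\<forall>u\<in>verts G. \<forall>v\<in>verts G. (u, v) \<in> (adj_rel G)\<^sup>*)"

definition cut_vertex :: "'a ugraph \<Rightarrow> 'a \<Rightarrow> bool" where
  "cut_vertex G v \<longleftrightarrow>
     v \<in> verts G \<and> card (components G) < card (components (delete_verts G {v}))"

definition complete_components :: "'a ugraph \<Rightarrow> bool" where
  "complete_components G \<longleftrightarrow>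
     (\<forall>C\<in>components G. \<forall>i\<in>C. \<forall>j\<in>C. i \<noteq> j \<longrightarrow> {i, j} \<in> edges G)"

definition neighbours :: "'a ugraph \<Rightarrow> 'a \<Rightarrow> 'a set" where
  "neighbours G v = {u. {v, u} \<in> edges G}"

text \<open>The graph \<open>G\<^sub>v\<close>.\<close>

definition nbr_completion :: "'a ugraph \<Rightarrow> 'a \<Rightarrow> 'a ugraph" where
  "nbr_completion G v = Graph (verts G)
     (edges G \<union> {{i, j} | i j. i \<in> neighbours G v \<and> j \<in> neighbours G v \<and> i \<noteq> j})"


section \<open>Binomial edge ideals and unmixedness\<close>

datatype 'a var = X 'a | Y 'a

text \<open>
  A polynomial with coefficients in \<open>'k\<close> is a finitely supported map from monomials
  (finitely supported exponent vectors) to \<open>'k\<close>; the product given by the type class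
  instances of \<open>poly_mapping\<close> is the convolution product.
\<close>

type_synonym ('a, 'k) xy_poly = "('a var \<Rightarrow>\<^sub>0 nat) \<Rightarrow>\<^sub>0 'k"

definition pvar :: "'a var \<Rightarrow> ('a, 'k::field) xy_poly" where
  "pvar z = Poly_Mapping.single (Poly_Mapping.single z 1) 1"

definition vars :: "('a, 'k::field) xy_poly \<Rightarrow> 'a var set" where
  "vars p = (\<Union>m\<in>Poly_Mapping.keys p. Poly_Mapping.keys m)"

text \<open>
  \<open>K[x\<^sub>i, y\<^sub>i : i \<in> V]\<close>. The type has variables for all elements of \<open>'a\<close>, so the
  carrier is restricted to the polynomials involving only variables indexed by \<open>V\<close>.
\<close>

definition xy_ring :: "'a set \<Rightarrow> ('a, 'k::field) xy_poly ring" where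
  "xy_ring V = \<lparr>carrier = {p. vars p \<subseteq> X ` V \<union> Y ` V},
     mult = (*), one = 1, zero = 0, add = (+)\<rparr>"

text \<open>
  Both orientations of each edge are used, as \<open>'a\<close> carries no order; they give
  the same generator up to sign.
\<close>

definition binomial_edge_ideal :: "'a ugraph \<Rightarrow> ('a, 'k::field) xy_poly set" where
  "binomial_edge_ideal G = genideal (xy_ring (verts G))
     {pvar (X i) * pvar (Y j) - pvar (X j) * pvar (Y i) | i j. {i, j} \<in> edges G}"

definition minimal_primes :: "('r, 'm) ring_scheme \<Rightarrow> 'r set \<Rightarrow> 'r set set" where
  "minimal_primes R I = {P. primeideal P R \<and> I \<subseteq> P \<and>
     (\<forall>Q. primeideal Q R \<and> I \<subseteq> Q \<and> Q \<subseteq> P \<longrightarrow> Q = P)}"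

definition height :: "('r, 'm) ring_scheme \<Rightarrow> 'r set \<Rightarrow> enat" where
  "height R P = (SUP n \<in> {n. \<exists>c :: nat \<Rightarrow> 'r set.
     (\<forall>i\<le>n. primeideal (c i) R) \<and> (\<forall>i<n. c i \<subset> c (Suc i)) \<and> c n = P}. enat n)"

definition unmixed_ideal :: "('r, 'm) ring_scheme \<Rightarrow> 'r set \<Rightarrow> bool" where
  "unmixed_ideal R I \<longleftrightarrow>
     (\<forall>P\<in>minimal_primes R I. \<forall>Q\<in>minimal_primes R I. height R P = height R Q)"

text \<open>The argument of type \<open>'k itself\<close> fixes the ground field.\<close>

definition unmixed :: "'k::field itself \<Rightarrow> 'a ugraph \<Rightarrow> bool" where
  "unmixed K G \<longleftrightarrow>
     unmixed_ideal (xy_ring (verts G)) (binomial_edge_ideal G :: ('a, 'k) xy_poly set)"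

inductive strongly_unmixed :: "'k::field itself \<Rightarrow> 'a ugraph \<Rightarrow> bool"
  for K :: "'k itself" where
  complete: "complete_components G \<Longrightarrow> strongly_unmixed K G"
| cut: "\<lbrakk>unmixed K G; cut_vertex G v;
      strongly_unmixed K (delete_verts G {v});
      strongly_unmixed K (nbr_completion G v);
      strongly_unmixed K (delete_verts (nbr_completion G v) {v})\<rbrakk>
    \<Longrightarrow> strongly_unmixed K G"


section \<open>Blocks and the graphs \<open>B\<^sup>W\<close>\<close>

definition nonseparable :: "'a ugraph \<Rightarrow> bool" where
  "nonseparable H \<longleftrightarrow> connected_graph H \<and> (\<forall>v. \<not> cut_vertex H v)"

definition is_block :: "'a ugraph \<Rightarrow> 'a ugraph \<Rightarrow> bool" where
  "is_block G B \<longleftrightarrow>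
     verts B \<subseteq> verts G \<and> B = induced G (verts B) \<and> nonseparable B \<and>
     (\<forall>S. verts B \<subseteq> S \<and> S \<subseteq> verts G \<and> nonseparable (induced G S) \<longrightarrow> S = verts B)"

definition block_cut_verts :: "'a ugraph \<Rightarrow> 'a ugraph \<Rightarrow> 'a set" where
  "block_cut_verts G B = {v \<in> verts B. cut_vertex G v}"

text \<open>
  The part \<open>G\<^sub>i\<close> of \<open>G\<close> attached to the block \<open>B\<close> at its cut vertex \<open>v\<close>.
  If \<open>G\<close> is connected and \<open>J\<^sub>G\<close> is unmixed, exactly one component of \<open>G - v\<close> is
  disjoint from \<open>B\<close>.
\<close>

definition branch :: "'a ugraph \<Rightarrow> 'a ugraph \<Rightarrow> 'a \<Rightarrow> 'a ugraph" where
  "branch G B v = induced G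
     (insert v (THE C. C \<in> components (delete_verts G {v}) \<and> C \<inter> verts B = {}))"

text \<open>\<open>f v\<close> is the new vertex \<open>f\<^sub>v\<close>.\<close>

definition whiskered_block ::
    "'a ugraph \<Rightarrow> 'a ugraph \<Rightarrow> 'a set \<Rightarrow> ('a \<Rightarrow> 'a) \<Rightarrow> 'a ugraph" where
  "whiskered_block G B W f = Graph
     (verts B \<union> (\<Union>v\<in>block_cut_verts G B - W. verts (branch G B v)) \<union> f ` W)
     (edges B \<union> (\<Union>v\<in>block_cut_verts G B - W. edges (branch G B v)) \<union> {{v, f v} | v. v \<in> W})"

definition new_vertices :: "'a ugraph \<Rightarrow> 'a set \<Rightarrow> ('a \<Rightarrow> 'a) \<Rightarrow> bool" where
  "new_vertices G W f \<longleftrightarrow> inj_on f W \<and> f ` W \<inter> verts G = {}"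


section \<open>The polynomial ring is a commutative ring\<close>

lemma vars_add: "vars (p + q) \<subseteq> vars p \<union> vars q"
  unfolding vars_def using Poly_Mapping.keys_add[of p q] by blast

lemma vars_mult: "vars (p * q) \<subseteq> vars p \<union> vars q"
proof
  fix z assume "z \<in> vars (p * q)"
  then obtain m where m: "m \<in> Poly_Mapping.keys (p * q)" "z \<in> Poly_Mapping.keys m"
    unfolding vars_def by blast
  then obtain a b where ab: "a \<in> Poly_Mapping.keys p" "b \<in> Poly_Mapping.keys q" "m = a + b"
    using Poly_Mapping.keys_mult[of p q] by blast
  then show "z \<in> vars p \<union> vars q"
    using m(2) Poly_Mapping.keys_add[of a b] unfolding vars_def by blast
qed

lemma vars_uminus: "vars (- p) = vars p"
  by (simp add: vars_def)

lemma vars_0: "vars 0 = {}" and vars_1: "vars 1 = {}"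
  by (simp_all add: vars_def)

lemma cring_xy_ring: "cring (xy_ring V :: ('a, 'k::field) xy_poly ring)"
proof -
  define U where "U = X ` V \<union> Y ` V"
  define R where "R = (xy_ring V :: ('a, 'k) xy_poly ring)"
  have R: "carrier R = {p. vars p \<subseteq> U}" "\<And>p q. p \<otimes>\<^bsub>R\<^esub> q = p * q"
    "\<And>p q. p \<oplus>\<^bsub>R\<^esub> q = p + q" "\<one>\<^bsub>R\<^esub> = 1" "\<zero>\<^bsub>R\<^esub> = 0"
    by (simp_all add: R_def U_def xy_ring_def)
  have "abelian_group R"
  proof (rule abelian_groupI)
    fix x y assume "x \<in> carrier R" "y \<in> carrier R"
    then show "x \<oplus>\<^bsub>R\<^esub> y \<in> carrier R"
      using vars_add[of x y] by (auto simp only: R mem_Collect_eq)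
  next
    fix x assume "x \<in> carrier R"
    then show "\<exists>y\<in>carrier R. y \<oplus>\<^bsub>R\<^esub> x = \<zero>\<^bsub>R\<^esub>"
      by (intro bexI[of _ "- x"]) (simp_all add: R vars_uminus)
  qed (simp_all add: R vars_0 ac_simps)
  moreover have "comm_monoid R"
  proof (rule comm_monoidI)
    fix x y assume "x \<in> carrier R" "y \<in> carrier R"
    then show "x \<otimes>\<^bsub>R\<^esub> y \<in> carrier R"
      using vars_mult[of x y] by (auto simp only: R mem_Collect_eq)
  qed (simp_all add: R vars_1 ac_simps)
  ultimately have "cring R"
    by (rule cringI) (simp add: R distrib_right)
  then show ?thesis by (simp add: R_def)
qed

end

theory Submission
  imports Defs
begin

text \<open>
  The proof has an algebraic and a combinatorial half, which meet in the criterion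
  \<open>unmixed_iff_comb_unmixed\<close>: \<open>J\<^sub>G\<close> is unmixed iff \<open>c\<^sub>G(T) = |T| + c\<^sub>G(\<emptyset>)\<close> for all cutsets \<open>T\<close>.

  For the criterion, each \<open>T\<close> gives a prime \<open>P\<^sub>T\<close>, the kernel of the monomial map that sends
  the variables at \<open>T\<close> to \<open>0\<close> and parametrizes, for each component of \<open>G - T\<close>, the
  \<open>2 \<times> m\<close> matrices of rank at most one. The kernel is generated by the variables at \<open>T\<close> and the
  minors within the components (\<open>toric_least\<close>), every prime above \<open>J\<^sub>G\<close> contains such generators
  for some \<open>T\<close>, and \<open>P\<^sub>T\<close> is minimal iff \<open>T\<close> is a cutset
  (\<open>minimal_primes_edge_ideal\<close>). The height of \<open>P\<^sub>T\<close> is \<open>n + |T| - c\<^sub>G(T)\<close> (\<open>height_toric\<close>):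
  merging classes of vertices and moving vertices into \<open>T\<close> yields a chain of that length, and a
  longer one would produce more linearly independent polynomials of bounded degree than
  there are monomials.

  The combinatorial half rests on one operation: a connected vertex set \<open>C\<close> is collapsed to a
  single vertex \<open>f\<close>, provided that all vertices of \<open>C\<close> that have neighbours outside \<open>C\<close> have
  there the same neighbourhood \<open>K\<close>, and that \<open>K\<close> is a clique. For \<open>K = {v}\<close> this replaces a
  branch at the cut vertex \<open>v\<close> by a whisker. Collapsing preserves the number of components of
  \<open>G - T\<close> for \<open>T\<close> outside \<open>C\<close>, and \<open>f\<close> belongs to no cutset, so unmixedness is
  inherited. The class of such configurations is closed under the steps of the recursion, which gives
  \<open>strongly_unmixed_collapsed\<close> by induction; for this the clique \<open>K\<close> has to be allowed to grow.

  Finally, the vertices outside of a block \<open>B\<close> fall into branches, one for each cut vertex in \<open>B\<close>,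
  because an ear attached at two vertices would enlarge the block. So the graph
  with whiskers at \<open>W\<close> arises from \<open>G\<close> by collapsing the branches at the vertices of \<open>W\<close> one
  after the other.
\<close>

section \<open>Counting connected components\<close>

abbreviation joined :: "'a ugraph \<Rightarrow> 'a \<Rightarrow> 'a \<Rightarrow> bool" where
  "joined G u v \<equiv> (u, v) \<in> (adj_rel G)\<^sup>*"

definition ncomp :: "'a ugraph \<Rightarrow> 'a set \<Rightarrow> nat" where
  "ncomp G T = card (components (delete_verts G T))"

definition cutset :: "'a ugraph \<Rightarrow> 'a set \<Rightarrow> bool" where
  "cutset G T \<longleftrightarrow> T \<subseteq> verts G \<and> (\<forall>t\<in>T. cut_vertex (delete_verts G (T - {t})) t)"

text \<open>For finite simple graphs this will turn out to be equivalent to \<open>unmixed\<close>, over every field.\<close>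

definition comb_unmixed :: "'a ugraph \<Rightarrow> bool" where
  "comb_unmixed G \<longleftrightarrow> (\<forall>T. cutset G T \<longrightarrow> ncomp G T = card T + ncomp G {})"

lemma verts_delete [simp]: "verts (delete_verts G T) = verts G - T"
  by (auto simp: delete_verts_def induced_def)

lemma edges_delete: "edges (delete_verts G T) = {e \<in> edges G. e \<subseteq> verts G - T}"
  by (simp add: delete_verts_def induced_def)

lemma verts_completion [simp]: "verts (nbr_completion G v) = verts G"
  by (simp add: nbr_completion_def)

lemma edges_completion:
  "edges (nbr_completion G v) =
     edges G \<union> {{i, j} | i j. {v, i} \<in> edges G \<and> {v, j} \<in> edges G \<and> i \<noteq> j}"
  by (simp add: nbr_completion_def neighbours_def)

lemma delete_delete: "delete_verts (delete_verts G S) T = delete_verts G (S \<union> T)"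
  by (rule ugraph.expand) (auto simp: edges_delete)

lemma delete_nothing:
  assumes "fin_simple_graph G"
  shows "delete_verts G {} = G"
  using assms by (intro ugraph.expand) (auto simp: edges_delete fin_simple_graph_def)

lemma adj_delete:
  "(u, v) \<in> adj_rel (delete_verts G T) \<longleftrightarrow>
     {u, v} \<in> edges G \<and> u \<in> verts G - T \<and> v \<in> verts G - T"
  by (auto simp: adj_rel_def edges_delete)

lemma fin_simple_delete:
  assumes "fin_simple_graph G"
  shows "fin_simple_graph (delete_verts G T)"
  using assms by (auto simp: fin_simple_graph_def edges_delete)

lemma edgeD:
  assumes "fin_simple_graph G" and "{u, v} \<in> edges G"
  shows "u \<in> verts G" and "v \<in> verts G" and "u \<noteq> v"
  using assms by (fastforce simp: fin_simple_graph_def)+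

lemma fin_simple_completion:
  assumes "fin_simple_graph G"
  shows "fin_simple_graph (nbr_completion G v)"
proof -
  have "i \<in> verts G" if "{v, i} \<in> edges G" for i
    using edgeD[OF assms that] by simp
  then show ?thesis
    using assms by (auto simp: fin_simple_graph_def edges_completion)
qed

lemma joined_sym: "joined G u v \<Longrightarrow> joined G v u"
proof -
  have "sym ((adj_rel G)\<^sup>*)"
    by (intro sym_rtrancl) (auto simp: sym_def adj_rel_def insert_commute)
  then show "joined G u v \<Longrightarrow> joined G v u"
    by (rule symD)
qed

lemma joined_trans: "joined G u v \<Longrightarrow> joined G v w \<Longrightarrow> joined G u w"
  by (rule rtrancl_trans)

lemma joined_edge: "{u, v} \<in> edges G \<Longrightarrow> joined G u v"
  by (auto simp: adj_rel_def)

text \<open>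
  Walks are transported along vertex maps that send each edge to a pair of joined vertices;
  retractions and contractions are of this kind.
\<close>

lemma joined_map:
  assumes "joined G u v"
    and "\<And>a b. {a, b} \<in> edges G \<Longrightarrow> joined H (\<pi> a) (\<pi> b)"
  shows "joined H (\<pi> u) (\<pi> v)"
  using assms(1)
proof (induction rule: rtrancl_induct)
  case (step y z)
  then show ?case
    using assms(2)[of y z] joined_trans by (fastforce simp: adj_rel_def)
qed simp

lemma joined_mono:
  assumes "joined G u v" and "edges G \<subseteq> edges H"
  shows "joined H u v"
proof -
  have "joined H (id u) (id v)"
    using assms(2) by (intro joined_map[OF assms(1)]) (auto intro: joined_edge)
  then show ?thesis by simp
qed

lemma joined_delete_mono:
  assumes "joined (delete_verts G T) u v" and "S \<subseteq> T"
  shows "joined (delete_verts G S) u v"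
proof (rule joined_mono[OF assms(1)])
  show "edges (delete_verts G T) \<subseteq> edges (delete_verts G S)"
    using assms(2) by (auto simp: edges_delete)
qed

definition comp_of :: "'a ugraph \<Rightarrow> 'a \<Rightarrow> 'a set" where
  "comp_of G u = {v \<in> verts G. joined G u v}"

lemma components_eq: "components G = comp_of G ` verts G"
  by (simp add: components_def comp_of_def[abs_def])

lemma comp_of_eq_iff:
  assumes "u \<in> verts G" and "v \<in> verts G"
  shows "comp_of G u = comp_of G v \<longleftrightarrow> joined G u v"
proof
  assume "comp_of G u = comp_of G v"
  then have "v \<in> comp_of G u"
    using assms(2) by (simp add: comp_of_def)
  then show "joined G u v"
    by (simp add: comp_of_def)
next
  assume "joined G u v"
  then have "joined G u w \<longleftrightarrow> joined G v w" for w
    using joined_trans[of u v G w] joined_trans[of v u G w] joined_sym[of u v G] by blast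
  then show "comp_of G u = comp_of G v"
    by (simp add: comp_of_def)
qed

lemma card_image_le_via:
  assumes "finite B" and "\<And>x. x \<in> A \<Longrightarrow> \<sigma> x \<in> B"
    and "\<And>x y. \<lbrakk>x \<in> A; y \<in> A; g (\<sigma> x) = g (\<sigma> y)\<rbrakk> \<Longrightarrow> f x = f y"
  shows "card (f ` A) \<le> card (g ` B)"
proof -
  define k where "k c = f (SOME x. x \<in> A \<and> g (\<sigma> x) = c)" for c
  have "f x = k (g (\<sigma> x))" if "x \<in> A" for x
  proof -
    have "\<exists>y. y \<in> A \<and> g (\<sigma> y) = g (\<sigma> x)"
      using that by blast
    from someI_ex[OF this] show ?thesis
      unfolding k_def using assms(3) that by metis
  qed
  then have "f ` A \<subseteq> k ` (g ` B)"
    using assms(2) by blast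
  then show ?thesis
    using assms(1) by (meson card_image_le card_mono finite_imageI le_trans)
qed

lemma card_image_less:
  assumes "finite B" and coarser: "\<And>x y. \<lbrakk>x \<in> B; y \<in> B; g x = g y\<rbrakk> \<Longrightarrow> f x = f y"
    and "u \<in> B" "v \<in> B" "f u = f v" "g u \<noteq> g v"
  shows "card (f ` B) < card (g ` B)"
proof -
  define B' where "B' = {x \<in> B. g x \<noteq> g v}"
  have "f ` B \<subseteq> f ` B'"
  proof
    fix c assume "c \<in> f ` B"
    then obtain x where x: "x \<in> B" "c = f x" by blast
    show "c \<in> f ` B'"
    proof (cases "g x = g v")
      case True
      then have "c = f u"
        using x coarser[of x v] assms(4,5) by simp
      then show ?thesis
        using assms(3,6) by (auto simp: B'_def)
    qed (use x in \<open>auto simp: B'_def\<close>)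
  qed
  then have "card (f ` B) \<le> card (f ` B')"
    using assms(1) by (intro card_mono) (auto simp: B'_def)
  also have "\<dots> \<le> card (g ` B')"
  proof (rule card_image_le_via[where \<sigma> = id])
    fix x y assume "x \<in> B'" "y \<in> B'" "g (id x) = g (id y)"
    then show "f x = f y"
      using coarser[of x y] by (simp add: B'_def)
  qed (use assms(1) in \<open>simp_all add: B'_def\<close>)
  also have "\<dots> < card (g ` B)"
  proof -
    have "g ` B' = g ` B - {g v}"
      by (auto simp: B'_def)
    then show ?thesis
      using assms(1,4) by (metis card_Diff1_less finite_imageI imageI)
  qed
  finally show ?thesis .
qed

text \<open>
  Numbers of components are compared by means of vertex maps that reflect, or preserve and
  reflect, being joined.
\<close>

lemma card_components_le:
  assumes "finite (verts H')" and "\<And>u. u \<in> verts H \<Longrightarrow> \<sigma> u \<in> verts H'"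
    and "\<And>u v. \<lbrakk>u \<in> verts H; v \<in> verts H; joined H' (\<sigma> u) (\<sigma> v)\<rbrakk> \<Longrightarrow> joined H u v"
  shows "card (components H) \<le> card (components H')"
  unfolding components_eq
  using assms by (intro card_image_le_via[where \<sigma> = \<sigma>]) (simp_all add: comp_of_eq_iff)

lemma card_components_eq:
  assumes "finite (verts H)" and onto: "\<pi> ` verts H = verts H'"
    and iff: "\<And>u v. \<lbrakk>u \<in> verts H; v \<in> verts H\<rbrakk> \<Longrightarrow> joined H' (\<pi> u) (\<pi> v) \<longleftrightarrow> joined H u v"
  shows "card (components H) = card (components H')"
proof (rule antisym)
  have fin: "finite (verts H')"
    using assms(1) unfolding onto[symmetric] by (rule finite_imageI)
  show "card (components H) \<le> card (components H')"
  proof (rule card_components_le[where \<sigma> = \<pi>, OF fin])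
    show "\<pi> u \<in> verts H'" if "u \<in> verts H" for u
      unfolding onto[symmetric] using that by (rule imageI)
  qed (rule iff[THEN iffD1])
  define \<tau> where "\<tau> = inv_into (verts H) \<pi>"
  have \<tau>: "\<tau> a \<in> verts H" "\<pi> (\<tau> a) = a" if "a \<in> verts H'" for a
    using that unfolding onto[symmetric] \<tau>_def by (rule inv_into_into, rule f_inv_into_f)
  show "card (components H') \<le> card (components H)"
  proof (rule card_components_le[where \<sigma> = \<tau>, OF assms(1) \<tau>(1)])
    fix a b assume ab: "a \<in> verts H'" "b \<in> verts H'" "joined H (\<tau> a) (\<tau> b)"
    show "joined H' a b"
      using iff[OF \<tau>(1)[OF ab(1)] \<tau>(1)[OF ab(2)]] ab(3) by (simp add: \<tau>(2) ab(1,2))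
  qed
qed

text \<open>A walk that is destroyed by the removal of \<open>t\<close> passes through \<open>t\<close>.\<close>

lemma surviving_neighbour:
  assumes "joined (delete_verts G (T - {t})) u v" and "\<not> joined (delete_verts G T) u v"
    and "fin_simple_graph G"
  shows "\<exists>k\<in>verts G - T. {t, k} \<in> edges G"
proof (rule ccontr)
  assume none: "\<not> ?thesis"
  have "edges (delete_verts G (T - {t})) \<subseteq> edges (delete_verts G T)"
  proof
    fix e assume e: "e \<in> edges (delete_verts G (T - {t}))"
    then obtain a b where ab: "e = {a, b}" "a \<noteq> b"
      using assms(3) by (auto simp: edges_delete fin_simple_graph_def card_2_iff)
    have "a \<noteq> t \<and> b \<noteq> t"
      using e ab none by (auto simp: edges_delete insert_commute)
    then show "e \<in> edges (delete_verts G T)"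
      using e ab by (auto simp: edges_delete)
  qed
  then show False
    using joined_mono[OF assms(1)] assms(2) by simp
qed

text \<open>
  If \<open>t\<close> has a surviving neighbour, then every component of \<open>G - (T - {t})\<close> meets \<open>G - T\<close>, and the
  components of \<open>G - T\<close> refine them. If \<open>t\<close> is isolated, nothing is separated and the number
  of components drops.
\<close>

lemma ncomp_less_iff:
  assumes G: "fin_simple_graph G" and t: "t \<in> T" "T \<subseteq> verts G"
  shows "ncomp G (T - {t}) < ncomp G T \<longleftrightarrow>
    (\<exists>u\<in>verts G - T. \<exists>v\<in>verts G - T.
       joined (delete_verts G (T - {t})) u v \<and> \<not> joined (delete_verts G T) u v)"
    (is "_ \<longleftrightarrow> ?sep")
proof
  assume less: "ncomp G (T - {t}) < ncomp G T"
  show ?sep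
  proof (rule ccontr)
    assume "\<not> ?sep"
    then have "card (components (delete_verts G T)) \<le> card (components (delete_verts G (T - {t})))"
      using G by (intro card_components_le[where \<sigma> = id]) (auto simp: fin_simple_graph_def)
    then show False
      using less by (simp add: ncomp_def)
  qed
next
  assume ?sep
  then obtain u v where uv: "u \<in> verts G - T" "v \<in> verts G - T"
    "joined (delete_verts G (T - {t})) u v" "\<not> joined (delete_verts G T) u v" by blast
  let ?f = "comp_of (delete_verts G (T - {t}))" and ?g = "comp_of (delete_verts G T)"
  obtain k where k: "{t, k} \<in> edges G" "k \<in> verts G - T"
    using surviving_neighbour[OF uv(3,4) G] by (elim bexE)
  have "joined (delete_verts G (T - {t})) t k"
    using k t by (intro joined_edge) (auto simp: edges_delete)
  then have "?f t = ?f k"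
    using k t by (subst comp_of_eq_iff) auto
  moreover have "verts G - (T - {t}) = insert t (verts G - T)"
    using t by blast
  ultimately have "?f ` verts (delete_verts G (T - {t})) = ?f ` (verts G - T)"
    using k by auto
  also have "card \<dots> < card (?g ` (verts G - T))"
  proof (rule card_image_less[where u = u and v = v])
    fix x y assume xy: "x \<in> verts G - T" "y \<in> verts G - T" "?g x = ?g y"
    then have "joined (delete_verts G (T - {t})) x y"
      by (intro joined_delete_mono[where T = T and S = "T - {t}"]) (auto simp: comp_of_eq_iff)
    then show "?f x = ?f y"
      using xy by (simp add: comp_of_eq_iff)
  qed (use G uv in \<open>simp_all add: comp_of_eq_iff fin_simple_graph_def\<close>)
  finally show "ncomp G (T - {t}) < ncomp G T"
    by (simp add: ncomp_def components_eq)
qed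

lemma cutset_iff:
  "cutset G T \<longleftrightarrow> T \<subseteq> verts G \<and> (\<forall>t\<in>T. ncomp G (T - {t}) < ncomp G T)"
proof -
  have "T - {t} \<union> {t} = T" if "t \<in> T" for t
    using that by blast
  then show ?thesis
    by (auto simp: cutset_def cut_vertex_def ncomp_def delete_delete)
qed

lemma cut_vertex_iff:
  assumes "fin_simple_graph G"
  shows "cut_vertex G v \<longleftrightarrow> v \<in> verts G \<and> ncomp G {} < ncomp G {v}"
  using assms by (simp add: cut_vertex_def ncomp_def delete_nothing)

lemma cutset_empty: "cutset G {}"
  by (simp add: cutset_def)

lemma cutset_singleton:
  assumes "fin_simple_graph G"
  shows "cutset G {v} \<longleftrightarrow> cut_vertex G v"
  using assms by (simp add: cutset_iff cut_vertex_iff)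

section \<open>Ideals of the polynomial ring\<close>

abbreviation xy_vars :: "'a set \<Rightarrow> 'a var set" where
  "xy_vars S \<equiv> X ` S \<union> Y ` S"

abbreviation minor :: "'a \<Rightarrow> 'a \<Rightarrow> ('a, 'k::field) xy_poly" where
  "minor i j \<equiv> pvar (X i) * pvar (Y j) - pvar (X j) * pvar (Y i)"

lemma carrier_iff: "p \<in> carrier (xy_ring V) \<longleftrightarrow> (\<forall>m\<in>Poly_Mapping.keys p. Poly_Mapping.keys m \<subseteq> xy_vars V)"
  by (auto simp: xy_ring_def vars_def)

lemma carrier_single: "Poly_Mapping.keys m \<subseteq> xy_vars V \<Longrightarrow> Poly_Mapping.single m c \<in> carrier (xy_ring V)"
  by (auto simp: carrier_iff)

lemma carrier_pvar: "z \<in> xy_vars V \<Longrightarrow> pvar z \<in> carrier (xy_ring V)"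
  unfolding pvar_def by (rule carrier_single) simp

lemma carrier_mult:
  "p \<in> carrier (xy_ring V) \<Longrightarrow> q \<in> carrier (xy_ring V) \<Longrightarrow> p * q \<in> carrier (xy_ring V)"
  using vars_mult[of p q] by (auto simp: xy_ring_def)

lemma carrier_add:
  "p \<in> carrier (xy_ring V) \<Longrightarrow> q \<in> carrier (xy_ring V) \<Longrightarrow> p + q \<in> carrier (xy_ring V)"
  using vars_add[of p q] by (auto simp: xy_ring_def)

lemma carrier_uminus: "p \<in> carrier (xy_ring V) \<Longrightarrow> - p \<in> carrier (xy_ring V)"
  by (simp add: xy_ring_def vars_uminus)

lemma carrier_diff:
  "p \<in> carrier (xy_ring V) \<Longrightarrow> q \<in> carrier (xy_ring V) \<Longrightarrow> p - q \<in> carrier (xy_ring V)"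
  using carrier_add[of p V "- q"] carrier_uminus[of q V] by simp

lemma carrier_0: "0 \<in> carrier (xy_ring V)" and carrier_1: "1 \<in> carrier (xy_ring V)"
  by (simp_all add: xy_ring_def vars_0 vars_1)

lemma carrier_power: "p \<in> carrier (xy_ring V) \<Longrightarrow> p ^ n \<in> carrier (xy_ring V)"
  by (induction n) (simp_all add: carrier_1 carrier_mult)

lemma carrier_sum:
  "(\<And>x. x \<in> A \<Longrightarrow> f x \<in> carrier (xy_ring V)) \<Longrightarrow> sum f A \<in> carrier (xy_ring V)"
  by (induction A rule: infinite_finite_induct) (simp_all add: carrier_0 carrier_add)

lemma carrier_minor:
  "i \<in> V \<Longrightarrow> j \<in> V \<Longrightarrow> minor i j \<in> carrier (xy_ring V)"
  by (intro carrier_diff carrier_mult carrier_pvar) auto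

text \<open>Ideals of \<open>xy_ring V\<close> in terms of the type class operations.\<close>

lemma xy_ring_ops:
  "mult (xy_ring V) = (*)" "add (xy_ring V) = (+)" "one (xy_ring V) = 1" "zero (xy_ring V) = 0"
  by (simp_all add: xy_ring_def)

lemma ideal_sub: "ideal I (xy_ring V) \<Longrightarrow> I \<subseteq> carrier (xy_ring V)"
  by (metis additive_subgroup.a_subset ideal.axioms(1))

lemma ideal_0: "ideal I (xy_ring V) \<Longrightarrow> 0 \<in> I"
  by (metis additive_subgroup.zero_closed ideal.axioms(1) xy_ring_ops(4))

lemma ideal_add: "ideal I (xy_ring V) \<Longrightarrow> p \<in> I \<Longrightarrow> q \<in> I \<Longrightarrow> p + q \<in> I"
  by (metis additive_subgroup.a_closed ideal.axioms(1) xy_ring_ops(2))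

lemma ideal_mult: "ideal I (xy_ring V) \<Longrightarrow> p \<in> carrier (xy_ring V) \<Longrightarrow> q \<in> I \<Longrightarrow> p * q \<in> I"
  by (metis ideal.I_l_closed xy_ring_ops(1))

lemma ideal_uminus:
  assumes "ideal I (xy_ring V)" and "p \<in> I"
  shows "- p \<in> I"
  using ideal_mult[OF assms(1) carrier_uminus[OF carrier_1] assms(2)] by simp

lemma ideal_diff: "ideal I (xy_ring V) \<Longrightarrow> p \<in> I \<Longrightarrow> q \<in> I \<Longrightarrow> p - q \<in> I"
  using ideal_add[of I V p "- q"] ideal_uminus[of I V q] by simp

lemma ideal_sum:
  "ideal I (xy_ring V) \<Longrightarrow> (\<And>x. x \<in> A \<Longrightarrow> f x \<in> I) \<Longrightarrow> sum f A \<in> I"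
  by (induction A rule: infinite_finite_induct) (simp_all add: ideal_0 ideal_add)

lemma idealI_xy:
  assumes "I \<subseteq> carrier (xy_ring V)" and "0 \<in> I"
    and "\<And>p q. p \<in> I \<Longrightarrow> q \<in> I \<Longrightarrow> p + q \<in> I"
    and mult: "\<And>p q. p \<in> carrier (xy_ring V) \<Longrightarrow> q \<in> I \<Longrightarrow> p * q \<in> I"
  shows "ideal I (xy_ring V :: ('a, 'k::field) xy_poly ring)"
proof -
  let ?R = "xy_ring V :: ('a, 'k) xy_poly ring"
  interpret cring ?R by (rule cring_xy_ring)
  have inv: "\<ominus>\<^bsub>?R\<^esub> p = - p" if "p \<in> carrier ?R" for p
    using minus_equality[of "- p" p] that by (simp add: xy_ring_ops carrier_uminus)
  have neg: "- p \<in> I" if "p \<in> I" for p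
    using mult[OF carrier_uminus[OF carrier_1] that] by simp
  have "subgroup I (add_monoid ?R)"
  proof (rule subgroup.intro)
    show "inv\<^bsub>add_monoid ?R\<^esub> p \<in> I" if "p \<in> I" for p
      using that neg assms(1) inv[unfolded a_inv_def] by auto
  qed (use assms(1-3) in \<open>auto simp: xy_ring_ops\<close>)
  moreover have "q * p \<in> I" if "q \<in> I" "p \<in> carrier ?R" for p q
    using mult[OF that(2,1)] by (simp only: mult.commute)
  ultimately show ?thesis
    using mult by (intro idealI ring_axioms) (auto simp: xy_ring_ops)
qed

lemma prime_mult:
  assumes "primeideal P (xy_ring V)" and "p * q \<in> P"
    and "p \<in> carrier (xy_ring V)" and "q \<in> carrier (xy_ring V)"
  shows "p \<in> P \<or> q \<in> P"
  using primeideal.I_prime[OF assms(1,3,4)] assms(2) by (simp add: xy_ring_ops)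

lemma prime_ideal: "primeideal P R \<Longrightarrow> ideal P R"
  by (simp add: primeideal_def)

lemma single_eq_0_iff: "Poly_Mapping.single m c = 0 \<longleftrightarrow> c = 0"
  by (metis lookup_single_eq lookup_zero single_zero)

section \<open>Linear extensions of monomial maps\<close>

lemma poly_expand: "p = (\<Sum>m\<in>Poly_Mapping.keys p. Poly_Mapping.single m (Poly_Mapping.lookup p m))"
proof (rule poly_mapping_eqI)
  fix k
  have "(\<Sum>m\<in>Poly_Mapping.keys p. Poly_Mapping.lookup (Poly_Mapping.single m (Poly_Mapping.lookup p m)) k)
      = (\<Sum>m\<in>Poly_Mapping.keys p. if m = k then Poly_Mapping.lookup p m else 0)"
    by (intro sum.cong) (auto simp: lookup_single when_def)
  then show "Poly_Mapping.lookup p k =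
      Poly_Mapping.lookup (\<Sum>m\<in>Poly_Mapping.keys p. Poly_Mapping.single m (Poly_Mapping.lookup p m)) k"
    by (simp add: lookup_sum in_keys_iff)
qed

text \<open>
  With \<open>N\<close> the set of monomials avoiding certain variables, these variables are set to \<open>0\<close>.
\<close>

definition monomial_map ::
    "'m set \<Rightarrow> ('m \<Rightarrow> 'n) \<Rightarrow> ('m \<Rightarrow>\<^sub>0 'k) \<Rightarrow> ('n \<Rightarrow>\<^sub>0 'k::comm_ring_1)" where
  "monomial_map N \<mu> p =
     (\<Sum>m\<in>Poly_Mapping.keys p. Poly_Mapping.single (\<mu> m) (Poly_Mapping.lookup p m) when m \<in> N)"

lemma monomial_map_superset:
  assumes "finite A" and "Poly_Mapping.keys p \<subseteq> A"
  shows "monomial_map N \<mu> p =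
    (\<Sum>m\<in>A. Poly_Mapping.single (\<mu> m) (Poly_Mapping.lookup p m) when m \<in> N)"
  unfolding monomial_map_def
  using assms by (intro sum.mono_neutral_left) (auto simp: in_keys_iff)

lemma monomial_map_add: "monomial_map N \<mu> (p + q) = monomial_map N \<mu> p + monomial_map N \<mu> q"
proof -
  let ?A = "Poly_Mapping.keys p \<union> Poly_Mapping.keys q"
  have "monomial_map N \<mu> (p + q) =
      (\<Sum>m\<in>?A. Poly_Mapping.single (\<mu> m) (Poly_Mapping.lookup (p + q) m) when m \<in> N)"
    by (rule monomial_map_superset) (use Poly_Mapping.keys_add[of p q] in auto)
  also have "\<dots> = (\<Sum>m\<in>?A. Poly_Mapping.single (\<mu> m) (Poly_Mapping.lookup p m) when m \<in> N) +
      (\<Sum>m\<in>?A. Poly_Mapping.single (\<mu> m) (Poly_Mapping.lookup q m) when m \<in> N)"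
    by (simp add: lookup_add single_add when_add_distrib sum.distrib)
  finally show ?thesis
    by (simp add: monomial_map_superset[of ?A])
qed

lemma monomial_map_0 [simp]: "monomial_map N \<mu> 0 = 0"
  by (simp add: monomial_map_def)

lemma monomial_map_single:
  "monomial_map N \<mu> (Poly_Mapping.single m c) = (Poly_Mapping.single (\<mu> m) c when m \<in> N)"
  by (cases "c = 0") (simp_all add: monomial_map_def)

lemma monomial_map_sum: "monomial_map N \<mu> (sum f A) = (\<Sum>x\<in>A. monomial_map N \<mu> (f x))"
  by (induction A rule: infinite_finite_induct) (simp_all add: monomial_map_add)

lemma monomial_map_mult:
  fixes \<mu> :: "'m::comm_monoid_add \<Rightarrow> 'n::comm_monoid_add"
  assumes \<mu>: "\<And>a b. \<mu> (a + b) = \<mu> a + \<mu> b" and N: "\<And>a b. a + b \<in> N \<longleftrightarrow> a \<in> N \<and> b \<in> N"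
  shows "monomial_map N \<mu> (p * q) = monomial_map N \<mu> p * monomial_map N \<mu> q"
proof -
  let ?s = "\<lambda>p m. Poly_Mapping.single m (Poly_Mapping.lookup p m)"
  have single: "monomial_map N \<mu> (?s p a * ?s q b) =
      monomial_map N \<mu> (?s p a) * monomial_map N \<mu> (?s q b)" for a b
    by (simp add: mult_single monomial_map_single \<mu> N when_def)
  have "p * q = (\<Sum>a\<in>Poly_Mapping.keys p. \<Sum>b\<in>Poly_Mapping.keys q. ?s p a * ?s q b)"
    by (subst poly_expand[of p], subst poly_expand[of q]) (rule sum_product)
  then have "monomial_map N \<mu> (p * q) = (\<Sum>a\<in>Poly_Mapping.keys p. \<Sum>b\<in>Poly_Mapping.keys q.
      monomial_map N \<mu> (?s p a) * monomial_map N \<mu> (?s q b))"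
    by (simp add: monomial_map_sum single)
  also have "\<dots> = monomial_map N \<mu> (\<Sum>a\<in>Poly_Mapping.keys p. ?s p a) *
      monomial_map N \<mu> (\<Sum>b\<in>Poly_Mapping.keys q. ?s q b)"
    by (simp add: monomial_map_sum sum_product)
  finally show ?thesis
    by (simp flip: poly_expand)
qed

lemma lookup_monomial_map:
  "Poly_Mapping.lookup (monomial_map N \<mu> p) w =
     (\<Sum>m | m \<in> Poly_Mapping.keys p \<and> m \<in> N \<and> \<mu> m = w. Poly_Mapping.lookup p m)"
proof -
  have "Poly_Mapping.lookup (monomial_map N \<mu> p) w =
      (\<Sum>m\<in>Poly_Mapping.keys p. if m \<in> N \<and> \<mu> m = w then Poly_Mapping.lookup p m else 0)"
    unfolding monomial_map_def lookup_sum
    by (intro sum.cong) (auto simp: lookup_single when_def)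
  then show ?thesis
    by (simp add: sum.If_cases Int_def conj_commute flip: sum.inter_filter)
qed

section \<open>The toric primes\<close>

text \<open>
  For \<open>T \<subseteq> V\<close> and a labelling \<open>r\<close> of the vertices, consider the homomorphism with
  \<open>x\<^sub>i \<mapsto> a\<^sub>i u\<^bsub>r i\<^esub>\<close> and \<open>y\<^sub>i \<mapsto> a\<^sub>i w\<^bsub>r i\<^esub>\<close> for \<open>i \<notin> T\<close>, and \<open>x\<^sub>i, y\<^sub>i \<mapsto> 0\<close> for \<open>i \<in> T\<close>. Its target
  is a polynomial ring, hence a domain, so its kernel is prime. The indeterminates
  \<open>a\<^sub>i\<close>, \<open>u\<^sub>c\<close>, \<open>w\<^sub>c\<close> are numbered \<open>3 h i\<close>, \<open>3 h c + 1\<close>, \<open>3 h c + 2\<close> by means of an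
  injection \<open>h\<close> into the natural numbers: the resulting linear order of the monomials shows that
  the target has no zero divisors. The labels are vertices themselves.
\<close>

locale numbered_verts =
  fixes V :: "'a set" and h :: "'a \<Rightarrow> nat"
  assumes finV: "finite V" and inj: "inj_on h V"
begin

text \<open>The exponent of the \<open>k\<close>-th indeterminate in the image of \<open>m\<close>.\<close>

definition expo :: "('a \<Rightarrow> 'a) \<Rightarrow> ('a var \<Rightarrow>\<^sub>0 nat) \<Rightarrow> nat \<Rightarrow> nat" where
  "expo r m k =
     (if k mod 3 = 0 then \<Sum>i | i \<in> V \<and> h i = k div 3. Poly_Mapping.lookup m (X i) + Poly_Mapping.lookup m (Y i)
      else if k mod 3 = 1 then \<Sum>i | i \<in> V \<and> h (r i) = k div 3. Poly_Mapping.lookup m (X i)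
      else \<Sum>i | i \<in> V \<and> h (r i) = k div 3. Poly_Mapping.lookup m (Y i))"

definition \<mu> :: "('a \<Rightarrow> 'a) \<Rightarrow> ('a var \<Rightarrow>\<^sub>0 nat) \<Rightarrow> (nat \<Rightarrow>\<^sub>0 nat)" where
  "\<mu> r m = Abs_poly_mapping (expo r m)"

lemma lookup_\<mu>: "Poly_Mapping.lookup (\<mu> r m) k = expo r m k"
proof -
  have sub: "{k. expo r m k \<noteq> 0} \<subseteq> (\<Union>n\<in>h ` V \<union> (h \<circ> r) ` V. {3 * n, 3 * n + 1, 3 * n + 2})"
  proof
    fix k assume k: "k \<in> {k. expo r m k \<noteq> 0}"
    have "k div 3 \<in> h ` V \<union> (h \<circ> r) ` V"
    proof (rule ccontr)
      assume "k div 3 \<notin> h ` V \<union> (h \<circ> r) ` V"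
      then have none: "h i \<noteq> k div 3 \<and> h (r i) \<noteq> k div 3" if "i \<in> V" for i
        using that by (metis UnCI comp_apply imageI)
      have "{i. i \<in> V \<and> h i = k div 3} = {}" "{i. i \<in> V \<and> h (r i) = k div 3} = {}"
        using none by blast+
      then have "expo r m k = 0"
        unfolding expo_def by (simp only: sum.empty if_cancel)
      then show False
        using k by simp
    qed
    moreover have "k \<in> {3 * (k div 3), 3 * (k div 3) + 1, 3 * (k div 3) + 2}"
      by auto
    ultimately show "k \<in> (\<Union>n\<in>h ` V \<union> (h \<circ> r) ` V. {3 * n, 3 * n + 1, 3 * n + 2})"
      by blast
  qed
  have "finite {k. expo r m k \<noteq> 0}"
    by (rule finite_subset[OF sub]) (use finV in simp)
  then show ?thesis
    by (simp add: \<mu>_def)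
qed

lemma \<mu>_add: "\<mu> r (m + m') = \<mu> r m + \<mu> r m'"
  by (rule poly_mapping_eqI) (simp add: lookup_\<mu> lookup_add expo_def sum.distrib)

lemma \<mu>_0: "\<mu> r 0 = 0"
  by (rule poly_mapping_eqI) (simp add: lookup_\<mu> expo_def)

lemma X_neq_Y: "(X :: 'a \<Rightarrow> 'a var) \<noteq> Y" "(Y :: 'a \<Rightarrow> 'a var) \<noteq> X"
  by (metis var.distinct(1))+

lemma \<mu>_vertex:
  assumes "i \<in> V"
  shows "Poly_Mapping.lookup (\<mu> r m) (3 * h i) =
    Poly_Mapping.lookup m (X i) + Poly_Mapping.lookup m (Y i)"
proof -
  have "{j. j \<in> V \<and> h j = h i} = {i}"
    using assms inj by (auto simp: inj_on_def)
  then show ?thesis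
    by (simp add: lookup_\<mu> expo_def)
qed

lemma \<mu>_label:
  assumes "c \<in> V" and "r ` V \<subseteq> V" and "\<xi> = X \<or> \<xi> = Y"
  shows "Poly_Mapping.lookup (\<mu> r m) (3 * h c + (if \<xi> = X then 1 else 2)) =
    (\<Sum>i | i \<in> V \<and> r i = c. Poly_Mapping.lookup m (\<xi> i))"
proof -
  have "{i. i \<in> V \<and> h (r i) = h c} = {i. i \<in> V \<and> r i = c}"
    using assms(1,2) inj by (auto simp: inj_on_def)
  moreover have "(3 * h c + 1) div 3 = h c" "(3 * h c + 2) div 3 = h c"
    "(3 * h c + 1) mod 3 = 1" "(3 * h c + 2) mod 3 = 2"
    by presburger+
  ultimately show ?thesis
    using assms(3) X_neq_Y by (auto simp: lookup_\<mu> expo_def)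
qed

definition avoiding :: "'a set \<Rightarrow> ('a var \<Rightarrow>\<^sub>0 nat) set" where
  "avoiding T = {m. Poly_Mapping.keys m \<inter> xy_vars T = {}}"

lemma keys_add_nat: "Poly_Mapping.keys (m + m' :: 'b \<Rightarrow>\<^sub>0 nat) = Poly_Mapping.keys m \<union> Poly_Mapping.keys m'"
  by (auto simp: in_keys_iff lookup_add)

lemma avoiding_add: "m + m' \<in> avoiding T \<longleftrightarrow> m \<in> avoiding T \<and> m' \<in> avoiding T"
  by (auto simp: avoiding_def keys_add_nat)

definition \<Phi> :: "'a set \<Rightarrow> ('a \<Rightarrow> 'a) \<Rightarrow> ('a, 'k::field) xy_poly \<Rightarrow> (nat \<Rightarrow>\<^sub>0 nat) \<Rightarrow>\<^sub>0 'k" where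
  "\<Phi> T r = monomial_map (avoiding T) (\<mu> r)"

definition toric :: "'a set \<Rightarrow> ('a \<Rightarrow> 'a) \<Rightarrow> ('a, 'k::field) xy_poly set" where
  "toric T r = {p \<in> carrier (xy_ring V). \<Phi> T r p = 0}"

lemma \<Phi>_mult: "\<Phi> T r (p * q) = \<Phi> T r p * \<Phi> T r q"
  unfolding \<Phi>_def by (rule monomial_map_mult) (simp_all add: \<mu>_add avoiding_add)

lemma \<Phi>_add: "\<Phi> T r (p + q) = \<Phi> T r p + \<Phi> T r q"
  by (simp add: \<Phi>_def monomial_map_add)

lemma \<Phi>_0: "\<Phi> T r 0 = 0"
  by (simp add: \<Phi>_def)

lemma \<Phi>_1: "\<Phi> T r 1 = 1"
  unfolding single_one[symmetric]
  by (simp add: \<Phi>_def monomial_map_single \<mu>_0 avoiding_def del: single_one)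

lemma \<Phi>_diff: "\<Phi> T r (p - q) = \<Phi> T r p - \<Phi> T r q"
  using \<Phi>_add[of T r "p - q" q] by simp

lemma toric_prime: "primeideal (toric T r) (xy_ring V :: ('a, 'k::field) xy_poly ring)"
proof (rule primeidealI)
  show "cring (xy_ring V :: ('a, 'k) xy_poly ring)"
    by (rule cring_xy_ring)
  show "ideal (toric T r) (xy_ring V :: ('a, 'k) xy_poly ring)"
    by (rule idealI_xy)
      (auto simp: toric_def \<Phi>_mult \<Phi>_add \<Phi>_0 carrier_0 carrier_add carrier_mult)
  show "carrier (xy_ring V :: ('a, 'k) xy_poly ring) \<noteq> toric T r"
  proof
    assume eq: "carrier (xy_ring V :: ('a, 'k) xy_poly ring) = toric T r"
    have "(1 :: ('a, 'k) xy_poly) \<in> toric T r"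
      unfolding eq[symmetric] by (rule carrier_1)
    then show False
      by (simp add: toric_def \<Phi>_1)
  qed
  show "p \<in> toric T r \<or> q \<in> toric T r"
    if "p \<in> carrier (xy_ring V :: ('a, 'k) xy_poly ring)" "q \<in> carrier (xy_ring V)"
      "p \<otimes>\<^bsub>xy_ring V\<^esub> q \<in> toric T r" for p q
    using that by (auto simp: toric_def xy_ring_ops \<Phi>_mult)
qed

lemma \<Phi>_single: "\<Phi> T r (Poly_Mapping.single m c) = (Poly_Mapping.single (\<mu> r m) c when m \<in> avoiding T)"
  by (simp add: \<Phi>_def monomial_map_single)

lemma toric_pvar_iff:
  assumes "i \<in> V"
  shows "(pvar (X i) :: ('a, 'k::field) xy_poly) \<in> toric T r \<longleftrightarrow> i \<in> T"
    and "(pvar (Y i) :: ('a, 'k) xy_poly) \<in> toric T r \<longleftrightarrow> i \<in> T"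
proof -
  have "(pvar (\<xi> i) :: ('a, 'k) xy_poly) \<in> toric T r \<longleftrightarrow> i \<in> T" if "\<xi> = X \<or> \<xi> = Y" for \<xi>
  proof -
    have "\<xi> i \<in> xy_vars V" "\<xi> i \<in> xy_vars T \<longleftrightarrow> i \<in> T"
      using assms that by auto
    moreover from this(1) have "(pvar (\<xi> i) :: ('a, 'k) xy_poly) \<in> carrier (xy_ring V)"
      by (rule carrier_pvar)
    ultimately show ?thesis
      by (simp add: toric_def pvar_def \<Phi>_single avoiding_def when_def single_eq_0_iff)
  qed
  then show "(pvar (X i) :: ('a, 'k) xy_poly) \<in> toric T r \<longleftrightarrow> i \<in> T"
    "(pvar (Y i) :: ('a, 'k) xy_poly) \<in> toric T r \<longleftrightarrow> i \<in> T" by blast+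
qed

text \<open>This is why minors of two vertices with equal labels lie in the kernel.\<close>

lemma \<mu>_exchange:
  assumes "i \<in> V" "j \<in> V" "r i = r j"
  shows "\<mu> r (Poly_Mapping.single (X i) 1 + Poly_Mapping.single (Y j) 1) =
    \<mu> r (Poly_Mapping.single (X j) 1 + Poly_Mapping.single (Y i) 1)"
proof (rule poly_mapping_eqI)
  fix k
  have count: "(\<Sum>l | l \<in> V \<and> P l. if i = l then Suc 0 else 0) = (if P i then Suc 0 else 0)"
    "(\<Sum>l | l \<in> V \<and> P l. if j = l then Suc 0 else 0) = (if P j then Suc 0 else 0)" for P
    using assms finV by simp_all
  show "Poly_Mapping.lookup (\<mu> r (Poly_Mapping.single (X i) 1 + Poly_Mapping.single (Y j) 1)) k =
      Poly_Mapping.lookup (\<mu> r (Poly_Mapping.single (X j) 1 + Poly_Mapping.single (Y i) 1)) k"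
    using assms
    by (simp add: lookup_\<mu> expo_def lookup_add lookup_single when_def sum.distrib count)
qed

lemma toric_minor_iff:
  assumes ij: "i \<in> V" "j \<in> V" and r: "r ` V \<subseteq> V"
  shows "(minor i j :: ('a, 'k::field) xy_poly) \<in> toric T r \<longleftrightarrow> i \<in> T \<or> j \<in> T \<or> r i = r j"
proof (cases "i \<in> T \<or> j \<in> T")
  case True
  have "(minor i j :: ('a, 'k) xy_poly) \<in> toric T r"
    using True carrier_minor[OF ij]
    by (auto simp: toric_def \<Phi>_diff pvar_def mult_single \<Phi>_single avoiding_def keys_add_nat)
  then show ?thesis
    using True by blast
next
  case False
  let ?m = "\<lambda>i j. Poly_Mapping.single (X i) 1 + Poly_Mapping.single (Y j) (1::nat)"
  have \<Phi>: "\<Phi> T r (minor i j :: ('a, 'k) xy_poly) =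
      Poly_Mapping.single (\<mu> r (?m i j)) 1 - Poly_Mapping.single (\<mu> r (?m j i)) 1"
  proof -
    have "?m a b \<in> avoiding T" if "a \<notin> T" "b \<notin> T" for a b
      using that by (auto simp: avoiding_def keys_add_nat)
    then show ?thesis
      using False by (simp add: \<Phi>_diff pvar_def mult_single \<Phi>_single)
  qed
  show ?thesis
  proof (cases "r i = r j")
    case True
    then show ?thesis
      using carrier_minor[OF ij] \<mu>_exchange[OF ij True] \<Phi> by (simp add: toric_def)
  next
    case ne: False
    have "Poly_Mapping.lookup (\<mu> r (?m i j)) (3 * h (r i) + (if (X :: 'a \<Rightarrow> 'a var) = X then 1 else 2)) \<noteq>
        Poly_Mapping.lookup (\<mu> r (?m j i)) (3 * h (r i) + (if (X :: 'a \<Rightarrow> 'a var) = X then 1 else 2))"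
    proof -
      have "r i \<in> V"
        using ij r by blast
      moreover have "(\<Sum>l | l \<in> V \<and> r l = r i. Poly_Mapping.lookup (?m i j) (X l)) = 1"
        using ij finV by (simp add: lookup_add lookup_single when_def)
      moreover have "(\<Sum>l | l \<in> V \<and> r l = r i. Poly_Mapping.lookup (?m j i) (X l)) = 0"
        using ne finV by (auto simp: lookup_add lookup_single when_def)
      ultimately show ?thesis
        using \<mu>_label[of "r i" r X] r by simp
    qed
    then have "\<mu> r (?m i j) \<noteq> \<mu> r (?m j i)"
      by metis
    then have "\<Phi> T r (minor i j :: ('a, 'k) xy_poly) \<noteq> 0"
      unfolding \<Phi> by (metis inj_single lookup_single_eq lookup_single_not_eq right_minus_eq zero_neq_one)
    then show ?thesis
      using False ne by (simp add: toric_def)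
  qed
qed

end

lemma split_variable:
  assumes "z \<in> Poly_Mapping.keys m"
  shows "m = Poly_Mapping.single z (1::nat) + (m - Poly_Mapping.single z 1)"
  using assms
  by (intro poly_mapping_eqI) (auto simp: lookup_add lookup_minus lookup_single when_def in_keys_iff)

lemma single_var_mult:
  "Poly_Mapping.single (Poly_Mapping.single z 1 + m) c = pvar z * Poly_Mapping.single m c"
  by (simp add: pvar_def mult_single)

context numbered_verts
begin

text \<open>
  The core of the generation statement. Two monomials with the same image are
  connected by exchanges \<open>x\<^sub>j y\<^sub>i \<rightarrow> x\<^sub>i y\<^sub>j\<close> with \<open>r i = r j\<close>: if a variable of \<open>m\<close> at vertex \<open>i\<close> is
  missing in \<open>m'\<close>, comparing exponents provides in \<open>m'\<close> the other variable at \<open>i\<close> and the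
  same kind of variable at some \<open>j\<close> with the same label, and after their exchange a common
  variable can be cancelled.
\<close>

lemma binomial_in_ideal:
  fixes I :: "('a, 'k::field) xy_poly set"
  assumes I: "ideal I (xy_ring V)" and r: "r ` V \<subseteq> V"
    and minors: "\<And>i j. \<lbrakk>i \<in> V - T; j \<in> V - T; r i = r j\<rbrakk> \<Longrightarrow> minor i j \<in> I"
    and "Poly_Mapping.keys m \<subseteq> xy_vars (V - T)" "Poly_Mapping.keys m' \<subseteq> xy_vars (V - T)"
    and "\<mu> r m = \<mu> r m'"
  shows "Poly_Mapping.single m 1 - Poly_Mapping.single m' 1 \<in> I"
  using assms(4-6)
proof (induction "\<Sum>z\<in>xy_vars V. Poly_Mapping.lookup m z" arbitrary: m m' rule: less_induct)
  case less
  have cancel: "Poly_Mapping.single m 1 - Poly_Mapping.single n 1 \<in> I"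
    if z: "z \<in> Poly_Mapping.keys m" "z \<in> Poly_Mapping.keys n"
      and n: "Poly_Mapping.keys n \<subseteq> xy_vars (V - T)" "\<mu> r m = \<mu> r n" for z n
  proof -
    define m1 n1 where "m1 = m - Poly_Mapping.single z 1" and "n1 = n - Poly_Mapping.single z 1"
    have split: "m = Poly_Mapping.single z 1 + m1" "n = Poly_Mapping.single z 1 + n1"
      unfolding m1_def n1_def by (rule split_variable[OF z(1)], rule split_variable[OF z(2)])
    have zV: "z \<in> xy_vars V"
      using z(1) less.prems(1) by blast
    have "Poly_Mapping.single m1 1 - Poly_Mapping.single n1 1 \<in> I"
    proof (rule less.hyps)
      have "(\<Sum>y\<in>xy_vars V. Poly_Mapping.lookup m y) =
          (\<Sum>y\<in>xy_vars V. if z = y then Suc 0 else 0) + (\<Sum>y\<in>xy_vars V. Poly_Mapping.lookup m1 y)"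
        by (simp add: split(1) lookup_add lookup_single when_def sum.distrib)
      also have "(\<Sum>y\<in>xy_vars V. if z = y then Suc 0 else 0) = 1"
        using zV finV by (subst sum.delta') auto
      finally show "(\<Sum>y\<in>xy_vars V. Poly_Mapping.lookup m1 y) < (\<Sum>y\<in>xy_vars V. Poly_Mapping.lookup m y)"
        by simp
      show "Poly_Mapping.keys m1 \<subseteq> xy_vars (V - T)" "Poly_Mapping.keys n1 \<subseteq> xy_vars (V - T)"
        using less.prems(1) n(1) by (auto simp: split keys_add_nat)
      show "\<mu> r m1 = \<mu> r n1"
        using n(2) by (simp add: split \<mu>_add)
    qed
    then have "pvar z * (Poly_Mapping.single m1 1 - Poly_Mapping.single n1 1) \<in> I"
      by (rule ideal_mult[OF I carrier_pvar[OF zV]])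
    then show ?thesis
      by (simp add: split single_var_mult right_diff_distrib del: One_nat_def)
  qed
  show ?case
  proof (cases "Poly_Mapping.keys m = {}")
    case True
    then have "m = 0" by simp
    have "Poly_Mapping.lookup m' (\<xi> i) = 0" if "i \<in> V" "\<xi> = X \<or> \<xi> = Y" for \<xi> i
      using \<mu>_vertex[OF that(1), of r m'] \<mu>_vertex[OF that(1), of r m] less.prems(3) \<open>m = 0\<close> that(2)
      by auto
    then have "m' = 0"
      using less.prems(2) by (intro poly_mapping_eqI) (auto simp: in_keys_iff subset_iff image_iff)
    then show ?thesis
      using \<open>m = 0\<close> ideal_0[OF I] by simp
  next
    case False
    then obtain \<xi> \<eta> :: "'a \<Rightarrow> 'a var" and i where i: "i \<in> V - T" "\<xi> i \<in> Poly_Mapping.keys m"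
      and \<xi>\<eta>: "\<xi> = X \<and> \<eta> = Y \<or> \<xi> = Y \<and> \<eta> = X"
      using less.prems(1) by blast
    have \<xi>: "\<xi> = X \<or> \<xi> = Y"
      using \<xi>\<eta> by blast
    have distinct: "\<xi> a \<noteq> \<eta> b" for a b
      using \<xi>\<eta> by auto
    show ?thesis
    proof (cases "\<xi> i \<in> Poly_Mapping.keys m'")
      case True
      then show ?thesis
        using cancel i(2) less.prems by blast
    next
      case no: False
      have "Poly_Mapping.lookup m (X i) + Poly_Mapping.lookup m (Y i) =
          Poly_Mapping.lookup m' (X i) + Poly_Mapping.lookup m' (Y i)"
        using \<mu>_vertex[of i r m] \<mu>_vertex[of i r m'] i(1) less.prems(3) by simp
      then have \<eta>i: "\<eta> i \<in> Poly_Mapping.keys m'"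
        using i(2) no \<xi>\<eta> by (auto simp: in_keys_iff)
      have riV: "r i \<in> V"
        using i(1) r by blast
      have "(\<Sum>l | l \<in> V \<and> r l = r i. Poly_Mapping.lookup m (\<xi> l)) =
          (\<Sum>l | l \<in> V \<and> r l = r i. Poly_Mapping.lookup m' (\<xi> l))"
        using \<mu>_label[OF riV r \<xi>, of m] \<mu>_label[OF riV r \<xi>, of m'] less.prems(3) by simp
      moreover have "(\<Sum>l | l \<in> V \<and> r l = r i. Poly_Mapping.lookup m (\<xi> l)) \<noteq> 0"
        using i finV by (auto simp: in_keys_iff)
      ultimately obtain j where j: "j \<in> V" "r j = r i" "Poly_Mapping.lookup m' (\<xi> j) \<noteq> 0"
        by (metis (mono_tags, lifting) mem_Collect_eq sum.not_neutral_contains_not_neutral)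
      have \<xi>j: "\<xi> j \<in> Poly_Mapping.keys m'"
        using j(3) by (simp add: in_keys_iff)
      then have jT: "j \<in> V - T"
        using less.prems(2) \<xi> by auto
      define m3 where "m3 = m' - Poly_Mapping.single (\<eta> i) 1"
      define m2 where "m2 = m3 - Poly_Mapping.single (\<xi> j) 1"
      have m'3: "m' = Poly_Mapping.single (\<eta> i) 1 + m3"
        unfolding m3_def by (rule split_variable[OF \<eta>i])
      have "\<xi> j \<in> Poly_Mapping.keys m3"
        using \<xi>j distinct[of j i] by (simp add: m'3 keys_add_nat)
      then have m3: "m3 = Poly_Mapping.single (\<xi> j) 1 + m2"
        unfolding m2_def by (rule split_variable)
      define m'' where "m'' = Poly_Mapping.single (\<xi> i) 1 + (Poly_Mapping.single (\<eta> j) 1 + m2)"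
      have m2: "Poly_Mapping.keys m2 \<subseteq> xy_vars (V - T)"
        using less.prems(2) by (simp add: m'3 m3 keys_add_nat)
      then have keys'': "Poly_Mapping.keys m'' \<subseteq> xy_vars (V - T)"
        using i(1) jT \<xi>\<eta> by (auto simp: m''_def keys_add_nat)
      have "\<mu> r (Poly_Mapping.single (\<xi> i) 1 + Poly_Mapping.single (\<eta> j) 1) =
          \<mu> r (Poly_Mapping.single (\<eta> i) 1 + Poly_Mapping.single (\<xi> j) 1)"
        using \<xi>\<eta> \<mu>_exchange[of i j r] \<mu>_exchange[of j i r] i(1) j(1,2) by (auto simp: add.commute)
      then have \<mu>'': "\<mu> r m'' = \<mu> r m'"
        by (simp add: m''_def m'3 m3 \<mu>_add flip: add.assoc)
      have "Poly_Mapping.single m 1 - Poly_Mapping.single m'' 1 \<in> I"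
        using i(2) keys'' \<mu>'' less.prems(3)
        by (intro cancel[of "\<xi> i"]) (simp_all add: m''_def keys_add_nat)
      moreover have "Poly_Mapping.single m'' 1 - Poly_Mapping.single m' 1 \<in> I"
      proof -
        have "pvar (\<xi> i) * pvar (\<eta> j) - pvar (\<xi> j) * pvar (\<eta> i) \<in> I"
          using \<xi>\<eta> minors[OF i(1) jT] minors[OF jT i(1)] j(2) by (auto simp: mult.commute)
        then have "Poly_Mapping.single m2 1 * (pvar (\<xi> i) * pvar (\<eta> j) - pvar (\<xi> j) * pvar (\<eta> i)) \<in> I"
          using m2 by (intro ideal_mult[OF I] carrier_single) auto
        moreover have "Poly_Mapping.single m2 1 * (pvar (\<xi> i) * pvar (\<eta> j) - pvar (\<xi> j) * pvar (\<eta> i)) =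
            Poly_Mapping.single m'' 1 - Poly_Mapping.single m' (1::'k)"
          unfolding m''_def m'3 m3 single_var_mult by (simp add: algebra_simps)
        ultimately show ?thesis by simp
      qed
      ultimately have "(Poly_Mapping.single m 1 - Poly_Mapping.single m'' 1) +
          (Poly_Mapping.single m'' 1 - Poly_Mapping.single m' 1) \<in> I"
        by (rule ideal_add[OF I])
      then show ?thesis by simp
    qed
  qed
qed

text \<open>
  Thus \<open>toric T r\<close> is generated by the variables at \<open>T\<close> and the minors of pairs with equal labels.
  In each group of terms of \<open>p\<close> with a common image the coefficients sum to zero, and modulo
  the ideal all monomials of the group can be replaced by a single one.
\<close>

theorem toric_least:
  fixes I :: "('a, 'k::field) xy_poly set"
  assumes I: "ideal I (xy_ring V)" and r: "r ` V \<subseteq> V"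
    and vars: "\<And>t. t \<in> T \<Longrightarrow> pvar (X t) \<in> I \<and> pvar (Y t) \<in> I"
    and minors: "\<And>i j. \<lbrakk>i \<in> V - T; j \<in> V - T; r i = r j\<rbrakk> \<Longrightarrow> minor i j \<in> I"
  shows "toric T r \<subseteq> I"
proof
  fix p :: "('a, 'k) xy_poly" assume p: "p \<in> toric T r"
  define c where "c = Poly_Mapping.lookup p"
  define K where "K = Poly_Mapping.keys p \<inter> avoiding T"
  define L where "L = Poly_Mapping.keys p - avoiding T"
  have keysV: "Poly_Mapping.keys m \<subseteq> xy_vars V" if "m \<in> Poly_Mapping.keys p" for m
    using p that by (auto simp: toric_def carrier_iff)
  have finK: "finite K"
    by (simp add: K_def)
  define s where "s w = (SOME m. m \<in> K \<and> \<mu> r m = w)" for w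
  have s: "s (\<mu> r m) \<in> K \<and> \<mu> r (s (\<mu> r m)) = \<mu> r m" if "m \<in> K" for m
    unfolding s_def using that by (intro someI_ex[of "\<lambda>n. n \<in> K \<and> \<mu> r n = \<mu> r m"]) blast
  have coeff: "(\<Sum>m | m \<in> K \<and> \<mu> r m = w. c m) = 0" for w
  proof -
    have "Poly_Mapping.lookup (\<Phi> T r p) w = 0"
      using p by (simp add: toric_def)
    then show ?thesis
      by (simp add: \<Phi>_def lookup_monomial_map K_def c_def conj_assoc)
  qed
  have "L \<union> K = Poly_Mapping.keys p"
    by (auto simp: K_def L_def)
  then have "p = (\<Sum>m\<in>L \<union> K. Poly_Mapping.single m (c m))"
    using poly_expand[of p] by (simp add: c_def)
  also have "\<dots> = (\<Sum>m\<in>L. Poly_Mapping.single m (c m)) + (\<Sum>m\<in>K. Poly_Mapping.single m (c m))"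
    by (rule sum.union_disjoint) (auto simp: K_def L_def)
  also have "(\<Sum>m\<in>K. Poly_Mapping.single m (c m)) =
      (\<Sum>m\<in>K. Poly_Mapping.single 0 (c m) * (Poly_Mapping.single m 1 - Poly_Mapping.single (s (\<mu> r m)) 1))"
  proof -
    have "(\<Sum>m\<in>K. Poly_Mapping.single (s (\<mu> r m)) (c m)) =
        (\<Sum>w\<in>\<mu> r ` K. \<Sum>m | m \<in> K \<and> \<mu> r m = w. Poly_Mapping.single (s (\<mu> r m)) (c m))"
      by (rule sum.image_gen[OF finK])
    also have "\<dots> = (\<Sum>w\<in>\<mu> r ` K. Poly_Mapping.single (s w) (\<Sum>m | m \<in> K \<and> \<mu> r m = w. c m))"
    proof (rule sum.cong[OF refl])
      fix w
      have collect: "(\<Sum>m\<in>A. Poly_Mapping.single (s w) (c m)) = Poly_Mapping.single (s w) (\<Sum>m\<in>A. c m)" for A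
        by (induction A rule: infinite_finite_induct) (simp_all add: single_add)
      show "(\<Sum>m | m \<in> K \<and> \<mu> r m = w. Poly_Mapping.single (s (\<mu> r m)) (c m)) =
          Poly_Mapping.single (s w) (\<Sum>m | m \<in> K \<and> \<mu> r m = w. c m)"
        unfolding collect[symmetric] by (rule sum.cong) auto
    qed
    also have "\<dots> = 0"
      by (simp add: coeff)
    finally show ?thesis
      by (simp add: right_diff_distrib mult_single sum_subtractf)
  qed
  finally have p_eq: "p = (\<Sum>m\<in>L. Poly_Mapping.single m (c m)) +
    (\<Sum>m\<in>K. Poly_Mapping.single 0 (c m) * (Poly_Mapping.single m 1 - Poly_Mapping.single (s (\<mu> r m)) 1))" .
  have "(\<Sum>m\<in>L. Poly_Mapping.single m (c m)) \<in> I"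
  proof (rule ideal_sum[OF I])
    fix m assume m: "m \<in> L"
    then obtain z where z: "z \<in> Poly_Mapping.keys m" "z \<in> xy_vars T"
      by (auto simp: L_def avoiding_def)
    define n where "n = m - Poly_Mapping.single z 1"
    have mn: "m = Poly_Mapping.single z 1 + n"
      unfolding n_def by (rule split_variable[OF z(1)])
    have "Poly_Mapping.keys n \<subseteq> xy_vars V"
      using keysV[of m] m by (auto simp: L_def mn keys_add_nat)
    then have "Poly_Mapping.single n (c m) * pvar z \<in> I"
      using z(2) vars by (intro ideal_mult[OF I] carrier_single) auto
    then show "Poly_Mapping.single m (c m) \<in> I"
      by (subst mn) (simp add: single_var_mult mult.commute del: One_nat_def)
  qed
  moreover have "(\<Sum>m\<in>K. Poly_Mapping.single 0 (c m) *
      (Poly_Mapping.single m 1 - Poly_Mapping.single (s (\<mu> r m)) 1)) \<in> I"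
  proof (rule ideal_sum[OF I])
    fix m assume m: "m \<in> K"
    have sub: "Poly_Mapping.keys n \<subseteq> xy_vars (V - T)" if "n \<in> K" for n
    proof
      fix z assume z: "z \<in> Poly_Mapping.keys n"
      have "z \<in> xy_vars V"
        using keysV[of n] that z by (auto simp: K_def)
      moreover have "z \<notin> xy_vars T"
        using that z by (auto simp: K_def avoiding_def)
      ultimately show "z \<in> xy_vars (V - T)"
        by auto
    qed
    have "Poly_Mapping.single m 1 - Poly_Mapping.single (s (\<mu> r m)) 1 \<in> I"
      using s[OF m] m sub by (intro binomial_in_ideal[OF I r minors]) auto
    then show "Poly_Mapping.single 0 (c m) *
        (Poly_Mapping.single m 1 - Poly_Mapping.single (s (\<mu> r m)) 1) \<in> I"
      by (intro ideal_mult[OF I] carrier_single) auto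
  qed
  ultimately show "p \<in> I"
    unfolding p_eq by (rule ideal_add[OF I])
qed

end

section \<open>Long chains of toric primes\<close>

definition prime_chain :: "('r, 'm) ring_scheme \<Rightarrow> 'r set \<Rightarrow> nat \<Rightarrow> bool" where
  "prime_chain R P n \<longleftrightarrow> (\<exists>c :: nat \<Rightarrow> 'r set.
     (\<forall>i\<le>n. primeideal (c i) R) \<and> (\<forall>i<n. c i \<subset> c (Suc i)) \<and> c n = P)"

lemma prime_chain_0: "primeideal P R \<Longrightarrow> prime_chain R P 0"
  unfolding prime_chain_def by (rule exI[of _ "\<lambda>_. P"]) simp

lemma prime_chain_Suc:
  assumes "prime_chain R P n" and "P \<subset> Q" and "primeideal Q R"
  shows "prime_chain R Q (Suc n)"
proof -
  obtain c where "\<forall>i\<le>n. primeideal (c i) R" "\<forall>i<n. c i \<subset> c (Suc i)" "c n = P"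
    using assms(1) by (auto simp: prime_chain_def)
  then show ?thesis
    unfolding prime_chain_def using assms(2,3)
    by (intro exI[of _ "c(Suc n := Q)"]) (auto simp: le_Suc_eq less_Suc_eq)
qed

lemma height_eqI:
  assumes "prime_chain R P n" and "\<And>k. prime_chain R P k \<Longrightarrow> k \<le> n"
  shows "height R P = enat n"
proof -
  have "height R P = (SUP k\<in>{k. prime_chain R P k}. enat k)"
    by (simp add: height_def prime_chain_def)
  also have "\<dots> = enat n"
    using assms by (intro antisym SUP_least SUP_upper) auto
  finally show ?thesis .
qed

context numbered_verts
begin

lemma toric_mono:
  assumes r': "r' ` V \<subseteq> V" and r: "r ` V \<subseteq> V" and T: "T' \<subseteq> T" "T \<subseteq> V"
    and coarser: "\<And>i j. \<lbrakk>i \<in> V - T; j \<in> V - T; r' i = r' j\<rbrakk> \<Longrightarrow> r i = r j"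
  shows "toric T' r' \<subseteq> (toric T r :: ('a, 'k::field) xy_poly set)"
proof (rule toric_least[OF prime_ideal[OF toric_prime] r'])
  show "pvar (X t) \<in> toric T r \<and> pvar (Y t) \<in> (toric T r :: ('a, 'k) xy_poly set)" if "t \<in> T'" for t
  proof -
    have "t \<in> T" "t \<in> V"
      using that T by auto
    then show ?thesis
      by (simp add: toric_pvar_iff)
  qed
  show "minor i j \<in> (toric T r :: ('a, 'k) xy_poly set)"
    if "i \<in> V - T'" "j \<in> V - T'" "r' i = r' j" for i j
    using that coarser[of i j] by (subst toric_minor_iff) (auto simp: r[THEN subsetD])
qed

text \<open>
  Going down, a vertex \<open>t\<close> of \<open>T\<close> is first moved into the class of a vertex outside of \<open>T\<close>,
  and vertices of a class are then split off one by one, until all classes are singletons.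
  The quantity \<open>|V| + |T| - c\<close>, with \<open>c\<close> the number of classes, drops by one in each step.
\<close>

lemma toric_chain:
  assumes "r ` V \<subseteq> V" and "T \<subseteq> V" and "T = {} \<or> T \<noteq> V"
  shows "prime_chain (xy_ring V) (toric T r :: ('a, 'k::field) xy_poly set)
    (card V + card T - card (r ` (V - T)))"
  using assms
proof (induction "card V + card T - card (r ` (V - T))" arbitrary: T r rule: less_induct)
  case less
  note r = \<open>r ` V \<subseteq> V\<close> and T = \<open>T \<subseteq> V\<close>
  let ?n = "\<lambda>T r. card V + card T - card (r ` (V - T))"
  have descend: "prime_chain (xy_ring V) (toric T r :: ('a, 'k) xy_poly set) (?n T r)"
    if r': "r' ` V \<subseteq> V" and T': "T' \<subseteq> V" "T' = {} \<or> T' \<noteq> V" and n: "?n T r = Suc (?n T' r')"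
      and sub: "toric T' r' \<subset> (toric T r :: ('a, 'k) xy_poly set)" for T' r'
  proof -
    have "prime_chain (xy_ring V) (toric T' r' :: ('a, 'k) xy_poly set) (?n T' r')"
      by (rule less.hyps[OF _ r' T']) (simp add: n)
    then show ?thesis
      unfolding n by (rule prime_chain_Suc[OF _ sub toric_prime])
  qed
  show ?case
  proof (cases "T = {}")
    case False
    then obtain t s where t: "t \<in> T" and s: "s \<in> V - T"
      using less.prems(2,3) by blast
    define T' r' where "T' = T - {t}" and "r' = r(t := r s)"
    show ?thesis
    proof (rule descend[of r' T'])
      show r': "r' ` V \<subseteq> V"
        using r s by (auto simp: r'_def)
      show "T' \<subseteq> V" "T' = {} \<or> T' \<noteq> V"
        using T t by (auto simp: T'_def)
      have "V - T' = insert t (V - T)"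
        using t T by (auto simp: T'_def)
      then have "r' ` (V - T') = r ` (V - T)"
        using s t by (auto simp: r'_def)
      moreover have "card T = Suc (card T')"
        using t T finV by (metis T'_def card.remove finite_subset)
      moreover have "card (r ` (V - T)) \<le> card V"
        using finV by (meson Diff_subset card_image_le card_mono finite_Diff le_trans)
      ultimately show "?n T r = Suc (?n T' r')" by simp
      have "toric T' r' \<subseteq> (toric T r :: ('a, 'k) xy_poly set)"
        using t by (intro toric_mono[OF r' r _ T]) (auto simp: T'_def r'_def split: if_splits)
      moreover have "(pvar (X t) :: ('a, 'k) xy_poly) \<in> toric T r" "(pvar (X t) :: ('a, 'k) xy_poly) \<notin> toric T' r'"
        using t T by (auto simp: toric_pvar_iff T'_def)
      ultimately show "toric T' r' \<subset> (toric T r :: ('a, 'k) xy_poly set)" by blast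
    qed
  next
    case empty: True
    show ?thesis
    proof (cases "inj_on r V")
      case True
      then show ?thesis
        using empty prime_chain_0[OF toric_prime] by (simp add: card_image)
    next
      case False
      then obtain i j where ij: "i \<in> V" "j \<in> V" "i \<noteq> j" "r i = r j"
        by (auto simp: inj_on_def)
      have less: "card (r ` V) < card V"
        using False finV card_image_le[OF finV, of r] inj_on_iff_eq_card[OF finV, of r] by linarith
      then have "r ` V \<noteq> V" by auto
      then obtain c where c: "c \<in> V" "c \<notin> r ` V"
        using r by blast
      define r' where "r' = r(i := c)"
      show ?thesis
        unfolding empty
      proof (rule descend[unfolded empty, of r' "{}"])
        show r': "r' ` V \<subseteq> V"
          using r c by (auto simp: r'_def)
        have "r' ` V = insert c (r ` V)"
          using ij by (auto simp: r'_def image_iff)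
        then have "card (r' ` V) = Suc (card (r ` V))"
          using c finV by simp
        then show "?n {} r = Suc (?n {} r')"
          using less by simp
        have "toric {} r' \<subseteq> (toric {} r :: ('a, 'k) xy_poly set)"
          using c by (intro toric_mono[OF r' r]) (auto simp: r'_def split: if_splits)
        moreover have "r' i \<noteq> r' j"
          using ij c by (auto simp: r'_def)
        then have "(minor i j :: ('a, 'k) xy_poly) \<in> toric {} r" "(minor i j :: ('a, 'k) xy_poly) \<notin> toric {} r'"
          using ij(4) by (simp_all add: toric_minor_iff[OF ij(1,2) r] toric_minor_iff[OF ij(1,2) r'])
        ultimately show "toric {} r' \<subset> (toric {} r :: ('a, 'k) xy_poly set)" by blast
      qed auto
    qed
  qed
qed

end

section \<open>An upper bound for the length of prime chains\<close>

text \<open>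
  The counterpart, in terms of counting, of the bound by the transcendence degree. For primes
  \<open>P \<subset> Q\<close>, multiplying a family that is linearly independent modulo \<open>Q\<close> by the powers
  \<open>1, q, \<dots>, q\<^sup>M\<close> of some \<open>q \<in> Q - P\<close> gives an independent family modulo \<open>P\<close>.
  Along a chain of length \<open>k\<close> that starts with \<open>(M + 1)\<^sup>d\<close> polynomials this produces
  \<open>(M + 1)\<^bsup>d + k\<^esup>\<close> linearly independent polynomials, with exponents bounded linearly in \<open>M\<close>. In
  \<open>n\<close> variables there is only room for \<open>O(M\<^sup>n)\<close> of them, so \<open>d + k \<le> n\<close>.
\<close>

definition independent_mod ::
    "('a, 'k::field) xy_poly set \<Rightarrow> nat \<Rightarrow> (nat \<Rightarrow> ('a, 'k) xy_poly) \<Rightarrow> bool" where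
  "independent_mod P N g \<longleftrightarrow>
     (\<forall>c. (\<Sum>i<N. Poly_Mapping.single 0 (c i) * g i) \<in> P \<longrightarrow> (\<forall>i<N. c i = 0))"

definition exps_le :: "nat \<Rightarrow> ('a, 'k::field) xy_poly \<Rightarrow> bool" where
  "exps_le B p \<longleftrightarrow> (\<forall>m\<in>Poly_Mapping.keys p. \<forall>z. Poly_Mapping.lookup m z \<le> B)"

definition has_family :: "'a set \<Rightarrow> ('a, 'k::field) xy_poly set \<Rightarrow> nat \<Rightarrow> nat \<Rightarrow> bool" where
  "has_family V P N B \<longleftrightarrow>
     (\<exists>g. (\<forall>i<N. g i \<in> carrier (xy_ring V) \<and> exps_le B (g i)) \<and> independent_mod P N g)"

lemma exps_le_mult: "exps_le B p \<Longrightarrow> exps_le B' q \<Longrightarrow> exps_le (B + B') (p * q)"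
  unfolding exps_le_def using Poly_Mapping.keys_mult[of p q]
  by (fastforce simp: lookup_add intro: add_mono)

lemma exps_le_mono: "exps_le B p \<Longrightarrow> B \<le> B' \<Longrightarrow> exps_le B' p"
  by (auto simp: exps_le_def intro: le_trans)

lemma exps_le_power: "exps_le D q \<Longrightarrow> exps_le (j * D) (q ^ j)"
proof (induction j)
  case 0
  have "exps_le 0 (1 :: ('a, 'b) xy_poly)"
    by (simp add: exps_le_def)
  then show ?case by simp
next
  case (Suc j)
  then show ?case
    using exps_le_mult[of D q "j * D" "q ^ j"] by simp
qed

lemma exps_le_exists: "\<exists>D. exps_le D p"
proof -
  let ?D = "\<Sum>m\<in>Poly_Mapping.keys p. \<Sum>z\<in>Poly_Mapping.keys m. Poly_Mapping.lookup m z"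
  have "Poly_Mapping.lookup m z \<le> ?D" if m: "m \<in> Poly_Mapping.keys p" for m z
  proof (cases "z \<in> Poly_Mapping.keys m")
    case True
    then have "Poly_Mapping.lookup m z \<le> (\<Sum>z\<in>Poly_Mapping.keys m. Poly_Mapping.lookup m z)"
      by (intro member_le_sum) auto
    also have "\<dots> \<le> ?D"
      using m by (intro member_le_sum[of m _ "\<lambda>m. \<Sum>z\<in>Poly_Mapping.keys m. Poly_Mapping.lookup m z"]) auto
    finally show ?thesis .
  qed (simp add: in_keys_iff)
  then show ?thesis
    unfolding exps_le_def by blast
qed

text \<open>
  Modulo \<open>Q\<close> only \<open>S 0\<close> survives, hence it vanishes; the rest is divisible by \<open>q\<close>, which can be
  cancelled modulo \<open>P\<close>.
\<close>

lemma power_sum_zero: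
  assumes P: "primeideal P (xy_ring V)" and Q: "ideal Q (xy_ring V)" and PQ: "P \<subseteq> Q"
    and q: "q \<in> Q" "q \<notin> P"
    and S: "\<And>j. S j \<in> carrier (xy_ring V)" "\<And>j. S j \<in> Q \<Longrightarrow> S j = 0"
    and "(\<Sum>j<n. q ^ j * S j) \<in> P"
  shows "\<forall>j<n. S j = 0"
  using S assms(8)
proof (induction n arbitrary: S)
  case (Suc n)
  have qc: "q \<in> carrier (xy_ring V)"
    using q(1) ideal_sub[OF Q] by blast
  let ?t = "\<Sum>j<n. q ^ j * S (Suc j)"
  have t: "?t \<in> carrier (xy_ring V)"
    using Suc.prems(1) qc by (intro carrier_sum carrier_mult carrier_power)
  have "(\<Sum>j<Suc n. q ^ j * S j) = S 0 + ?t * q"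
    by (subst sum.lessThan_Suc_shift) (simp add: sum_distrib_left sum_distrib_right ac_simps)
  then have sum: "S 0 + ?t * q \<in> P"
    using Suc.prems(3) by simp
  then have "S 0 + ?t * q - ?t * q \<in> Q"
    using PQ by (intro ideal_diff[OF Q] ideal_mult[OF Q t q(1)]) blast
  then have S0: "S 0 = 0"
    by (intro Suc.prems(2)) simp
  then have "?t * q \<in> P"
    using sum by simp
  then have "?t \<in> P"
    using prime_mult[OF P _ t qc] q(2) by blast
  then have "\<forall>j<n. S (Suc j) = 0"
    by (intro Suc.IH) (use Suc.prems(1,2) in auto)
  then show ?case
    using S0 by (auto simp: less_Suc_eq_0_disj)
qed simp

lemma family_step:
  assumes P: "primeideal P (xy_ring V)" and Q: "primeideal Q (xy_ring V)" and PQ: "P \<subseteq> Q"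
    and q: "q \<in> Q" "q \<notin> P" "exps_le D q"
    and fam: "has_family V Q N B"
  shows "has_family V P (Suc M * N) (B + M * D)"
proof -
  obtain g where g: "\<And>i. i < N \<Longrightarrow> g i \<in> carrier (xy_ring V)" "\<And>i. i < N \<Longrightarrow> exps_le B (g i)"
    and indep: "independent_mod Q N g"
    using fam by (auto simp: has_family_def)
  have qc: "q \<in> carrier (xy_ring V)"
    using q(1) ideal_sub[OF prime_ideal[OF Q]] by blast
  \<comment> \<open>The pair of the power \<open>j\<close> and the index \<open>a < N\<close> is encoded as \<open>i = j * N + a\<close>.\<close>
  define g' where "g' i = q ^ (i div N) * g (i mod N)" for i
  have in_range: "i mod N < N" "i div N \<le> M" if "i < Suc M * N" for i
  proof -
    have "0 < N"
      using that by (cases N) auto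
    then show "i mod N < N" "i div N \<le> M"
      using that less_mult_imp_div_less[of i "Suc M" N] by auto
  qed
  have "g' i \<in> carrier (xy_ring V)" if "i < Suc M * N" for i
    using in_range[OF that] qc g(1) by (simp add: g'_def carrier_mult carrier_power)
  moreover have "exps_le (B + M * D) (g' i)" if "i < Suc M * N" for i
  proof -
    have "exps_le (i div N * D + B) (g' i)"
      unfolding g'_def using in_range[OF that] q(3) g(2) by (intro exps_le_mult exps_le_power) auto
    moreover have "i div N * D + B \<le> B + M * D"
      using in_range(2)[OF that] by (simp add: mult_le_mono1)
    ultimately show ?thesis
      by (rule exps_le_mono)
  qed
  moreover have "independent_mod P (Suc M * N) g'"
    unfolding independent_mod_def
  proof (intro allI impI)
    fix c i
    assume sum: "(\<Sum>i<Suc M * N. Poly_Mapping.single 0 (c i) * g' i) \<in> P" and i: "i < Suc M * N"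
    define S where "S j = (\<Sum>a<N. Poly_Mapping.single 0 (c (j * N + a)) * g a)" for j
    have S_indep: "\<forall>a<N. c (j * N + a) = 0" if "S j \<in> Q" for j
      using indep[unfolded independent_mod_def, THEN spec, of "\<lambda>a. c (j * N + a)"] that
      by (simp add: S_def)
    have "(\<Sum>i<Suc M * N. Poly_Mapping.single 0 (c i) * g' i) =
        (\<Sum>j<Suc M. \<Sum>i\<in>{j * N..<j * N + N}. Poly_Mapping.single 0 (c i) * g' i)"
      by (rule sum.nat_group[symmetric])
    also have "\<dots> = (\<Sum>j<Suc M. q ^ j * S j)"
    proof (rule sum.cong[OF refl])
      fix j
      have "(\<Sum>i\<in>{j * N..<j * N + N}. Poly_Mapping.single 0 (c i) * g' i) =
          (\<Sum>a<N. Poly_Mapping.single 0 (c (j * N + a)) * g' (j * N + a))"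
        using sum.shift_bounds_nat_ivl[of "\<lambda>i. Poly_Mapping.single 0 (c i) * g' i" 0 "j * N" N]
        by (simp add: atLeast0LessThan add.commute)
      also have "\<dots> = (\<Sum>a<N. q ^ j * (Poly_Mapping.single 0 (c (j * N + a)) * g a))"
        by (rule sum.cong) (simp_all add: g'_def ac_simps)
      finally show "(\<Sum>i\<in>{j * N..<j * N + N}. Poly_Mapping.single 0 (c i) * g' i) = q ^ j * S j"
        by (simp add: S_def sum_distrib_left)
    qed
    finally have "(\<Sum>j<Suc M. q ^ j * S j) \<in> P"
      using sum by simp
    then have "\<forall>j<Suc M. S j = 0"
    proof (rule power_sum_zero[OF P prime_ideal[OF Q] PQ q(1,2), rotated 2])
      show "S j \<in> carrier (xy_ring V)" for j
        unfolding S_def using g(1) by (intro carrier_sum carrier_mult carrier_single) auto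
      show "S j = 0" if "S j \<in> Q" for j
        using S_indep[OF that] by (simp add: S_def)
    qed
    then have "S (i div N) \<in> Q"
      using in_range(2)[OF i] ideal_0[OF prime_ideal[OF Q]] by simp
    then have "c (i div N * N + i mod N) = 0"
      using S_indep in_range(1)[OF i] by blast
    then show "c i = 0" by simp
  qed
  ultimately show ?thesis
    unfolding has_family_def by blast
qed

text \<open>It matters that \<open>C\<close> depends on the chain only, not on \<open>M\<close>.\<close>

lemma family_chain:
  fixes c :: "nat \<Rightarrow> ('a, 'k::field) xy_poly set"
  assumes "\<forall>i\<le>k. primeideal (c i) (xy_ring V)" and "\<forall>i<k. c i \<subset> c (Suc i)"
  shows "\<exists>C. \<forall>M N B. has_family V (c k) N B \<longrightarrow> has_family V (c 0) (Suc M ^ k * N) (B + M * C)"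
  using assms
proof (induction k)
  case (Suc k)
  then obtain C where C:
    "\<And>M N B. has_family V (c k) N B \<Longrightarrow> has_family V (c 0) (Suc M ^ k * N) (B + M * C)"
    by force
  obtain q where q: "q \<in> c (Suc k)" "q \<notin> c k"
    using Suc.prems(2) by blast
  obtain D where D: "exps_le D q"
    using exps_le_exists by blast
  have "has_family V (c 0) (Suc M ^ Suc k * N) (B + M * (D + C))"
    if fam: "has_family V (c (Suc k)) N B" for M N B
  proof -
    have "has_family V (c k) (Suc M * N) (B + M * D)"
      using Suc.prems by (intro family_step[OF _ _ _ q D fam]) auto
    from C[OF this, of M] show ?thesis
      by (simp add: algebra_simps)
  qed
  then show ?case by blast
qed (intro exI[of _ 0], simp)

lemma underdetermined_system:
  fixes a :: "'j \<Rightarrow> 'i \<Rightarrow> 'k::field"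
  assumes "finite I" and "finite J" and "card I < card J"
  shows "\<exists>c. (\<exists>j\<in>J. c j \<noteq> 0) \<and> (\<forall>i\<in>I. (\<Sum>j\<in>J. c j * a j i) = 0)"
  using assms
proof (induction I arbitrary: J a rule: finite_induct)
  case empty
  then obtain j where "j \<in> J"
    by fastforce
  then show ?case
    by (intro exI[of _ "\<lambda>_. 1"]) auto
next
  case (insert i I)
  show ?case
  proof (cases "\<forall>j\<in>J. a j i = 0")
    case True
    have "card I < card J"
      using insert.prems(2) insert.hyps by simp
    from insert.IH[OF insert.prems(1) this, of a] show ?thesis
      using True by auto
  next
    case False
    then obtain p where p: "p \<in> J" "a p i \<noteq> 0" by blast
    \<comment> \<open>The unknown at \<open>p\<close> is eliminated by means of equation \<open>i\<close>.\<close>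
    define a' where "a' j l = a j l - a j i / a p i * a p l" for j l
    have "card I < card (J - {p})"
      using insert.prems insert.hyps p(1) by simp
    from insert.IH[OF _ this, of a'] insert.prems(1) obtain c
      where c: "\<exists>j\<in>J - {p}. c j \<noteq> 0" "\<And>l. l \<in> I \<Longrightarrow> (\<Sum>j\<in>J - {p}. c j * a' j l) = 0"
      by auto
    define c' where "c' = c(p := - (\<Sum>j\<in>J - {p}. c j * a j i) / a p i)"
    have sum: "(\<Sum>j\<in>J. c' j * a j l) =
        (\<Sum>j\<in>J - {p}. c j * a j l) - (\<Sum>j\<in>J - {p}. c j * a j i) / a p i * a p l" for l
    proof -
      have "(\<Sum>j\<in>J. c' j * a j l) = c' p * a p l + (\<Sum>j\<in>J - {p}. c' j * a j l)"
        by (rule sum.remove[OF insert.prems(1) p(1)])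
      also have "(\<Sum>j\<in>J - {p}. c' j * a j l) = (\<Sum>j\<in>J - {p}. c j * a j l)"
        by (rule sum.cong) (auto simp: c'_def)
      finally show ?thesis
        by (simp add: c'_def)
    qed
    have "(\<Sum>j\<in>J. c' j * a j l) = 0" if "l \<in> insert i I" for l
    proof (cases "l = i")
      case True
      then show ?thesis
        using p(2) by (simp add: sum)
    next
      case False
      then have "0 = (\<Sum>j\<in>J - {p}. c j * a' j l)"
        using c(2) that by simp
      also have "\<dots> = (\<Sum>j\<in>J - {p}. c j * a j l) - (\<Sum>j\<in>J - {p}. c j * a j i / a p i * a p l)"
        by (simp add: a'_def right_diff_distrib sum_subtractf mult.assoc)
      also have "(\<Sum>j\<in>J - {p}. c j * a j i / a p i * a p l) = (\<Sum>j\<in>J - {p}. c j * a j i) / a p i * a p l"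
        by (simp add: sum_divide_distrib sum_distrib_right mult.assoc)
      finally show ?thesis
        by (simp add: sum)
    qed
    moreover have "\<exists>j\<in>J. c' j \<noteq> 0"
      using c(1) by (auto simp: c'_def)
    ultimately show ?thesis by blast
  qed
qed

definition bounded_monomials :: "'z set \<Rightarrow> nat \<Rightarrow> ('z \<Rightarrow>\<^sub>0 nat) set" where
  "bounded_monomials A B = {m. Poly_Mapping.keys m \<subseteq> A \<and> (\<forall>z. Poly_Mapping.lookup m z \<le> B)}"

lemma card_bounded_monomials:
  assumes A: "finite A"
  shows "finite (bounded_monomials A B)" and "card (bounded_monomials A B) = Suc B ^ card A"
proof -
  have bij: "bij_betw (\<lambda>m. restrict (Poly_Mapping.lookup m) A) (bounded_monomials A B) (A \<rightarrow>\<^sub>E {..B})"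
    unfolding bij_betw_def
  proof
    show "inj_on (\<lambda>m. restrict (Poly_Mapping.lookup m) A) (bounded_monomials A B)"
    proof (rule inj_onI, rule poly_mapping_eqI)
      fix m m' z
      assume m: "m \<in> bounded_monomials A B" "m' \<in> bounded_monomials A B"
        and eq: "restrict (Poly_Mapping.lookup m) A = restrict (Poly_Mapping.lookup m') A"
      show "Poly_Mapping.lookup m z = Poly_Mapping.lookup m' z"
      proof (cases "z \<in> A")
        case True
        then show ?thesis
          using fun_cong[OF eq, of z] by simp
      next
        case False
        then have "z \<notin> Poly_Mapping.keys m" "z \<notin> Poly_Mapping.keys m'"
          using m by (auto simp: bounded_monomials_def)
        then show ?thesis
          by (simp add: in_keys_iff)
      qed
    qed
    show "(\<lambda>m. restrict (Poly_Mapping.lookup m) A) ` bounded_monomials A B = (A \<rightarrow>\<^sub>E {..B})"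
    proof
      show "(A \<rightarrow>\<^sub>E {..B}) \<subseteq> (\<lambda>m. restrict (Poly_Mapping.lookup m) A) ` bounded_monomials A B"
      proof
        fix f assume f: "f \<in> A \<rightarrow>\<^sub>E {..B}"
        define e where "e z = (if z \<in> A then f z else 0)" for z
        have "finite {z. e z \<noteq> 0}"
          using A by (rule rev_finite_subset) (auto simp: e_def)
        then have e: "Poly_Mapping.lookup (Abs_poly_mapping e) = e"
          by simp
        have "f = restrict (Poly_Mapping.lookup (Abs_poly_mapping e)) A"
          unfolding e using f by (auto simp: e_def fun_eq_iff PiE_def extensional_def)
        moreover have "e z \<le> B" for z
          using f by (auto simp: e_def PiE_def)
        then have "Abs_poly_mapping e \<in> bounded_monomials A B"
          by (auto simp: bounded_monomials_def in_keys_iff e) (simp add: e_def split: if_splits)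
        ultimately show "f \<in> (\<lambda>m. restrict (Poly_Mapping.lookup m) A) ` bounded_monomials A B"
          by blast
      qed
    qed (auto simp: bounded_monomials_def)
  qed
  have "finite (A \<rightarrow>\<^sub>E {..B})"
    using A by (simp add: finite_PiE)
  then show "finite (bounded_monomials A B)"
    using bij_betw_finite[OF bij] by simp
  show "card (bounded_monomials A B) = Suc B ^ card A"
    using bij_betw_same_card[OF bij] A by (simp add: card_PiE)
qed

lemma lookup_scale: "Poly_Mapping.lookup (Poly_Mapping.single 0 c * p) m = c * Poly_Mapping.lookup p m"
  by (simp add: mult_map_scale_conv_mult[symmetric] Poly_Mapping.map.rep_eq when_def)

lemma family_size_le:
  assumes V: "finite V" and P: "(0 :: ('a, 'k::field) xy_poly) \<in> P" and fam: "has_family V P N B"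
  shows "N \<le> Suc B ^ (2 * card V)"
proof (rule ccontr)
  assume large: "\<not> N \<le> Suc B ^ (2 * card V)"
  obtain g :: "nat \<Rightarrow> ('a, 'k) xy_poly"
    where g: "\<And>i. i < N \<Longrightarrow> g i \<in> carrier (xy_ring V)" "\<And>i. i < N \<Longrightarrow> exps_le B (g i)"
      and indep: "independent_mod P N g"
    using fam by (auto simp: has_family_def)
  let ?I = "bounded_monomials (xy_vars V) B"
  have "card (xy_vars V) = card (X ` V) + card (Y ` V)"
    using V by (intro card_Un_disjoint) auto
  then have "card (xy_vars V) = 2 * card V"
    by (simp add: card_image inj_on_def)
  then have "finite ?I" "card ?I < card {..<N}"
    using large V by (simp_all add: card_bounded_monomials)
  from underdetermined_system[OF this(1) _ this(2), of "\<lambda>i m. Poly_Mapping.lookup (g i) m"]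
  obtain c where c: "\<exists>i\<in>{..<N}. c i \<noteq> 0" "\<And>m. m \<in> ?I \<Longrightarrow> (\<Sum>i<N. c i * Poly_Mapping.lookup (g i) m) = 0"
    by auto
  have "(\<Sum>i<N. Poly_Mapping.single 0 (c i) * g i) = 0"
  proof (rule poly_mapping_eqI)
    fix m
    have "(\<Sum>i<N. c i * Poly_Mapping.lookup (g i) m) = 0"
    proof (cases "m \<in> ?I")
      case False
      have "Poly_Mapping.lookup (g i) m = 0" if "i < N" for i
      proof (rule ccontr)
        assume "Poly_Mapping.lookup (g i) m \<noteq> 0"
        then have "m \<in> Poly_Mapping.keys (g i)"
          by (simp add: in_keys_iff)
        then show False
          using g[OF that] False by (auto simp: bounded_monomials_def carrier_iff exps_le_def)
      qed
      then show ?thesis by simp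
    qed (rule c(2))
    then show "Poly_Mapping.lookup (\<Sum>i<N. Poly_Mapping.single 0 (c i) * g i) m = Poly_Mapping.lookup 0 m"
      by (simp add: lookup_sum lookup_scale)
  qed
  then have "\<forall>i<N. c i = 0"
    using indep P by (simp add: independent_mod_def)
  then show False
    using c(1) by auto
qed

lemma exponent_le_of_growth:
  fixes e n C :: nat
  assumes "\<And>M. Suc M ^ e \<le> Suc (M + M * C) ^ n"
  shows "e \<le> n"
proof (rule ccontr)
  assume "\<not> e \<le> n"
  \<comment> \<open>With \<open>e \<ge> n + 1\<close>, the assumption gives \<open>M + 1 \<le> (C + 1)\<^sup>n\<close> for all \<open>M\<close>.\<close>
  define M where "M = Suc C ^ n"
  have "Suc M ^ Suc n \<le> Suc M ^ e"
    using \<open>\<not> e \<le> n\<close> by (intro power_increasing) auto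
  also have "\<dots> \<le> Suc (M + M * C) ^ n"
    by (rule assms)
  also have "\<dots> \<le> (Suc C * Suc M) ^ n"
    by (intro power_mono) (auto simp: algebra_simps)
  also have "\<dots> = M * Suc M ^ n"
    by (simp only: M_def power_mult_distrib)
  finally have "Suc M \<le> M"
    by simp
  then show False by simp
qed

context numbered_verts
begin

text \<open>
  Modulo \<open>toric T r\<close>, the monomials in all \<open>x\<^sub>i\<close> with \<open>i \<notin> T\<close> and one \<open>y\<^sub>i\<close> for each label are
  independent, because \<open>\<mu>\<close> is injective on them.
\<close>

lemma toric_family:
  assumes r: "r ` V \<subseteq> V" and T: "T \<subseteq> V"
  shows "has_family V (toric T r :: ('a, 'k::field) xy_poly set)
    (Suc M ^ (card (V - T) + card (r ` (V - T)))) M"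
proof -
  define s where "s = inv_into (V - T) r"
  have s: "s c \<in> V - T" "r (s c) = c" if "c \<in> r ` (V - T)" for c
    using that unfolding s_def by (rule inv_into_into, rule f_inv_into_f)
  define S where "S = X ` (V - T) \<union> (\<lambda>c. Y (s c)) ` r ` (V - T)"
  have SV: "S \<subseteq> xy_vars (V - T)"
    using s by (auto simp: S_def)
  have "inj_on (\<lambda>c. Y (s c)) (r ` (V - T))"
    by (rule inj_onI) (metis s(2) var.inject(2))
  moreover have "inj_on X (V - T)"
    by (simp add: inj_on_def)
  moreover have "card S = card (X ` (V - T)) + card ((\<lambda>c. Y (s c)) ` r ` (V - T))"
    unfolding S_def using finV by (intro card_Un_disjoint) auto
  ultimately have cardS: "card S = card (V - T) + card (r ` (V - T))"
    by (simp add: card_image)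
  have finS: "finite S"
    using finV by (simp add: S_def)
  let ?\<M> = "bounded_monomials S M"
  have inj\<mu>: "inj_on (\<mu> r) ?\<M>"
  proof (rule inj_onI)
    fix m m' assume m: "m \<in> ?\<M>" "m' \<in> ?\<M>" and eq: "\<mu> r m = \<mu> r m'"
    have zero: "Poly_Mapping.lookup n z = 0" if "n \<in> ?\<M>" "z \<notin> S" for n z
      using that by (auto simp: bounded_monomials_def in_keys_iff)
    have Y_sum: "(\<Sum>i | i \<in> V \<and> r i = c. Poly_Mapping.lookup n (Y i)) = Poly_Mapping.lookup n (Y (s c))"
      if n: "n \<in> ?\<M>" and c: "c \<in> r ` (V - T)" for n c
    proof -
      have "Poly_Mapping.lookup n (Y i) = 0" if "r i = c" "i \<noteq> s c" for i
      proof (rule zero[OF n], rule notI)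
        assume "Y i \<in> S"
        then obtain c' where "c' \<in> r ` (V - T)" "i = s c'"
          by (auto simp: S_def)
        then show False
          using that s(2)[of c'] by simp
      qed
      then have "(\<Sum>i | i \<in> V \<and> r i = c. Poly_Mapping.lookup n (Y i)) =
          (\<Sum>i\<in>{s c}. Poly_Mapping.lookup n (Y i))"
        using finV s[OF c] by (intro sum.mono_neutral_right) auto
      then show ?thesis by simp
    qed
    have Y_eq: "Poly_Mapping.lookup m (Y i) = Poly_Mapping.lookup m' (Y i)" for i
    proof (cases "Y i \<in> S")
      case True
      then obtain c where c: "c \<in> r ` (V - T)" "i = s c"
        by (auto simp: S_def)
      have cV: "c \<in> V"
        using c(1) r by auto
      show ?thesis
        using \<mu>_label[OF cV r, of Y m] \<mu>_label[OF cV r, of Y m'] eq Y_sum[OF m(1) c(1)]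
          Y_sum[OF m(2) c(1)] c(2) by simp
    qed (simp add: zero m)
    have X_eq: "Poly_Mapping.lookup m (X i) = Poly_Mapping.lookup m' (X i)" for i
    proof (cases "i \<in> V")
      case True
      then show ?thesis
        using \<mu>_vertex[OF True, of r m] \<mu>_vertex[OF True, of r m'] eq Y_eq[of i] by simp
    next
      case False
      then have "X i \<notin> S"
        by (auto simp: S_def)
      then show ?thesis
        by (simp add: zero m)
    qed
    show "m = m'"
    proof (rule poly_mapping_eqI)
      show "Poly_Mapping.lookup m z = Poly_Mapping.lookup m' z" for z
        using X_eq Y_eq by (cases z) simp_all
    qed
  qed
  have fin\<M>: "finite ?\<M>" and card\<M>: "card ?\<M> = Suc M ^ (card (V - T) + card (r ` (V - T)))"
    using card_bounded_monomials[OF finS] cardS by simp_all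
  obtain e where e: "bij_betw e {0..<card ?\<M>} ?\<M>"
    using ex_bij_betw_nat_finite[OF fin\<M>] by blast
  then have eM: "e i \<in> ?\<M>" if "i < card ?\<M>" for i
    using that by (auto simp: bij_betw_def)
  have avoid: "e i \<in> avoiding T" if "i < card ?\<M>" for i
    using eM[OF that] SV by (auto simp: avoiding_def bounded_monomials_def)
  define g where "g i = (Poly_Mapping.single (e i) 1 :: ('a, 'k) xy_poly)" for i
  have "g i \<in> carrier (xy_ring V)" if "i < card ?\<M>" for i
    unfolding g_def using eM[OF that] SV
    by (intro carrier_single) (auto simp: bounded_monomials_def)
  moreover have "exps_le M (g i)" if "i < card ?\<M>" for i
    using eM[OF that] by (simp add: g_def exps_le_def bounded_monomials_def)
  moreover have "independent_mod (toric T r) (card ?\<M>) g"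
    unfolding independent_mod_def
  proof (intro allI impI)
    fix c i assume sum: "(\<Sum>i<card ?\<M>. Poly_Mapping.single 0 (c i) * g i) \<in> toric T r" and i: "i < card ?\<M>"
    have "0 = \<Phi> T r (\<Sum>i<card ?\<M>. Poly_Mapping.single 0 (c i) * g i)"
      using sum by (simp add: toric_def)
    also have "\<dots> = (\<Sum>j<card ?\<M>. Poly_Mapping.single (\<mu> r (e j)) (c j))"
      using avoid by (simp add: \<Phi>_def monomial_map_sum g_def mult_single monomial_map_single)
    finally have "0 = Poly_Mapping.lookup (\<Sum>j<card ?\<M>. Poly_Mapping.single (\<mu> r (e j)) (c j)) (\<mu> r (e i))"
      by (metis lookup_zero)
    also have "\<dots> = (\<Sum>j<card ?\<M>. if j = i then c j else 0)"
      unfolding lookup_sum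
    proof (rule sum.cong[OF refl])
      fix j assume "j \<in> {..<card ?\<M>}"
      then have "\<mu> r (e j) = \<mu> r (e i) \<longleftrightarrow> j = i"
        using i e inj\<mu> eM by (auto simp: bij_betw_def inj_on_def)
      then show "Poly_Mapping.lookup (Poly_Mapping.single (\<mu> r (e j)) (c j)) (\<mu> r (e i)) = (if j = i then c j else 0)"
        by (auto simp: lookup_single when_def)
    qed
    also have "\<dots> = c i"
      using i by simp
    finally show "c i = 0" by simp
  qed
  ultimately show ?thesis
    unfolding has_family_def card\<M>[symmetric] by blast
qed

theorem height_toric:
  assumes r: "r ` V \<subseteq> V" and T: "T \<subseteq> V" "T = {} \<or> T \<noteq> V"
  shows "height (xy_ring V) (toric T r :: ('a, 'k::field) xy_poly set) =
    enat (card V + card T - card (r ` (V - T)))"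
proof (rule height_eqI[OF toric_chain[OF assms]])
  fix k assume "prime_chain (xy_ring V) (toric T r :: ('a, 'k) xy_poly set) k"
  then obtain c :: "nat \<Rightarrow> ('a, 'k) xy_poly set" where c: "\<forall>i\<le>k. primeideal (c i) (xy_ring V)"
    "\<forall>i<k. c i \<subset> c (Suc i)" "c k = toric T r"
    by (auto simp: prime_chain_def)
  define d where "d = card (V - T) + card (r ` (V - T))"
  obtain C where C:
    "\<And>M N B. has_family V (c k) N B \<Longrightarrow> has_family V (c 0) (Suc M ^ k * N) (B + M * C)"
    using family_chain[OF c(1,2)] by blast
  have "0 \<in> c 0"
    using ideal_0[OF prime_ideal] c(1) by blast
  moreover have "has_family V (c k) (Suc M ^ d) M" for M
    unfolding c(3) d_def by (rule toric_family[OF r T(1)])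
  ultimately have "Suc M ^ k * Suc M ^ d \<le> Suc (M + M * C) ^ (2 * card V)" for M
    by (rule family_size_le[OF finV _ C])
  then have "k + d \<le> 2 * card V"
    unfolding power_add[symmetric] by (rule exponent_le_of_growth)
  moreover have "card (V - T) = card V - card T" "card T \<le> card V"
    using T(1) finV by (simp_all add: card_Diff_subset finite_subset card_mono)
  ultimately show "k \<le> card V + card T - card (r ` (V - T))"
    unfolding d_def by linarith
qed

end

section \<open>Minimal primes of binomial edge ideals\<close>

lemma binomial_edge_ideal_le_iff:
  fixes I :: "('a, 'k::field) xy_poly set"
  assumes G: "fin_simple_graph G" and I: "ideal I (xy_ring (verts G))"
  shows "binomial_edge_ideal G \<subseteq> I \<longleftrightarrow> (\<forall>i j. {i, j} \<in> edges G \<longrightarrow> minor i j \<in> I)"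
proof -
  let ?R = "xy_ring (verts G) :: ('a, 'k) xy_poly ring"
  let ?S = "{minor i j :: ('a, 'k) xy_poly | i j. {i, j} \<in> edges G}"
  interpret cring ?R by (rule cring_xy_ring)
  have "?S \<subseteq> carrier ?R"
  proof
    fix p :: "('a, 'k) xy_poly" assume "p \<in> ?S"
    then obtain i j where "p = minor i j" "{i, j} \<in> edges G"
      by auto
    then show "p \<in> carrier ?R"
      using edgeD(1,2)[OF G] by (simp add: carrier_minor)
  qed
  then have "?S \<subseteq> genideal ?R ?S"
    by (rule genideal_self)
  moreover have "genideal ?R ?S \<subseteq> I" if "?S \<subseteq> I"
    using I that by (rule genideal_minimal)
  ultimately show ?thesis
    unfolding binomial_edge_ideal_def by blast
qed

locale edge_ideal =
  fixes G :: "'a ugraph" and h :: "'a \<Rightarrow> nat"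
  assumes simple: "fin_simple_graph G" and inj_h: "inj_on h (verts G)"
begin

sublocale numbered_verts "verts G" h
  using simple inj_h by unfold_locales (simp_all add: fin_simple_graph_def)

text \<open>
  A chosen vertex of each component of \<open>G - T\<close> serves as its label. On \<open>T\<close> the value only has to
  be some vertex.
\<close>

definition repr :: "'a set \<Rightarrow> 'a \<Rightarrow> 'a" where
  "repr T i = (if i \<in> verts G - T then SOME v. v \<in> comp_of (delete_verts G T) i else i)"

lemma repr_in_comp:
  assumes "i \<in> verts G - T"
  shows "repr T i \<in> comp_of (delete_verts G T) i"
proof -
  have "i \<in> comp_of (delete_verts G T) i"
    using assms by (simp add: comp_of_def)
  then show ?thesis
    using assms someI[of "\<lambda>v. v \<in> comp_of (delete_verts G T) i"] by (simp add: repr_def)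
qed

lemma repr_range: "repr T ` verts G \<subseteq> verts G"
proof -
  have "repr T i \<in> verts G" if "i \<in> verts G" for i
    using that repr_in_comp[of i T] by (cases "i \<in> T") (auto simp: repr_def comp_of_def)
  then show ?thesis by blast
qed

lemma repr_eq_iff:
  assumes ij: "i \<in> verts G - T" "j \<in> verts G - T"
  shows "repr T i = repr T j \<longleftrightarrow> joined (delete_verts G T) i j"
proof
  assume "joined (delete_verts G T) i j"
  then have "comp_of (delete_verts G T) i = comp_of (delete_verts G T) j"
    using ij by (simp add: comp_of_eq_iff)
  then show "repr T i = repr T j"
    using ij by (simp add: repr_def)
next
  assume "repr T i = repr T j"
  then have "joined (delete_verts G T) i (repr T i)" "joined (delete_verts G T) j (repr T i)"
    using repr_in_comp[OF ij(1)] repr_in_comp[OF ij(2)] by (simp_all add: comp_of_def)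
  then show "joined (delete_verts G T) i j"
    by (rule joined_trans[OF _ joined_sym])
qed

lemma ncomp_eq_labels: "ncomp G T = card (repr T ` (verts G - T))"
proof -
  have fin: "finite (verts G - T)"
    using finV by simp
  have "card (comp_of (delete_verts G T) ` (verts G - T)) = card (repr T ` (verts G - T))"
  proof (rule antisym)
    show "card (comp_of (delete_verts G T) ` (verts G - T)) \<le> card (repr T ` (verts G - T))"
      using fin by (intro card_image_le_via[where \<sigma> = id]) (simp_all add: repr_eq_iff comp_of_eq_iff)
    show "card (repr T ` (verts G - T)) \<le> card (comp_of (delete_verts G T) ` (verts G - T))"
      using fin by (intro card_image_le_via[where \<sigma> = id]) (simp_all add: repr_eq_iff comp_of_eq_iff)
  qed
  then show ?thesis
    by (simp add: ncomp_def components_eq)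
qed

abbreviation cut_prime :: "'a set \<Rightarrow> ('a, 'k::field) xy_poly set" where
  "cut_prime T \<equiv> toric T (repr T)"

lemma minor_in_cut_prime:
  assumes "i \<in> verts G" and "j \<in> verts G"
  shows "(minor i j :: ('a, 'k::field) xy_poly) \<in> cut_prime T \<longleftrightarrow>
    i \<in> T \<or> j \<in> T \<or> joined (delete_verts G T) i j"
  using assms repr_eq_iff[of i T j] by (cases "i \<in> T \<or> j \<in> T") (auto simp: toric_minor_iff repr_range)

lemma edge_ideal_le_cut_prime:
  "binomial_edge_ideal G \<subseteq> (cut_prime T :: ('a, 'k::field) xy_poly set)"
proof -
  have "(minor i j :: ('a, 'k) xy_poly) \<in> cut_prime T" if e: "{i, j} \<in> edges G" for i j
  proof -
    have ij: "i \<in> verts G" "j \<in> verts G"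
      using edgeD[OF simple e] by simp_all
    have "joined (delete_verts G T) i j" if "i \<notin> T" "j \<notin> T"
      using e ij that by (intro joined_edge) (auto simp: edges_delete)
    then show ?thesis
      using ij by (auto simp: minor_in_cut_prime)
  qed
  then show ?thesis
    by (simp add: binomial_edge_ideal_le_iff[OF simple prime_ideal[OF toric_prime]])
qed

lemma cut_prime_mono:
  assumes "S \<subseteq> T" "T \<subseteq> verts G"
    and "\<And>i j. \<lbrakk>i \<in> verts G - T; j \<in> verts G - T; joined (delete_verts G S) i j\<rbrakk>
      \<Longrightarrow> joined (delete_verts G T) i j"
  shows "cut_prime S \<subseteq> (cut_prime T :: ('a, 'k::field) xy_poly set)"
proof (rule toric_mono[OF repr_range repr_range assms(1,2)])
  fix i j assume ij: "i \<in> verts G - T" "j \<in> verts G - T" "repr S i = repr S j"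
  then have "i \<in> verts G - S" "j \<in> verts G - S"
    using assms(1) by blast+
  then have "joined (delete_verts G S) i j"
    using ij(3) by (simp only: repr_eq_iff)
  then show "repr T i = repr T j"
    using assms(3) ij(1,2) by (simp only: repr_eq_iff)
qed

text \<open>
  A prime containing the ideal contains the minors along all walks whose inner vertices
  \<open>j\<close> do not have both \<open>x\<^sub>j\<close> and \<open>y\<^sub>j\<close> in it, by the relation
  \<open>x\<^sub>j [i k] = x\<^sub>i [j k] + x\<^sub>k [i j]\<close> between minors and its analogue for \<open>y\<^sub>j\<close>.
\<close>

lemma prime_above_edge_ideal:
  fixes Q :: "('a, 'k::field) xy_poly set"
  assumes Q: "primeideal Q (xy_ring (verts G))" and le: "binomial_edge_ideal G \<subseteq> Q"
  shows "\<exists>T\<subseteq>verts G. cut_prime T \<subseteq> Q"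
proof -
  define T where "T = {i \<in> verts G. pvar (X i) \<in> Q \<and> pvar (Y i) \<in> Q}"
  note I = prime_ideal[OF Q]
  have edge: "minor i j \<in> Q" if "{i, j} \<in> edges G" for i j
    using le that by (simp add: binomial_edge_ideal_le_iff[OF simple I])
  have walk: "j \<in> verts G \<and> minor i j \<in> Q"
    if "joined (delete_verts G T) i j" "i \<in> verts G - T" for i j
    using that(1)
  proof (induction rule: rtrancl_induct)
    case base
    then show ?case
      using that(2) ideal_0[OF I] by simp
  next
    case (step y z)
    have e: "{y, z} \<in> edges G" "y \<in> verts G - T" "z \<in> verts G - T"
      using step.hyps(2) by (simp_all add: adj_delete)
    have iV: "i \<in> verts G"
      using that(2) by simp
    have car: "pvar (X v) \<in> carrier (xy_ring (verts G))" "pvar (Y v) \<in> carrier (xy_ring (verts G))"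
      if "v \<in> verts G" for v
      using that by (simp_all add: carrier_pvar)
    have "(pvar (X y) * minor i z :: ('a, 'k) xy_poly) = pvar (X i) * minor y z + pvar (X z) * minor i y"
      by (simp add: algebra_simps)
    moreover have "pvar (X i) * minor y z + pvar (X z) * minor i y \<in> Q"
      using step.IH e iV car edge[OF e(1)] by (intro ideal_add[OF I] ideal_mult[OF I]) auto
    moreover have "(pvar (Y y) * minor i z :: ('a, 'k) xy_poly) = pvar (Y z) * minor i y + pvar (Y i) * minor y z"
      by (simp add: algebra_simps)
    moreover have "pvar (Y z) * minor i y + pvar (Y i) * minor y z \<in> Q"
      using step.IH e iV car edge[OF e(1)] by (intro ideal_add[OF I] ideal_mult[OF I]) auto
    ultimately have "pvar (X y) * minor i z \<in> Q" "pvar (Y y) * minor i z \<in> Q"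
      by simp_all
    moreover have "minor i z \<in> carrier (xy_ring (verts G))"
      using iV e(3) by (simp add: carrier_minor)
    moreover have "pvar (X y) \<notin> Q \<or> pvar (Y y) \<notin> Q"
      using e(2) by (auto simp: T_def)
    ultimately have "minor i z \<in> Q"
      using prime_mult[OF Q] car e(2) by blast
    then show ?case
      using e(3) by simp
  qed
  have "cut_prime T \<subseteq> Q"
  proof (rule toric_least[OF I repr_range])
    show "pvar (X t) \<in> Q \<and> pvar (Y t) \<in> Q" if "t \<in> T" for t
      using that by (simp add: T_def)
    show "minor i j \<in> Q" if "i \<in> verts G - T" "j \<in> verts G - T" "repr T i = repr T j" for i j
      using walk[of i j] that repr_eq_iff[OF that(1,2)] by simp
  qed
  then show ?thesis
    by (intro exI[of _ T]) (auto simp: T_def)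
qed

text \<open>
  If \<open>P\<^sub>S \<subseteq> P\<^sub>T\<close> with \<open>S \<subset> T\<close>, take \<open>t \<in> T - S\<close>. As \<open>t\<close> is a cut vertex of \<open>G - (T - {t})\<close>, it
  separates two vertices \<open>u\<close> and \<open>v\<close>, and their minor is in \<open>P\<^sub>S\<close> but not in \<open>P\<^sub>T\<close>.
\<close>

lemma cutset_minimal:
  assumes T: "cutset G T" and S: "S \<subseteq> verts G"
    and le: "cut_prime S \<subseteq> (cut_prime T :: ('a, 'k::field) xy_poly set)"
  shows "S = T"
proof (rule ccontr)
  assume "S \<noteq> T"
  have TV: "T \<subseteq> verts G"
    using T by (simp add: cutset_iff)
  have "S \<subseteq> T"
  proof
    fix t assume t: "t \<in> S"
    then have "t \<in> verts G"
      using S by blast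
    then have "(pvar (X t) :: ('a, 'k) xy_poly) \<in> cut_prime S"
      using t by (simp add: toric_pvar_iff)
    then have "(pvar (X t) :: ('a, 'k) xy_poly) \<in> cut_prime T"
      using le by blast
    then show "t \<in> T"
      using \<open>t \<in> verts G\<close> by (simp add: toric_pvar_iff)
  qed
  then obtain t where t: "t \<in> T" "t \<notin> S"
    using \<open>S \<noteq> T\<close> by blast
  have "ncomp G (T - {t}) < ncomp G T"
    using T t(1) by (simp add: cutset_iff)
  then obtain u v where uv: "u \<in> verts G - T" "v \<in> verts G - T"
    "joined (delete_verts G (T - {t})) u v" "\<not> joined (delete_verts G T) u v"
    unfolding ncomp_less_iff[OF simple t(1) TV] by blast
  have "joined (delete_verts G S) u v"
    using uv(3) by (rule joined_delete_mono) (use \<open>S \<subseteq> T\<close> t(2) in blast)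
  then have "(minor u v :: ('a, 'k) xy_poly) \<in> cut_prime S"
    using uv(1,2) by (simp add: minor_in_cut_prime)
  then have "(minor u v :: ('a, 'k) xy_poly) \<in> cut_prime T"
    using le by blast
  then show False
    using uv by (simp add: minor_in_cut_prime)
qed

text \<open>
  For \<open>T\<close> that is not a cutset, some \<open>t \<in> T\<close> separates no two vertices of \<open>G - T\<close>, and then
  \<open>P\<^sub>T\<close> strictly contains the prime of \<open>T - {t}\<close>.
\<close>

theorem minimal_primes_edge_ideal:
  "minimal_primes (xy_ring (verts G)) (binomial_edge_ideal G :: ('a, 'k::field) xy_poly set) =
     cut_prime ` {T. cutset G T}"
proof (intro equalityI subsetI)
  let ?J = "binomial_edge_ideal G :: ('a, 'k) xy_poly set"
  fix P assume "P \<in> minimal_primes (xy_ring (verts G)) ?J"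
  then have P: "primeideal P (xy_ring (verts G))" "?J \<subseteq> P"
    and minimal: "\<And>Q. \<lbrakk>primeideal Q (xy_ring (verts G)); ?J \<subseteq> Q; Q \<subseteq> P\<rbrakk> \<Longrightarrow> Q = P"
    by (auto simp: minimal_primes_def)
  obtain T where T: "T \<subseteq> verts G" "cut_prime T \<subseteq> P"
    using prime_above_edge_ideal[OF P] by blast
  have PT: "cut_prime T = P"
    by (rule minimal[OF toric_prime edge_ideal_le_cut_prime T(2)])
  have "ncomp G (T - {t}) < ncomp G T" if t: "t \<in> T" for t
  proof (rule ccontr)
    assume "\<not> ncomp G (T - {t}) < ncomp G T"
    then have same: "joined (delete_verts G T) i j"
      if "i \<in> verts G - T" "j \<in> verts G - T" "joined (delete_verts G (T - {t})) i j" for i j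
      using ncomp_less_iff[OF simple t T(1)] that by blast
    have "cut_prime (T - {t}) \<subseteq> (cut_prime T :: ('a, 'k) xy_poly set)"
      using same by (intro cut_prime_mono[OF _ T(1)]) auto
    then have "cut_prime (T - {t}) = P"
      using T(2) by (intro minimal[OF toric_prime edge_ideal_le_cut_prime]) blast
    then have "(pvar (X t) :: ('a, 'k) xy_poly) \<in> cut_prime T \<longleftrightarrow> (pvar (X t) :: ('a, 'k) xy_poly) \<in> cut_prime (T - {t})"
      using PT by simp
    moreover have "t \<in> verts G"
      using t T(1) by blast
    ultimately show False
      using t by (simp add: toric_pvar_iff)
  qed
  then show "P \<in> cut_prime ` {T. cutset G T}"
    using T(1) PT by (auto simp: cutset_iff)
next
  let ?J = "binomial_edge_ideal G :: ('a, 'k) xy_poly set"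
  fix P :: "('a, 'k) xy_poly set" assume "P \<in> cut_prime ` {T. cutset G T}"
  then obtain T where T: "cutset G T" "P = cut_prime T" by blast
  have "Q = P" if Q: "primeideal Q (xy_ring (verts G))" "?J \<subseteq> Q" "Q \<subseteq> P" for Q
  proof -
    obtain S where S: "S \<subseteq> verts G" "cut_prime S \<subseteq> Q"
      using prime_above_edge_ideal[OF Q(1,2)] by blast
    then have "S = T"
      using Q(3) T by (intro cutset_minimal[where 'k = 'k, OF T(1) S(1)]) blast
    then show ?thesis
      using S(2) Q(3) T(2) by blast
  qed
  then show "P \<in> minimal_primes (xy_ring (verts G)) ?J"
    using toric_prime edge_ideal_le_cut_prime unfolding minimal_primes_def T(2) by blast
qed

lemma height_cut_prime:
  assumes "cutset G T"
  shows "height (xy_ring (verts G)) (cut_prime T :: ('a, 'k::field) xy_poly set) =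
    enat (card (verts G) + card T - ncomp G T)"
  unfolding ncomp_eq_labels
proof (rule height_toric[OF repr_range])
  show "T \<subseteq> verts G"
    using assms by (simp add: cutset_iff)
  \<comment> \<open>All vertices together are no cutset: removing the last one leaves no component.\<close>
  show "T = {} \<or> T \<noteq> verts G"
    using assms by (auto simp: cutset_iff ncomp_eq_labels)
qed

lemma ncomp_le: "T \<subseteq> verts G \<Longrightarrow> ncomp G T + card T \<le> card (verts G)"
  using card_image_le[of "verts G - T" "repr T"] finV card_mono[of "verts G" T]
  by (simp add: ncomp_eq_labels card_Diff_subset finite_subset)

lemma unmixed_iff: "unmixed TYPE('k::field) G \<longleftrightarrow> comb_unmixed G"
proof -
  let ?ht = "\<lambda>T. card (verts G) + card T - ncomp G T"
  have ht: "height (xy_ring (verts G)) (cut_prime T :: ('a, 'k) xy_poly set) = enat (?ht T)"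
    if "cutset G T" for T
    by (rule height_cut_prime[OF that])
  have "unmixed TYPE('k) G \<longleftrightarrow> (\<forall>T T'. cutset G T \<longrightarrow> cutset G T' \<longrightarrow> ?ht T = ?ht T')"
    by (auto simp: unmixed_def unmixed_ideal_def minimal_primes_edge_ideal ht)
  also have "\<dots> \<longleftrightarrow> (\<forall>T. cutset G T \<longrightarrow> ?ht T = ?ht {})"
    using cutset_empty[of G] by metis
  also have "\<dots> \<longleftrightarrow> comb_unmixed G"
    unfolding comb_unmixed_def
  proof (intro all_cong)
    fix T assume "cutset G T"
    then have "ncomp G T + card T \<le> card (verts G)" "ncomp G {} \<le> card (verts G)"
      using ncomp_le[of T] ncomp_le[of "{}"] by (simp_all add: cutset_iff)
    then show "?ht T = ?ht {} \<longleftrightarrow> ncomp G T = card T + ncomp G {}"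
      by auto
  qed
  finally show ?thesis .
qed

end

theorem unmixed_iff_comb_unmixed:
  assumes "fin_simple_graph G"
  shows "unmixed TYPE('k::field) G \<longleftrightarrow> comb_unmixed G"
proof -
  obtain h :: "'a \<Rightarrow> nat" where "inj_on h (verts G)"
    using assms finite_imp_inj_to_nat_seg by (metis fin_simple_graph_def)
  then interpret edge_ideal G h
    using assms by unfold_locales
  show ?thesis
    by (rule unmixed_iff)
qed

section \<open>Collapsing a connected set to one vertex\<close>

lemma ugraph_eqI:
  assumes "fin_simple_graph G" and "fin_simple_graph H" and "verts G = verts H"
    and "\<And>u v. {u, v} \<in> edges G \<longleftrightarrow> {u, v} \<in> edges H"
  shows "G = H"
proof (rule ugraph.expand, intro conjI)
  have "e \<in> edges G \<longleftrightarrow> e \<in> edges H" for e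
  proof (cases "card e = 2")
    case True
    then show ?thesis
      using assms(4) by (auto simp: card_2_iff)
  qed (use assms(1,2) in \<open>auto simp: fin_simple_graph_def\<close>)
  then show "edges G = edges H"
    by blast
qed (rule assms(3))

lemma adj_completion:
  "{a, b} \<in> edges (nbr_completion G w) \<longleftrightarrow>
     {a, b} \<in> edges G \<or> ({w, a} \<in> edges G \<and> {w, b} \<in> edges G \<and> a \<noteq> b)"
  by (auto simp: edges_completion doubleton_eq_iff)

lemma complete_components_iff:
  "complete_components G \<longleftrightarrow>
     (\<forall>u\<in>verts G. \<forall>v\<in>verts G. u \<noteq> v \<longrightarrow> joined G u v \<longrightarrow> {u, v} \<in> edges G)"
    (is "_ \<longleftrightarrow> ?R")
proof
  assume complete: "complete_components G"
  show ?R
  proof (intro ballI impI)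
    fix u v assume "u \<in> verts G" "v \<in> verts G" "u \<noteq> v" "joined G u v"
    then have "comp_of G u \<in> components G" "u \<in> comp_of G u" "v \<in> comp_of G u"
      by (auto simp: components_eq comp_of_def)
    with complete \<open>u \<noteq> v\<close> show "{u, v} \<in> edges G"
      unfolding complete_components_def by blast
  qed
next
  assume R: ?R
  have "{i, j} \<in> edges G" if "u \<in> verts G" "i \<in> comp_of G u" "j \<in> comp_of G u" "i \<noteq> j" for u i j
  proof -
    have "joined G i j"
      using that(2,3) joined_sym[of u i G] joined_trans[of i u G j] by (simp add: comp_of_def)
    then show ?thesis
      using R that by (simp add: comp_of_def)
  qed
  then show "complete_components G"
    by (auto simp: complete_components_def components_eq)
qed

text \<open>
  The part \<open>C\<close> of \<open>G\<close> is connected, and the edges between \<open>A\<close> and \<open>C\<close> are all edges between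
  a clique \<open>K\<close> of \<open>A\<close> and a set \<open>L\<close>. A branch \<open>C\<close> at a cut vertex \<open>v\<close> is the case
  \<open>K = {v}\<close>; cliques are admitted because completing a neighbourhood enlarges \<open>K\<close> and \<open>L\<close>.
  The set \<open>K\<close> may be empty, since it can lose its last vertex by deletion.
\<close>

locale collapsible =
  fixes G :: "'a ugraph" and A C K L :: "'a set"
  assumes simple: "fin_simple_graph G"
    and verts: "verts G = A \<union> C" "A \<inter> C = {}"
    and clique: "K \<subseteq> A" "\<And>i j. \<lbrakk>i \<in> K; j \<in> K; i \<noteq> j\<rbrakk> \<Longrightarrow> {i, j} \<in> edges G"
    and contact: "L \<subseteq> C" "L \<noteq> {}"
    and cross: "\<And>a c. \<lbrakk>a \<in> A; c \<in> C\<rbrakk> \<Longrightarrow> {a, c} \<in> edges G \<longleftrightarrow> a \<in> K \<and> c \<in> L"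
    and connected: "\<And>u v. \<lbrakk>u \<in> C; v \<in> C\<rbrakk> \<Longrightarrow> joined (induced G C) u v"

text \<open>The set \<open>C\<close> is contracted to the vertex \<open>f\<close>.\<close>

definition collapsed :: "'a ugraph \<Rightarrow> 'a set \<Rightarrow> 'a set \<Rightarrow> 'a \<Rightarrow> 'a ugraph" where
  "collapsed G A K f = Graph (insert f A) ({e \<in> edges G. e \<subseteq> A} \<union> {{k, f} | k. k \<in> K})"

lemma verts_collapsed [simp]: "verts (collapsed G A K f) = insert f A"
  by (simp add: collapsed_def)

lemma adj_collapsed:
  "{u, v} \<in> edges (collapsed G A K f) \<longleftrightarrow>
     ({u, v} \<in> edges G \<and> u \<in> A \<and> v \<in> A) \<or> (u \<in> K \<and> v = f) \<or> (u = f \<and> v \<in> K)"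
  by (auto simp: collapsed_def doubleton_eq_iff)

lemma adj_induced: "{u, v} \<in> edges (induced G S) \<longleftrightarrow> {u, v} \<in> edges G \<and> u \<in> S \<and> v \<in> S"
  by (auto simp: induced_def)

lemma adj_delete_edges:
  "{u, v} \<in> edges (delete_verts G T) \<longleftrightarrow>
     {u, v} \<in> edges G \<and> u \<in> verts G - T \<and> v \<in> verts G - T"
  by (auto simp: edges_delete)

context collapsible
begin

lemma simple_collapsed:
  assumes "f \<notin> A"
  shows "fin_simple_graph (collapsed G A K f)"
proof -
  have "k \<noteq> f \<and> k \<in> A" if "k \<in> K" for k
    using that clique(1) assms by blast
  then show ?thesis
    using simple verts by (auto simp: fin_simple_graph_def collapsed_def)
qed

lemma joined_collapsed_lift:
  assumes "f \<notin> A" and "T \<subseteq> A" and "l \<in> L"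
    and "joined (delete_verts (collapsed G A K f) T) x y"
  shows "joined (delete_verts G T) (if x = f then l else x) (if y = f then l else y)"
  using assms(4)
proof (rule joined_map)
  fix a b assume "{a, b} \<in> edges (delete_verts (collapsed G A K f) T)"
  then have "{if a = f then l else a, if b = f then l else b} \<in> edges (delete_verts G T)"
    using assms(1-3) clique(1) contact(1) verts cross[of a l] cross[of b l]
    by (auto simp: adj_delete_edges adj_collapsed insert_commute)
  then show "joined (delete_verts G T) (if a = f then l else a) (if b = f then l else b)"
    by (rule joined_edge)
qed

text \<open>
  A connected set \<open>C\<close> and the single vertex \<open>f\<close> see the same vertices of \<open>A\<close>, namely \<open>K\<close>, so the
  contraction \<open>\<pi>\<close> of \<open>C\<close> to \<open>f\<close> induces a bijection of components.
\<close>

lemma ncomp_collapsed: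
  assumes f: "f \<notin> A" and T: "T \<subseteq> A"
  shows "ncomp (collapsed G A K f) T = ncomp G T"
proof -
  let ?G = "delete_verts G T" and ?H = "delete_verts (collapsed G A K f) T"
  define \<pi> where "\<pi> u = (if u \<in> C then f else u)" for u
  obtain l where l: "l \<in> L" "l \<in> C"
    using contact by blast
  have "card (components ?G) = card (components ?H)"
  proof (rule card_components_eq[where \<pi> = \<pi>])
    show "finite (verts ?G)"
      using simple by (simp add: fin_simple_graph_def)
    show "\<pi> ` verts ?G = verts ?H"
    proof
      show "verts ?H \<subseteq> \<pi> ` verts ?G"
      proof
        fix x assume "x \<in> verts ?H"
        then have "x = \<pi> (if x = f then l else x)" "(if x = f then l else x) \<in> verts ?G"
          using l verts T f by (auto simp: \<pi>_def)
        then show "x \<in> \<pi> ` verts ?G"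
          by (rule image_eqI)
      qed
    qed (use verts f T in \<open>auto simp: \<pi>_def\<close>)
    fix u v assume uv: "u \<in> verts ?G" "v \<in> verts ?G"
    show "joined ?H (\<pi> u) (\<pi> v) \<longleftrightarrow> joined ?G u v"
    proof
      assume "joined ?G u v"
      then show "joined ?H (\<pi> u) (\<pi> v)"
      proof (rule joined_map)
        fix a b assume ab: "{a, b} \<in> edges ?G"
        show "joined ?H (\<pi> a) (\<pi> b)"
        proof (cases "a \<in> C \<and> b \<in> C")
          case True
          then show ?thesis by (simp add: \<pi>_def)
        next
          case False
          then have "{\<pi> a, \<pi> b} \<in> edges ?H"
            using ab verts T f cross[of a b] cross[of b a]
            by (auto simp: adj_delete_edges adj_collapsed \<pi>_def insert_commute)
          then show ?thesis by (rule joined_edge)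
        qed
      qed
    next
      assume "joined ?H (\<pi> u) (\<pi> v)"
      from joined_collapsed_lift[OF f T l(1) this]
      have lifted: "joined ?G (if \<pi> u = f then l else \<pi> u) (if \<pi> v = f then l else \<pi> v)" .
      have to_l: "joined ?G w (if \<pi> w = f then l else \<pi> w)" if "w \<in> verts ?G" for w
      proof (cases "w \<in> C")
        case True
        have "edges (induced G C) \<subseteq> edges ?G"
          using verts T by (auto simp: edges_delete induced_def)
        then have "joined ?G w l"
          using connected[OF True l(2)] by (rule joined_mono[rotated])
        then show ?thesis
          using True by (simp add: \<pi>_def)
      next
        case False
        then show ?thesis
          using that verts f by (auto simp: \<pi>_def)
      qed
      show "joined ?G u v"
        using joined_trans[OF joined_trans[OF to_l[OF uv(1)] lifted] joined_sym[OF to_l[OF uv(2)]]] .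
    qed
  qed
  then show ?thesis
    by (simp add: ncomp_def)
qed

text \<open>The neighbours of \<open>f\<close> form a clique, so no walk needs to pass through \<open>f\<close>.\<close>

lemma new_vertex_not_in_cutset:
  assumes f: "f \<notin> A" and T: "cutset (collapsed G A K f) T"
  shows "f \<notin> T"
proof
  let ?H = "collapsed G A K f"
  assume fT: "f \<in> T"
  note H = simple_collapsed[OF f]
  from T fT have "ncomp ?H (T - {f}) < ncomp ?H T" and sub: "T \<subseteq> verts ?H"
    by (auto simp: cutset_iff)
  then obtain u v where uv: "u \<in> verts ?H - T" "v \<in> verts ?H - T"
    "joined (delete_verts ?H (T - {f})) u v" "\<not> joined (delete_verts ?H T) u v"
    using ncomp_less_iff[OF H fT sub] by (elim iffD1[THEN bexE] bexE conjE)
  obtain k where k: "k \<in> verts ?H - T" "{f, k} \<in> edges ?H"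
    using surviving_neighbour[OF uv(3,4) H] by (elim bexE)
  define \<rho> where "\<rho> x = (if x = f then k else x)" for x
  have kK: "k \<in> K"
    using k fT f clique(1) by (auto simp: adj_collapsed)
  have "joined (delete_verts ?H T) (\<rho> u) (\<rho> v)"
    using uv(3)
  proof (rule joined_map)
    fix a b assume ab: "{a, b} \<in> edges (delete_verts ?H (T - {f}))"
    show "joined (delete_verts ?H T) (\<rho> a) (\<rho> b)"
    proof (cases "\<rho> a = \<rho> b")
      case False
      have ab': "{a, b} \<in> edges ?H" "a \<in> verts ?H - (T - {f})" "b \<in> verts ?H - (T - {f})"
        using ab by (simp_all add: adj_delete_edges)
      have \<rho>: "\<rho> x \<in> verts ?H - T" if "x \<in> verts ?H - (T - {f})" for x
        using that k fT by (auto simp: \<rho>_def)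
      have "{\<rho> a, \<rho> b} \<in> edges ?H"
      proof (cases "a = f \<or> b = f")
        case True
        then have "\<rho> a \<in> K" "\<rho> b \<in> K"
          using ab'(1) kK f clique(1) by (auto simp: adj_collapsed \<rho>_def)
        then show ?thesis
          using clique False by (auto simp: adj_collapsed)
      qed (use ab' in \<open>simp add: \<rho>_def\<close>)
      then have "{\<rho> a, \<rho> b} \<in> edges (delete_verts ?H T)"
        using \<rho>[OF ab'(2)] \<rho>[OF ab'(3)] by (simp add: adj_delete_edges)
      then show ?thesis by (rule joined_edge)
    qed simp
  qed
  moreover have "\<rho> u = u" "\<rho> v = v"
    using uv fT by (auto simp: \<rho>_def)
  ultimately show False
    using uv(4) by simp
qed

lemma comb_unmixed_collapsed:
  assumes f: "f \<notin> A" and "comb_unmixed G"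
  shows "comb_unmixed (collapsed G A K f)"
  unfolding comb_unmixed_def
proof (intro allI impI)
  let ?H = "collapsed G A K f"
  fix T assume T: "cutset ?H T"
  have TA: "T \<subseteq> A"
    using new_vertex_not_in_cutset[OF f T] T by (auto simp: cutset_iff)
  have "cutset G T"
    unfolding cutset_iff
  proof (intro conjI ballI)
    fix t assume "t \<in> T"
    then have "ncomp ?H (T - {t}) < ncomp ?H T"
      using T by (simp add: cutset_iff)
    moreover have "T - {t} \<subseteq> A"
      using TA by blast
    ultimately show "ncomp G (T - {t}) < ncomp G T"
      using TA by (simp add: ncomp_collapsed[OF f])
  qed (use TA verts in blast)
  then show "ncomp ?H T = card T + ncomp ?H {}"
    using assms(2) TA by (simp add: ncomp_collapsed[OF f] comb_unmixed_def)
qed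

lemma complete_components_collapsed:
  assumes f: "f \<notin> A" and complete: "complete_components G"
  shows "complete_components (collapsed G A K f)"
  unfolding complete_components_iff
proof (intro ballI impI)
  let ?H = "collapsed G A K f"
  fix u v assume uv: "u \<in> verts ?H" "v \<in> verts ?H" "u \<noteq> v" "joined ?H u v"
  obtain l where l: "l \<in> L" "l \<in> C"
    using contact by blast
  let ?s = "\<lambda>x. if x = f then l else x"
  have "joined (delete_verts ?H {}) u v"
    using uv(4) by (simp add: delete_nothing[OF simple_collapsed[OF f]])
  from joined_collapsed_lift[OF f _ l(1) this] have "joined G (?s u) (?s v)"
    by (simp add: delete_nothing[OF simple])
  moreover have "?s u \<in> verts G" "?s v \<in> verts G" "?s u \<noteq> ?s v"
    using uv(1-3) verts l by auto
  ultimately have "{?s u, ?s v} \<in> edges G"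
    using complete[unfolded complete_components_iff, rule_format] by blast
  then show "{u, v} \<in> edges ?H"
    using uv(1-3) l cross[of u l] cross[of v l] f
    by (auto simp: adj_collapsed insert_commute split: if_splits)
qed

lemma collapsible_delete:
  "collapsible (delete_verts G {w}) (A - {w}) C (K - {w}) L" if "w \<in> A"
proof
  show "joined (induced (delete_verts G {w}) C) u v" if "u \<in> C" "v \<in> C" for u v
  proof (rule joined_mono[OF connected[OF that]])
    show "edges (induced G C) \<subseteq> edges (induced (delete_verts G {w}) C)"
      using verts \<open>w \<in> A\<close> by (auto simp: induced_def edges_delete)
  qed
qed (use simple verts clique contact cross that in \<open>auto simp: fin_simple_delete adj_delete_edges\<close>)

lemma delete_collapsed:
  assumes f: "f \<notin> A" and w: "w \<in> A"
  shows "delete_verts (collapsed G A K f) {w} =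
    collapsed (delete_verts G {w}) (A - {w}) (K - {w}) f"
proof (rule ugraph_eqI)
  show "fin_simple_graph (delete_verts (collapsed G A K f) {w})"
    by (rule fin_simple_delete[OF simple_collapsed[OF f]])
  show "fin_simple_graph (collapsed (delete_verts G {w}) (A - {w}) (K - {w}) f)"
    using f by (intro collapsible.simple_collapsed[OF collapsible_delete[OF w]]) simp
qed (use f w verts clique(1) in \<open>auto simp: adj_delete_edges adj_collapsed\<close>)

lemma joined_induced_completion:
  assumes "u \<in> C" "v \<in> C"
  shows "joined (induced (nbr_completion G w) C) u v"
  using connected[OF assms] by (rule joined_mono) (auto simp: induced_def nbr_completion_def)

text \<open>
  Completing the neighbourhood of a vertex \<open>w\<close> of \<open>A\<close> matters for \<open>C\<close> only if \<open>w \<in> K\<close>; then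
  every neighbour of \<open>w\<close> in \<open>A\<close> becomes adjacent to all of \<open>L\<close> and to all of \<open>K\<close>.
\<close>

definition grown_clique :: "'a \<Rightarrow> 'a set" where
  "grown_clique w = (if w \<in> K then K \<union> {x \<in> A. {w, x} \<in> edges G} else K)"

lemma collapsible_completion:
  assumes w: "w \<in> A"
  shows "collapsible (nbr_completion G w) A C (grown_clique w) L"
proof
  have wL: "{w, c} \<in> edges G \<longleftrightarrow> w \<in> K \<and> c \<in> L" if "c \<in> C" for c
    by (rule cross[OF w that])
  show "{i, j} \<in> edges (nbr_completion G w)"
    if ij: "i \<in> grown_clique w" "j \<in> grown_clique w" "i \<noteq> j" for i j
  proof (cases "w \<in> K")
    case True
    have near: "x = w \<or> {w, x} \<in> edges G" if "x \<in> grown_clique w" for x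
      using that True clique(2)[of w x] by (auto simp: grown_clique_def)
    show ?thesis
      using near[OF ij(1)] near[OF ij(2)] ij(3) insert_commute[of i j "{}"]
      by (auto simp: adj_completion)
  next
    case False
    then show ?thesis
      using ij clique(2)[of i j] by (simp add: grown_clique_def adj_completion)
  qed
  show "{a, c} \<in> edges (nbr_completion G w) \<longleftrightarrow> a \<in> grown_clique w \<and> c \<in> L"
    if "a \<in> A" "c \<in> C" for a c
    using that cross[OF that] wL[OF that(2)] verts(2) clique(2)[of w a] edgeD(3)[OF simple, of w a]
    by (auto simp: grown_clique_def adj_completion)
qed (use simple verts clique(1) contact joined_induced_completion
     in \<open>auto simp: fin_simple_completion grown_clique_def\<close>)

lemma completion_collapsed:
  assumes f: "f \<notin> A" and w: "w \<in> A"
  shows "nbr_completion (collapsed G A K f) w = collapsed (nbr_completion G w) A (grown_clique w) f"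
proof (rule ugraph_eqI)
  show "fin_simple_graph (nbr_completion (collapsed G A K f) w)"
    by (rule fin_simple_completion[OF simple_collapsed[OF f]])
  show "fin_simple_graph (collapsed (nbr_completion G w) A (grown_clique w) f)"
    by (rule collapsible.simple_collapsed[OF collapsible_completion[OF w] f])
  show "{u, v} \<in> edges (nbr_completion (collapsed G A K f) w) \<longleftrightarrow>
    {u, v} \<in> edges (collapsed (nbr_completion G w) A (grown_clique w) f)" for u v
    using f w clique(1) clique(2)[of w u] clique(2)[of w v]
    by (auto simp: adj_completion adj_collapsed grown_clique_def insert_commute)
qed simp

text \<open>
  For \<open>w\<close> in \<open>C\<close> the completion may enlarge \<open>L\<close> but does not reach \<open>A\<close>: the neighbours of \<open>w\<close>
  there are \<open>K\<close> or none, and \<open>K\<close> is a clique.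
\<close>

lemma collapsible_completion_inside:
  assumes w: "w \<in> C"
  shows "collapsible (nbr_completion G w) A C K
    (if w \<in> L then L \<union> {c \<in> C. {w, c} \<in> edges G} else L)"
proof
  have wK: "{w, a} \<in> edges G \<longleftrightarrow> a \<in> K \<and> w \<in> L" if "a \<in> A" for a
    using cross[OF that w] by (simp add: insert_commute)
  show "{a, c} \<in> edges (nbr_completion G w) \<longleftrightarrow>
    a \<in> K \<and> c \<in> (if w \<in> L then L \<union> {c \<in> C. {w, c} \<in> edges G} else L)"
    if "a \<in> A" "c \<in> C" for a c
    using that cross[OF that] wK[OF that(1)] verts(2) by (auto simp: adj_completion)
qed (use simple verts clique contact joined_induced_completion
     in \<open>auto simp: fin_simple_completion adj_completion\<close>)

lemma collapsed_completion_inside: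
  assumes f: "f \<notin> A" and w: "w \<in> C"
  shows "collapsed (nbr_completion G w) A K f = collapsed G A K f"
proof (rule ugraph_eqI)
  have wK: "{w, a} \<in> edges G \<longleftrightarrow> a \<in> K \<and> w \<in> L" if "a \<in> A" for a
    using cross[OF that w] by (simp add: insert_commute)
  show "{u, v} \<in> edges (collapsed (nbr_completion G w) A K f) \<longleftrightarrow>
    {u, v} \<in> edges (collapsed G A K f)" for u v
    using wK[of u] wK[of v] clique(2)[of u v] by (auto simp: adj_collapsed adj_completion)
  show "fin_simple_graph (collapsed (nbr_completion G w) A K f)"
    by (rule collapsible.simple_collapsed[OF collapsible_completion_inside[OF w] f])
qed (simp_all add: simple_collapsed[OF f])

end

text \<open>
  The recursion defining strong unmixedness of the collapsed graph follows the one of \<open>G\<close>: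
  operations at a vertex of \<open>A\<close> commute with collapsing, and completion at a vertex
  of \<open>C\<close> does not change the collapsed graph at all, so that step is simply skipped.
\<close>

theorem strongly_unmixed_collapsed:
  assumes "strongly_unmixed TYPE('k::field) G"
    and "collapsible G A C K L" and "f \<notin> A"
  shows "strongly_unmixed TYPE('k) (collapsed G A K f)"
  using assms
proof (induction arbitrary: A C K L rule: strongly_unmixed.induct)
  case (complete G)
  then show ?case
    by (intro strongly_unmixed.complete collapsible.complete_components_collapsed)
next
  case (cut G w)
  interpret collapsible G A C K L by (rule cut.prems)
  note f = \<open>f \<notin> A\<close>
  show ?case
  proof (cases "w \<in> A")
    case True
    interpret Gw: collapsible "nbr_completion G w" A C "grown_clique w" L
      by (rule collapsible_completion[OF True])
    have f': "f \<notin> A - {w}"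
      using f by simp
    show ?thesis
    proof (rule strongly_unmixed.cut)
      show "unmixed TYPE('k) (collapsed G A K f)"
        using cut.hyps(1) simple simple_collapsed[OF f] comb_unmixed_collapsed[OF f]
        by (simp add: unmixed_iff_comb_unmixed)
      show "cut_vertex (collapsed G A K f) w"
        using cut.hyps(2) True
        by (simp add: cut_vertex_iff simple simple_collapsed[OF f] ncomp_collapsed[OF f])
      show "strongly_unmixed TYPE('k) (delete_verts (collapsed G A K f) {w})"
        unfolding delete_collapsed[OF f True]
        by (rule cut.IH(1)[OF collapsible_delete[OF True] f'])
      show "strongly_unmixed TYPE('k) (nbr_completion (collapsed G A K f) w)"
        unfolding completion_collapsed[OF f True]
        by (rule cut.IH(2)[OF collapsible_completion[OF True] f])
      show "strongly_unmixed TYPE('k) (delete_verts (nbr_completion (collapsed G A K f) w) {w})"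
        unfolding completion_collapsed[OF f True] Gw.delete_collapsed[OF f True]
        by (rule cut.IH(3)[OF Gw.collapsible_delete[OF True] f'])
    qed
  next
    case False
    then have w: "w \<in> C"
      using cut.hyps(2) verts by (auto simp: cut_vertex_def)
    show ?thesis
      using cut.IH(2)[OF collapsible_completion_inside[OF w] f]
      by (simp add: collapsed_completion_inside[OF f w])
  qed
qed

section \<open>Blocks and their branches\<close>

text \<open>Unlike \<open>connected_graph\<close>, this allows the empty set.\<close>

definition connected_set :: "'a ugraph \<Rightarrow> 'a set \<Rightarrow> bool" where
  "connected_set G S \<longleftrightarrow> (\<forall>u\<in>S. \<forall>v\<in>S. joined (induced G S) u v)"

lemma joined_induced_mono:
  assumes "joined (induced G S) u v" and "S \<subseteq> S'"
  shows "joined (induced G S') u v"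
  using assms(1) by (rule joined_mono) (use assms(2) in \<open>auto simp: induced_def\<close>)

lemma connected_set_singleton: "connected_set G {x}"
  by (simp add: connected_set_def)

lemma connected_set_hub:
  assumes "\<And>u. u \<in> S \<Longrightarrow> joined (induced G S) u h"
  shows "connected_set G S"
  unfolding connected_set_def
proof (intro ballI)
  fix u v assume "u \<in> S" "v \<in> S"
  then show "joined (induced G S) u v"
    using joined_trans[OF assms[of u] joined_sym[OF assms[of v]]] by simp
qed

lemma connected_set_Un_overlap:
  assumes S: "connected_set G S" and S': "connected_set G S'" and h: "h \<in> S" "h \<in> S'"
  shows "connected_set G (S \<union> S')"
proof (rule connected_set_hub[where h = h])
  fix u assume "u \<in> S \<union> S'"
  then show "joined (induced G (S \<union> S')) u h"
  proof
    assume "u \<in> S"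
    then have "joined (induced G S) u h"
      using S h(1) by (simp add: connected_set_def)
    then show ?thesis
      by (rule joined_induced_mono) simp
  next
    assume "u \<in> S'"
    then have "joined (induced G S') u h"
      using S' h(2) by (simp add: connected_set_def)
    then show ?thesis
      by (rule joined_induced_mono) simp
  qed
qed

lemma connected_set_edge:
  assumes "{x, y} \<in> edges G"
  shows "connected_set G {x, y}"
proof (rule connected_set_hub[where h = x])
  have "joined (induced G {x, y}) x y"
    using assms by (intro joined_edge) (simp add: adj_induced)
  then show "joined (induced G {x, y}) u x" if "u \<in> {x, y}" for u
    using that joined_sym[of x y] by auto
qed

lemma connected_set_Un_edge:
  assumes "connected_set G S" and "connected_set G S'"
    and "x \<in> S" "y \<in> S'" "{x, y} \<in> edges G"
  shows "connected_set G (S \<union> S')"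
proof -
  have "connected_set G (S \<union> {x, y})"
    using assms(3) by (intro connected_set_Un_overlap[OF assms(1) connected_set_edge[OF assms(5)]]) auto
  then have "connected_set G (S \<union> {x, y} \<union> S')"
    using assms(4) by (intro connected_set_Un_overlap[OF _ assms(2), where h = y]) auto
  moreover have "S \<union> {x, y} \<union> S' = S \<union> S'"
    using assms(3,4) by auto
  ultimately show ?thesis by simp
qed

lemma cut_vertex_iff_separates:
  assumes "fin_simple_graph G"
  shows "cut_vertex G z \<longleftrightarrow> z \<in> verts G \<and>
    (\<exists>u\<in>verts G - {z}. \<exists>v\<in>verts G - {z}. joined G u v \<and> \<not> joined (delete_verts G {z}) u v)"
proof (cases "z \<in> verts G")
  case True
  then show ?thesis
    using ncomp_less_iff[OF assms, of z "{z}"]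
    by (simp add: cut_vertex_iff[OF assms] delete_nothing[OF assms])
qed (simp add: cut_vertex_def)

lemma nonseparable_induced_iff:
  assumes G: "fin_simple_graph G" and S: "S \<subseteq> verts G"
  shows "nonseparable (induced G S) \<longleftrightarrow>
    S \<noteq> {} \<and> connected_set G S \<and> (\<forall>z\<in>S. connected_set G (S - {z}))"
proof -
  have V: "verts (induced G S) = S"
    using S by (auto simp: induced_def)
  have del: "delete_verts (induced G S) {z} = induced G (S - {z})" for z
    using G S by (intro ugraph.expand) (auto simp: delete_verts_def induced_def)
  have simple: "fin_simple_graph (induced G S)"
    using G by (auto simp: fin_simple_graph_def induced_def)
  have conn: "connected_graph (induced G S) \<longleftrightarrow> S \<noteq> {} \<and> connected_set G S"
    by (simp add: connected_graph_def connected_set_def V)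
  have "cut_vertex (induced G S) z \<longleftrightarrow> z \<in> S \<and> \<not> connected_set G (S - {z})"
    if "connected_set G S" for z
  proof -
    have "joined (induced G S) u v" if "u \<in> S - {z}" "v \<in> S - {z}" for u v
      using that \<open>connected_set G S\<close> by (simp add: connected_set_def)
    then show ?thesis
      unfolding cut_vertex_iff_separates[OF simple] del V connected_set_def by blast
  qed
  then show ?thesis
    unfolding nonseparable_def conn by blast
qed

lemma component_eq_comp_of:
  assumes "D \<in> components H" and "x \<in> D"
  shows "D = comp_of H x"
proof -
  obtain u where u: "u \<in> verts H" "D = comp_of H u"
    using assms(1) by (auto simp: components_eq)
  then have "x \<in> verts H" "joined H u x"
    using assms(2) by (auto simp: comp_of_def)
  then show ?thesis
    using u by (simp add: comp_of_eq_iff)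
qed

lemma comp_of_closed:
  assumes "fin_simple_graph H" and "a \<in> comp_of H x" and "{a, y} \<in> edges H"
  shows "y \<in> comp_of H x"
  using assms(2) joined_trans[OF _ joined_edge[OF assms(3)], of x] edgeD(2)[OF assms(1,3)]
  by (simp add: comp_of_def)

lemma connected_comp_of:
  assumes H: "fin_simple_graph H"
  shows "connected_set H (comp_of H x)"
proof (rule connected_set_hub[where h = x])
  fix u assume u: "u \<in> comp_of H x"
  then have "joined H u x"
    by (simp add: comp_of_def joined_sym)
  then have "u \<in> comp_of H x \<longrightarrow> joined (induced H (comp_of H x)) u x"
  proof (induction rule: converse_rtrancl_induct)
    case (step a b)
    have e: "{a, b} \<in> edges H"
      using step.hyps(1) by (simp add: adj_rel_def)
    show ?case
    proof
      assume a: "a \<in> comp_of H x"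
      have b: "b \<in> comp_of H x"
        by (rule comp_of_closed[OF H a e])
      have "joined (induced H (comp_of H x)) a b"
        using a b e by (intro joined_edge) (simp add: adj_induced)
      then show "joined (induced H (comp_of H x)) a x"
        by (rule joined_trans[OF _ step.IH[rule_format, OF b]])
    qed
  qed simp
  then show "joined (induced H (comp_of H x)) u x"
    using u by simp
qed

lemma connected_graph_leaves:
  assumes "connected_graph G" and "fin_simple_graph G"
    and "D \<subseteq> verts G" "D \<noteq> {}" "p \<in> verts G - D"
  shows "\<exists>a\<in>D. \<exists>y\<in>verts G - D. {a, y} \<in> edges G"
proof (rule ccontr)
  assume none: "\<not> ?thesis"
  obtain x where x: "x \<in> D"
    using assms(4) by blast
  then have "joined G x p"
    using assms(1,3,5) by (auto simp: connected_graph_def)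
  then have "p \<in> D"
  proof (induction rule: rtrancl_induct)
    case (step a b)
    then have "{a, b} \<in> edges G"
      by (simp add: adj_rel_def)
    then show ?case
      using step.IH none edgeD(2)[OF assms(2)] by blast
  qed (rule x)
  then show False
    using assms(5) by simp
qed

text \<open>
  An ear: a connected set \<open>D\<close> outside \<open>b\<close> with two attachment vertices enlarges the
  nonseparable set \<open>b\<close>. The enlargement is not \<open>b \<union> D\<close>, which may have dangling parts, but a
  minimal set \<open>S \<supset> b\<close> that stays connected when any one vertex of \<open>b\<close> is removed. If the
  removal of another vertex \<open>z\<close> disconnected \<open>S\<close>, the part cut off from \<open>b\<close> could be
  folded onto \<open>z\<close>, contradicting minimality.
\<close>

lemma nonseparable_ear:
  assumes G: "fin_simple_graph G" and sub: "b \<subseteq> verts G" "D \<subseteq> verts G - b"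
    and b: "connected_set G b" "\<And>z. z \<in> b \<Longrightarrow> connected_set G (b - {z})"
    and D: "connected_set G D"
    and p: "p \<in> b" "d \<in> D" "{p, d} \<in> edges G"
    and q: "q \<in> b" "d' \<in> D" "{q, d'} \<in> edges G"
    and "p \<noteq> q"
  shows "\<exists>S. b \<subset> S \<and> S \<subseteq> verts G \<and> nonseparable (induced G S)"
proof -
  define F where
    "F = {S. b \<subset> S \<and> S \<subseteq> verts G \<and> (\<forall>z\<in>b. connected_set G (S - {z}))}"
  have "b \<union> D \<in> F"
  proof -
    have "connected_set G (b \<union> D - {z})" if z: "z \<in> b" for z
    proof -
      have "connected_set G ((b - {z}) \<union> D)"
      proof (cases "z = p")
        case True
        then show ?thesis
          using q \<open>p \<noteq> q\<close> by (intro connected_set_Un_edge[OF b(2)[OF z] D, of q d']) auto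
      next
        case False
        then show ?thesis
          using p by (intro connected_set_Un_edge[OF b(2)[OF z] D, of p d]) auto
      qed
      moreover have "b \<union> D - {z} = (b - {z}) \<union> D"
        using z sub by blast
      ultimately show ?thesis by simp
    qed
    then show ?thesis
      using sub p(2) by (auto simp: F_def)
  qed
  define S where "S = arg_min card (\<lambda>S. S \<in> F)"
  have SF: "S \<in> F" and minimal: "\<And>S'. S' \<in> F \<Longrightarrow> card S \<le> card S'"
    using arg_min_nat_lemma[of "\<lambda>S. S \<in> F", OF \<open>b \<union> D \<in> F\<close>, of card]
    by (simp_all add: S_def)
  have S: "b \<subset> S" "S \<subseteq> verts G" "\<And>z. z \<in> b \<Longrightarrow> connected_set G (S - {z})"
    using SF by (auto simp: F_def)
  have finS: "finite S"
    using S(2) G by (auto simp: fin_simple_graph_def intro: finite_subset)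
  obtain s where s: "s \<in> S" "s \<notin> b"
    using S(1) by blast
  have "connected_set G ((S - {p}) \<union> (S - {q}))"
    using s p q by (intro connected_set_Un_overlap[OF S(3)[OF p(1)] S(3)[OF q(1)], of s]) auto
  moreover have "(S - {p}) \<union> (S - {q}) = S"
    using \<open>p \<noteq> q\<close> by blast
  ultimately have whole: "connected_set G S" by simp
  have "connected_set G (S - {z})" if z: "z \<in> S" for z
  proof (cases "z \<in> b")
    case False
    define R where "R = {x \<in> S - {z}. joined (induced G (S - {z})) x p}"
    have bz: "b \<subseteq> S - {z}"
      using S(1) False by blast
    have "b \<subseteq> R"
    proof
      fix x assume x: "x \<in> b"
      then have "joined (induced G b) x p"
        using b(1) p(1) by (simp add: connected_set_def)
      then have "joined (induced G (S - {z})) x p"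
        by (rule joined_induced_mono[OF _ bz])
      then show "x \<in> R"
        using x bz by (auto simp: R_def)
    qed
    have R_closed: "x \<in> R" if "y \<in> R" "{x, y} \<in> edges G" "x \<in> S - {z}" for x y
    proof -
      have "joined (induced G (S - {z})) x y"
        using that by (intro joined_edge) (simp add: adj_induced R_def)
      then show ?thesis
        using that joined_trans by (fastforce simp: R_def)
    qed
    have "insert z R \<in> F"
    proof -
      have "connected_set G (insert z R - {z'})" if z': "z' \<in> b" for z'
        unfolding connected_set_def
      proof (intro ballI)
        fix u v assume uv: "u \<in> insert z R - {z'}" "v \<in> insert z R - {z'}"
        define \<rho> where "\<rho> x = (if x \<in> R then x else z)" for x
        have "z' \<noteq> z"
          using z' False by blast
        have "joined (induced G (S - {z'})) u v"
          using S(3)[OF z'] uv z by (auto simp: connected_set_def R_def)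
        then have "joined (induced G (insert z R - {z'})) (\<rho> u) (\<rho> v)"
        proof (rule joined_map)
          fix x y assume "{x, y} \<in> edges (induced G (S - {z'}))"
          then have xy: "{x, y} \<in> edges G" "x \<in> S - {z'}" "y \<in> S - {z'}"
            by (simp_all add: adj_induced)
          show "joined (induced G (insert z R - {z'})) (\<rho> x) (\<rho> y)"
          proof (cases "x \<in> insert z R \<and> y \<in> insert z R")
            case True
            then have "\<rho> x = x" "\<rho> y = y"
              by (auto simp: \<rho>_def R_def)
            then show ?thesis
              using True xy by (intro joined_edge) (simp add: adj_induced)
          next
            case False
            then have "x \<notin> R \<and> y \<notin> R"
              using R_closed[of y x] R_closed[of x y] xy by (auto simp: insert_commute)
            then show ?thesis
              by (simp add: \<rho>_def)
          qed
        qed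
        moreover have "\<rho> u = u" "\<rho> v = v"
          using uv by (auto simp: \<rho>_def)
        ultimately show "joined (induced G (insert z R - {z'})) u v" by simp
      qed
      moreover have "b \<subset> insert z R"
        using \<open>b \<subseteq> R\<close> False by blast
      moreover have "insert z R \<subseteq> verts G"
        using S(2) z by (auto simp: R_def)
      ultimately show ?thesis
        by (simp add: F_def)
    qed
    then have "card S \<le> card (insert z R)"
      by (rule minimal)
    moreover have "insert z R \<subseteq> S"
      using z by (auto simp: R_def)
    ultimately have "insert z R = S"
      using finS by (metis card_seteq)
    then have "R = S - {z}"
      by (auto simp: R_def)
    then show ?thesis
      by (intro connected_set_hub[where h = p]) (auto simp: R_def)
  qed (rule S(3))
  then show ?thesis
    using S(1,2) s(1) whole by (intro exI[of _ S]) (auto simp: nonseparable_induced_iff[OF G])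
qed

text \<open>
  The condition \<open>two_parts\<close> is what unmixedness contributes: a cut vertex is a cutset with one
  element, so its removal leaves exactly two components.
\<close>

locale block_of_graph =
  fixes G B :: "'a ugraph"
  assumes simple: "fin_simple_graph G" and connected: "connected_graph G"
    and block: "is_block G B"
    and two_parts: "\<And>v. cut_vertex G v \<Longrightarrow> ncomp G {v} = 2"
begin

abbreviation "b \<equiv> verts B"
abbreviation "V\<^sub>B \<equiv> block_cut_verts G B"

lemma block_sub: "b \<subseteq> verts G" and block_induced: "B = induced G b"
  using block by (auto simp: is_block_def)

lemma block_connected: "b \<noteq> {}" "connected_set G b" "\<And>z. z \<in> b \<Longrightarrow> connected_set G (b - {z})"
proof -
  have "nonseparable (induced G b)"
    using block block_induced by (simp add: is_block_def)
  then show "b \<noteq> {}" "connected_set G b" "\<And>z. z \<in> b \<Longrightarrow> connected_set G (b - {z})"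
    using nonseparable_induced_iff[OF simple block_sub] by auto
qed

lemma block_maximal:
  assumes "b \<subset> S" and "S \<subseteq> verts G"
  shows "\<not> nonseparable (induced G S)"
  using block assms by (auto simp: is_block_def)

lemma block_not_singleton:
  assumes "v \<in> b" and "x \<in> verts G" and "x \<noteq> v"
  obtains w where "w \<in> b" and "w \<noteq> v"
proof (cases "b = {v}")
  case True
  have "\<exists>a\<in>{v}. \<exists>y\<in>verts G - {v}. {a, y} \<in> edges G"
    using assms block_sub by (intro connected_graph_leaves[OF connected simple, of _ x]) auto
  then obtain y where y: "y \<in> verts G" "y \<noteq> v" "{v, y} \<in> edges G"
    by auto
  have "connected_set G ({v, y} - {z})" if "z \<in> {v, y}" for z
  proof -
    have "{v, y} - {z} = {v} \<or> {v, y} - {z} = {y}"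
      using that y(2) by auto
    then show ?thesis
      by (elim disjE) (simp_all only: connected_set_singleton)
  qed
  then have "nonseparable (induced G {v, y})"
    using assms(1) block_sub y connected_set_edge[OF y(3)]
    by (subst nonseparable_induced_iff[OF simple]) auto
  moreover have "b \<subset> {v, y}" "{v, y} \<subseteq> verts G"
    using True y block_sub by auto
  ultimately show ?thesis
    using block_maximal by blast
qed (use assms(1) that in blast)

text \<open>
  By maximality of the block there is no ear, so every component of \<open>G - b\<close> hangs on the block
  at one vertex.
\<close>

lemma attachment:
  assumes x: "x \<in> verts G - b"
  defines "D \<equiv> comp_of (delete_verts G b) x"
  obtains v where "v \<in> b"
    "\<And>a y. \<lbrakk>a \<in> D; {a, y} \<in> edges G\<rbrakk> \<Longrightarrow> y \<in> D \<or> y = v"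
proof -
  have D: "D \<subseteq> verts G - b" "x \<in> D"
    using x by (auto simp: D_def comp_of_def)
  have closed: "y \<in> D" if "a \<in> D" "{a, y} \<in> edges G" "y \<notin> b" for a y
    using comp_of_closed[OF fin_simple_delete[OF simple], of a b x y] that D
      edgeD[OF simple that(2)] by (auto simp: D_def adj_delete_edges)
  have conn: "connected_set G D"
  proof (rule connected_set_hub[where h = x])
    fix u assume "u \<in> D"
    then have "joined (induced (delete_verts G b) D) u x"
      using connected_comp_of[OF fin_simple_delete[OF simple], of b x] D(2)
      by (simp add: connected_set_def D_def)
    then show "joined (induced G D) u x"
      by (rule joined_mono) (auto simp: induced_def edges_delete)
  qed
  obtain p where "p \<in> b"
    using block_connected(1) by blast
  then have "\<exists>a\<in>D. \<exists>y\<in>verts G - D. {a, y} \<in> edges G"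
    using D block_sub by (intro connected_graph_leaves[OF connected simple, of _ p]) auto
  then obtain a v where v: "a \<in> D" "v \<in> verts G - D" "{a, v} \<in> edges G"
    by blast
  have vb: "v \<in> b"
    using closed[OF v(1,3)] v(2) by blast
  have "y = v" if "a' \<in> D" "{a', y} \<in> edges G" "y \<in> b" for a' y
  proof (rule ccontr)
    assume "y \<noteq> v"
    have "\<exists>S. b \<subset> S \<and> S \<subseteq> verts G \<and> nonseparable (induced G S)"
    proof (rule nonseparable_ear[OF simple block_sub D(1) block_connected(2,3) conn])
      show "{v, a} \<in> edges G" "{y, a'} \<in> edges G"
        using v(3) that(2) by (simp_all add: insert_commute)
    qed (use D(2) v(1) vb that(1,3) \<open>y \<noteq> v\<close> in auto)
    then show False
      using block_maximal by blast
  qed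
  then show thesis
    using that[of v] vb v closed by blast
qed

text \<open>The branch of the definition without its cut vertex \<open>v\<close>.\<close>

definition part :: "'a \<Rightarrow> 'a set" where
  "part v = (THE C. C \<in> components (delete_verts G {v}) \<and> C \<inter> b = {})"

text \<open>
  One of the two components of \<open>G - v\<close> contains the connected set \<open>b - {v}\<close>, which is not empty,
  so the other one is the only candidate for a component disjoint from \<open>b\<close>.
\<close>

lemma part_eqI:
  assumes v: "v \<in> V\<^sub>B" and C: "C \<in> components (delete_verts G {v})" "C \<inter> b = {}"
  shows "part v = C"
proof -
  have vb: "v \<in> b" and cut: "cut_vertex G v"
    using v by (auto simp: block_cut_verts_def)
  obtain x where "x \<in> C" "x \<in> verts G" "x \<noteq> v"
    using C(1) by (auto simp: components_eq comp_of_def)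
  then obtain w where w: "w \<in> b" "w \<noteq> v"
    using block_not_singleton[OF vb] by blast
  have main: "comp_of (delete_verts G {v}) w \<in> components (delete_verts G {v})"
    "w \<in> comp_of (delete_verts G {v}) w"
    using w block_sub by (auto simp: components_eq comp_of_def)
  have "card (components (delete_verts G {v})) = 2"
    using two_parts[OF cut] by (simp add: ncomp_def)
  then have "C' = C" if "C' \<in> components (delete_verts G {v})" "C' \<inter> b = {}" for C'
    using that C main w(1) unfolding card_2_iff by (elim exE conjE) auto
  with C show ?thesis
    unfolding part_def by (intro the_equality conjI) blast+
qed

lemma part_exists:
  assumes v: "v \<in> V\<^sub>B"
  shows "part v \<in> components (delete_verts G {v})" and "part v \<inter> b = {}"
proof -
  have vb: "v \<in> b" and cut: "cut_vertex G v"
    using v by (auto simp: block_cut_verts_def)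
  have "card (components (delete_verts G {v})) = 2"
    using two_parts[OF cut] by (simp add: ncomp_def)
  then obtain C1 C2 where C12: "components (delete_verts G {v}) = {C1, C2}" "C1 \<noteq> C2"
    by (auto simp: card_2_iff)
  have "\<exists>C. C \<in> components (delete_verts G {v}) \<and> C \<inter> b = {}"
  proof (rule ccontr)
    assume none: "\<not> ?thesis"
    then have "C1 \<inter> b \<noteq> {}" "C2 \<inter> b \<noteq> {}"
      unfolding C12(1) by blast+
    then obtain y1 y2 where y: "y1 \<in> C1" "y1 \<in> b" "y2 \<in> C2" "y2 \<in> b"
      by blast
    have C: "C1 = comp_of (delete_verts G {v}) y1" "C2 = comp_of (delete_verts G {v}) y2"
      using y C12(1) by (simp_all add: component_eq_comp_of)
    have in_V: "y1 \<in> verts G - {v}" "y2 \<in> verts G - {v}"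
      using y(1,3) unfolding C comp_of_def by auto
    have "joined (induced G (b - {v})) y1 y2"
      using block_connected(3)[OF vb] y in_V by (simp add: connected_set_def)
    then have "joined (delete_verts G {v}) y1 y2"
      by (rule joined_mono) (use block_sub in \<open>auto simp: induced_def edges_delete\<close>)
    then show False
      using C C12(2) in_V by (simp add: comp_of_eq_iff)
  qed
  then show "part v \<in> components (delete_verts G {v})" "part v \<inter> b = {}"
    using part_eqI[OF v] by auto
qed

lemma part_sub:
  assumes "v \<in> V\<^sub>B"
  shows "part v \<subseteq> verts G - b" and "part v \<noteq> {}"
  using part_exists[OF assms] by (auto simp: components_eq comp_of_def)

lemma part_closed:
  assumes v: "v \<in> V\<^sub>B" and a: "a \<in> part v" and e: "{a, y} \<in> edges G"
  shows "y \<in> part v \<or> y = v"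
proof -
  have vb: "v \<in> b"
    using v by (simp add: block_cut_verts_def)
  have eq: "part v = comp_of (delete_verts G {v}) a"
    by (rule component_eq_comp_of[OF part_exists(1)[OF v] a])
  have "y \<in> part v" if "y \<noteq> v"
    unfolding eq
  proof (rule comp_of_closed[OF fin_simple_delete[OF simple]])
    show "a \<in> comp_of (delete_verts G {v}) a"
      using a eq by simp
    show "{a, y} \<in> edges (delete_verts G {v})"
      using e that edgeD[OF simple e] part_sub(1)[OF v] a vb by (auto simp: adj_delete_edges)
  qed
  then show ?thesis by blast
qed

lemma part_connected:
  assumes v: "v \<in> V\<^sub>B" and "u \<in> part v" "w \<in> part v"
  shows "joined (induced G (part v)) u w"
proof -
  have eq: "part v = comp_of (delete_verts G {v}) u"
    by (rule component_eq_comp_of[OF part_exists(1)[OF v] assms(2)])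
  have "joined (induced (delete_verts G {v}) (part v)) u w"
    using connected_comp_of[OF fin_simple_delete[OF simple], of "{v}" u] assms(2,3)
    by (simp add: eq connected_set_def)
  then show ?thesis
    by (rule joined_mono) (auto simp: induced_def edges_delete)
qed

lemma part_contact:
  assumes v: "v \<in> V\<^sub>B"
  shows "\<exists>a\<in>part v. {v, a} \<in> edges G"
proof -
  have "v \<in> b"
    using v by (simp add: block_cut_verts_def)
  then have "\<exists>a\<in>part v. \<exists>y\<in>verts G - part v. {a, y} \<in> edges G"
    using part_sub[OF v] block_sub
    by (intro connected_graph_leaves[OF connected simple, of _ v]) auto
  then obtain a y where "a \<in> part v" "y \<notin> part v" "{a, y} \<in> edges G"
    by blast
  then show ?thesis
    using part_closed[OF v, of a y] by (auto simp: insert_commute)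
qed

text \<open>
  As a component of \<open>G - b\<close>, a part is determined by any of its vertices. Since its only
  neighbour in \<open>b\<close> is its cut vertex, the parts of distinct cut vertices will be disjoint.
\<close>

lemma part_eq_comp_of:
  assumes v: "v \<in> V\<^sub>B" and x: "x \<in> part v"
  shows "part v = comp_of (delete_verts G b) x"
proof -
  have vb: "v \<in> b"
    using v by (simp add: block_cut_verts_def)
  have eq: "part v = comp_of (delete_verts G {v}) x"
    by (rule component_eq_comp_of[OF part_exists(1)[OF v] x])
  show ?thesis
  proof
    show "part v \<subseteq> comp_of (delete_verts G b) x"
    proof
      fix y assume y: "y \<in> part v"
      have "joined (delete_verts G b) x y"
        using part_connected[OF v x y] by (rule joined_mono)
          (use part_sub(1)[OF v] in \<open>auto simp: induced_def edges_delete\<close>)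
      then show "y \<in> comp_of (delete_verts G b) x"
        using part_sub(1)[OF v] y by (auto simp: comp_of_def)
    qed
    show "comp_of (delete_verts G b) x \<subseteq> part v"
    proof
      fix y assume y: "y \<in> comp_of (delete_verts G b) x"
      then have "joined (delete_verts G b) x y"
        by (simp add: comp_of_def)
      then have "joined (delete_verts G {v}) x y"
        by (rule joined_delete_mono) (use vb in simp)
      then show "y \<in> part v"
        using y vb by (auto simp: eq comp_of_def)
    qed
  qed
qed

lemma part_disjoint:
  assumes v: "v \<in> V\<^sub>B" and w: "w \<in> V\<^sub>B" and "v \<noteq> w"
  shows "part v \<inter> part w = {}"
proof (rule ccontr)
  assume "part v \<inter> part w \<noteq> {}"
  then obtain x where x: "x \<in> part v" "x \<in> part w" by blast
  have "part v = part w"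
    using part_eq_comp_of[OF v x(1)] part_eq_comp_of[OF w x(2)] by simp
  moreover obtain a where "a \<in> part v" "{v, a} \<in> edges G"
    using part_contact[OF v] by blast
  ultimately have "v \<in> part w \<or> v = w"
    using part_closed[OF w, of a v] by (simp add: insert_commute)
  moreover have "v \<notin> part w"
    using part_sub(1)[OF w] v by (auto simp: block_cut_verts_def)
  ultimately show False
    using \<open>v \<noteq> w\<close> by blast
qed

text \<open>
  The component of \<open>G - b\<close> around \<open>x\<close> has a single attachment \<open>v\<close>, hence it is also a component
  of \<open>G - v\<close>, and \<open>v\<close> is a cut vertex.
\<close>

lemma parts_cover:
  assumes x: "x \<in> verts G - b"
  shows "\<exists>v\<in>V\<^sub>B. x \<in> part v"
proof -
  let ?D = "comp_of (delete_verts G b) x"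
  obtain v where v: "v \<in> b"
    "\<And>a y. \<lbrakk>a \<in> ?D; {a, y} \<in> edges G\<rbrakk> \<Longrightarrow> y \<in> ?D \<or> y = v"
    using attachment[OF x] by blast
  have xD: "x \<in> ?D"
    using x by (simp add: comp_of_def)
  have D_eq: "?D = comp_of (delete_verts G {v}) x"
  proof
    show "?D \<subseteq> comp_of (delete_verts G {v}) x"
    proof
      fix y assume y: "y \<in> ?D"
      then have "joined (delete_verts G b) x y"
        by (simp add: comp_of_def)
      then have "joined (delete_verts G {v}) x y"
        by (rule joined_delete_mono) (use v(1) in simp)
      then show "y \<in> comp_of (delete_verts G {v}) x"
        using y v(1) by (auto simp: comp_of_def)
    qed
    show "comp_of (delete_verts G {v}) x \<subseteq> ?D"
    proof
      fix y assume "y \<in> comp_of (delete_verts G {v}) x"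
      then have "joined (delete_verts G {v}) x y"
        by (simp add: comp_of_def)
      then show "y \<in> ?D"
      proof (induction rule: rtrancl_induct)
        case (step a c)
        then show ?case
          using v(2)[of a c] by (auto simp: adj_delete)
      qed (rule xD)
    qed
  qed
  have D_b: "?D \<inter> b = {}"
    by (auto simp: comp_of_def)
  have "cut_vertex G v"
  proof -
    obtain w where w: "w \<in> b" "w \<noteq> v"
      using block_not_singleton[OF v(1), of x] x v(1) by blast
    have "joined G x w"
      using connected x w(1) block_sub by (auto simp: connected_graph_def)
    moreover have "\<not> joined (delete_verts G {v}) x w"
    proof
      assume "joined (delete_verts G {v}) x w"
      then have "w \<in> ?D"
        unfolding D_eq using w block_sub by (auto simp: comp_of_def)
      then show False
        using w(1) D_b by blast
    qed
    ultimately show ?thesis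
      using x w v(1) block_sub by (auto simp: cut_vertex_iff_separates[OF simple])
  qed
  then have vV: "v \<in> V\<^sub>B"
    using v(1) by (simp add: block_cut_verts_def)
  have "?D \<in> components (delete_verts G {v})"
    unfolding D_eq using x v(1) by (auto simp: components_eq)
  then have "part v = ?D"
    by (rule part_eqI[OF vV _ D_b])
  then show ?thesis
    using vV xD by blast
qed

section \<open>Whiskers\<close>

text \<open>The old vertices that survive in the graph with whiskers at \<open>W\<close>.\<close>

definition rest :: "'a set \<Rightarrow> 'a set" where
  "rest W = b \<union> (\<Union>v\<in>V\<^sub>B - W. part v)"

lemma cut_verts_in_block: "v \<in> V\<^sub>B \<Longrightarrow> v \<in> b"
  by (simp add: block_cut_verts_def)

lemma rest_sub: "rest W \<subseteq> verts G"
  using block_sub part_sub(1) by (auto simp: rest_def)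

lemma rest_empty: "rest {} = verts G"
  using parts_cover rest_sub[of "{}"] by (auto simp: rest_def)

lemma whiskered_block_eq:
  assumes W: "W \<subseteq> V\<^sub>B"
  shows "whiskered_block G B W f =
    Graph (rest W \<union> f ` W) ({e \<in> edges G. e \<subseteq> rest W} \<union> {{v, f v} | v. v \<in> W})"
proof -
  have branch: "branch G B v = induced G (insert v (part v))" for v
    by (simp add: branch_def part_def)
  have vb: "verts (branch G B v) = insert v (part v)" if "v \<in> V\<^sub>B" for v
    using part_sub(1)[OF that] cut_verts_in_block[OF that] block_sub
    by (auto simp: branch induced_def)
  have eB: "edges B = {e \<in> edges G. e \<subseteq> b}"
    by (subst block_induced) (simp add: induced_def)
  have "b \<union> (\<Union>v\<in>V\<^sub>B - W. verts (branch G B v)) = rest W"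
    using cut_verts_in_block by (auto simp: vb rest_def)
  moreover have "edges B \<union> (\<Union>v\<in>V\<^sub>B - W. edges (branch G B v)) = {e \<in> edges G. e \<subseteq> rest W}"
  proof
    show "edges B \<union> (\<Union>v\<in>V\<^sub>B - W. edges (branch G B v)) \<subseteq> {e \<in> edges G. e \<subseteq> rest W}"
      using cut_verts_in_block by (auto simp: eB branch induced_def rest_def)
    show "{e \<in> edges G. e \<subseteq> rest W} \<subseteq> edges B \<union> (\<Union>v\<in>V\<^sub>B - W. edges (branch G B v))"
    proof
      fix e assume "e \<in> {e \<in> edges G. e \<subseteq> rest W}"
      then have e: "e \<in> edges G" "e \<subseteq> rest W" by auto
      show "e \<in> edges B \<union> (\<Union>v\<in>V\<^sub>B - W. edges (branch G B v))"
      proof (cases "e \<subseteq> b")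
        case False
        then obtain a where a: "a \<in> e" "a \<notin> b" by blast
        then obtain v where v: "v \<in> V\<^sub>B - W" "a \<in> part v"
          using e(2) by (auto simp: rest_def)
        have "card e = 2"
          using e(1) simple by (auto simp: fin_simple_graph_def)
        then obtain y where y: "e = {a, y}"
          using a(1) by (auto simp: card_2_iff)
        have "y \<in> part v \<or> y = v"
          using part_closed[of v a y] v e(1) y by simp
        then show ?thesis
          using e(1) v y by (auto simp: branch induced_def)
      qed (use e(1) eB in simp)
    qed
  qed
  ultimately show ?thesis
    by (simp add: whiskered_block_def)
qed

lemma whiskered_block_none: "whiskered_block G B {} f = G"
proof -
  have "{e \<in> edges G. e \<subseteq> verts G} = edges G"
    using simple by (auto simp: fin_simple_graph_def)
  then show ?thesis
    by (simp add: whiskered_block_eq rest_empty)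
qed

text \<open>Passing from \<open>W\<close> to \<open>insert v W\<close> collapses the branch at \<open>v\<close> to the new vertex.\<close>

lemma
  assumes W: "insert v W \<subseteq> V\<^sub>B" "v \<notin> W" and f: "new_vertices G (insert v W) f"
  defines "A \<equiv> rest (insert v W) \<union> f ` W"
  shows collapsible_whiskered:
      "collapsible (whiskered_block G B W f) A (part v) {v} {c \<in> part v. {v, c} \<in> edges G}"
    and whiskered_block_insert:
      "whiskered_block G B (insert v W) f = collapsed (whiskered_block G B W f) A {v} (f v)"
    and whisker_fresh: "f v \<notin> A"
proof -
  have v: "v \<in> V\<^sub>B" "v \<in> b"
    using W cut_verts_in_block by auto
  have Wb: "W \<subseteq> V\<^sub>B" "W \<subseteq> b"
    using W cut_verts_in_block by auto
  have inj: "inj_on f (insert v W)" and fresh: "\<And>u. u \<in> insert v W \<Longrightarrow> f u \<notin> verts G"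
    using f by (auto simp: new_vertices_def)
  note part = part_sub(1)[OF v(1)]
  have rest_W: "rest W = rest (insert v W) \<union> part v"
    using W v by (auto simp: rest_def)
  have rest_part: "rest (insert v W) \<inter> part v = {}"
    using W part_disjoint[OF v(1)] part by (auto simp: rest_def)
  have b_rest: "b \<subseteq> rest U" for U
    by (auto simp: rest_def)
  show fresh_v: "f v \<notin> A"
    using fresh[of v] rest_sub inj W(2) by (auto simp: A_def inj_on_def)
  let ?W = "whiskered_block G B W f"
  have vertsW: "verts ?W = rest W \<union> f ` W"
    by (simp add: whiskered_block_eq[OF Wb(1)])
  have adjW: "{x, y} \<in> edges ?W \<longleftrightarrow> ({x, y} \<in> edges G \<and> x \<in> rest W \<and> y \<in> rest W) \<or>
      (x \<in> W \<and> y = f x) \<or> (y \<in> W \<and> x = f y)" for x y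
    by (auto simp: whiskered_block_eq[OF Wb(1)] doubleton_eq_iff)
  have simpleW: "fin_simple_graph ?W"
  proof -
    have "finite (verts G)" "W \<subseteq> verts G"
      using simple Wb(2) block_sub by (auto simp: fin_simple_graph_def)
    then have fin: "finite (rest W)" "finite W"
      using rest_sub by (auto intro: finite_subset)
    have "u \<noteq> f u" "u \<in> rest W" if "u \<in> W" for u
      using that Wb block_sub fresh b_rest by fastforce+
    then show ?thesis
      using simple fin by (auto simp: whiskered_block_eq[OF Wb(1)] fin_simple_graph_def)
  qed
  show collapsible: "collapsible ?W A (part v) {v} {c \<in> part v. {v, c} \<in> edges G}"
  proof
    show "fin_simple_graph ?W" by (rule simpleW)
    show "verts ?W = A \<union> part v"
      by (auto simp: vertsW A_def rest_W)
    show "A \<inter> part v = {}"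
      using rest_part fresh part by (auto simp: A_def)
    show "{v} \<subseteq> A"
      using b_rest v(2) by (auto simp: A_def)
    show "{c \<in> part v. {v, c} \<in> edges G} \<noteq> {}"
      using part_contact[OF v(1)] by blast
    show "{a, c} \<in> edges ?W \<longleftrightarrow> a \<in> {v} \<and> c \<in> {c \<in> part v. {v, c} \<in> edges G}"
      if a: "a \<in> A" and c: "c \<in> part v" for a c
    proof
      have "c \<notin> b" "c \<in> verts G"
        using c part by auto
      have notf: "c \<noteq> f u" if "u \<in> W" for u
        using that fresh[of u] \<open>c \<in> verts G\<close> by auto
      assume "{a, c} \<in> edges ?W"
      then have e: "{c, a} \<in> edges G" "a \<in> rest W"
        using notf \<open>c \<notin> b\<close> Wb by (auto simp: adjW insert_commute)
      have "a \<notin> part v"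
        using a c rest_part fresh part by (auto simp: A_def)
      then have "a = v"
        using part_closed[OF v(1) c e(1)] by blast
      then show "a \<in> {v} \<and> c \<in> {c \<in> part v. {v, c} \<in> edges G}"
        using e c by (simp add: insert_commute)
    next
      assume "a \<in> {v} \<and> c \<in> {c \<in> part v. {v, c} \<in> edges G}"
      then show "{a, c} \<in> edges ?W"
        using b_rest v(2) by (auto simp: adjW rest_W)
    qed
    show "joined (induced ?W (part v)) u w" if "u \<in> part v" "w \<in> part v" for u w
      using part_connected[OF v(1) that] by (rule joined_mono)
        (auto simp: induced_def whiskered_block_eq[OF Wb(1)] rest_W)
  qed auto
  show "whiskered_block G B (insert v W) f = collapsed ?W A {v} (f v)"
  proof (rule ugraph.expand, intro conjI)
    show "verts (whiskered_block G B (insert v W) f) = verts (collapsed ?W A {v} (f v))"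
      by (auto simp: whiskered_block_eq[OF W(1)] A_def)
    have old: "{e \<in> edges G. e \<subseteq> rest W \<and> e \<subseteq> A} = {e \<in> edges G. e \<subseteq> rest (insert v W)}"
    proof -
      have "rest W \<inter> A = rest (insert v W)"
        using rest_W rest_part fresh rest_sub by (fastforce simp: A_def)
      then show ?thesis by blast
    qed
    have new: "{u, f u} \<subseteq> A" if "u \<in> W" for u
      using that Wb b_rest by (auto simp: A_def)
    show "edges (whiskered_block G B (insert v W) f) = edges (collapsed ?W A {v} (f v))"
      using old new
      by (simp add: whiskered_block_eq[OF W(1)] whiskered_block_eq[OF Wb(1)] collapsed_def) blast
  qed
qed

theorem strongly_unmixed_whiskered:
  assumes G: "strongly_unmixed TYPE('k::field) G"
    and W: "W \<subseteq> V\<^sub>B" and f: "new_vertices G W f"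
  shows "strongly_unmixed TYPE('k) (whiskered_block G B W f)"
proof -
  have "finite W"
    using W cut_verts_in_block block_sub simple
    by (meson fin_simple_graph_def finite_subset subset_iff)
  then show ?thesis
    using W f
  proof (induction W rule: finite_induct)
    case empty
    then show ?case
      using G by (simp add: whiskered_block_none)
  next
    case (insert v W)
    have "new_vertices G W f"
      using insert.prems(2) by (auto simp: new_vertices_def)
    then have "strongly_unmixed TYPE('k) (whiskered_block G B W f)"
      using insert.prems(1) by (intro insert.IH) auto
    then show ?case
      unfolding whiskered_block_insert[OF insert.prems(1) insert.hyps(2) insert.prems(2)]
      using collapsible_whiskered[OF insert.prems(1) insert.hyps(2) insert.prems(2)]
        whisker_fresh[OF insert.prems(1) insert.hyps(2) insert.prems(2)]
      by (rule strongly_unmixed_collapsed)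
  qed
qed

end

text \<open>
  A graph with a cut vertex has an incomplete component, so strong unmixedness includes
  unmixedness, which is applied to the cutset \<open>{v}\<close>.
\<close>

lemma strongly_unmixed_two_parts:
  assumes "fin_simple_graph G" and "connected_graph G"
    and "strongly_unmixed TYPE('k::field) G" and v: "cut_vertex G v"
  shows "ncomp G {v} = 2"
proof -
  have "\<not> complete_components G"
  proof
    assume complete: "complete_components G"
    obtain u w where uw: "u \<in> verts G - {v}" "w \<in> verts G - {v}" "joined G u w"
      "\<not> joined (delete_verts G {v}) u w"
      using v unfolding cut_vertex_iff_separates[OF assms(1)] by blast
    then have "u \<noteq> w" by auto
    then have "{u, w} \<in> edges G"
      using complete uw unfolding complete_components_iff by blast
    then have "joined (delete_verts G {v}) u w"
      using uw by (intro joined_edge) (simp add: adj_delete_edges)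
    with uw(4) show False by simp
  qed
  with assms(3) have "unmixed TYPE('k) G"
    by (cases rule: strongly_unmixed.cases) auto
  then have "comb_unmixed G"
    by (simp add: unmixed_iff_comb_unmixed[OF assms(1)])
  then have "ncomp G {v} = 1 + ncomp G {}"
    using v by (simp add: comb_unmixed_def cutset_singleton[OF assms(1)])
  moreover have "ncomp G {} = 1"
  proof -
    obtain u where u: "u \<in> verts G"
      using assms(2) by (auto simp: connected_graph_def)
    have "components G = {comp_of G u}"
    proof -
      have "comp_of G w = comp_of G u" if "w \<in> verts G" for w
        using that u assms(2) by (simp add: comp_of_eq_iff connected_graph_def)
      then have "comp_of G ` verts G = (\<lambda>w. comp_of G u) ` verts G"
        by (rule image_cong[OF refl])
      also have "\<dots> = {comp_of G u}"
        using u by (rule image_constant)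
      finally show ?thesis
        by (simp only: components_eq)
    qed
    then show ?thesis
      by (simp add: ncomp_def delete_nothing[OF assms(1)])
  qed
  ultimately show ?thesis by simp
qed

theorem theorem3p10:
  fixes G B :: "'a ugraph"
  assumes "fin_simple_graph G"
    and "connected_graph G"
    and "strongly_unmixed TYPE('k::field) G"
    and "is_block G B"
  shows "(\<forall>W f. W \<subseteq> block_cut_verts G B \<and> new_vertices G W f
             \<longrightarrow> strongly_unmixed TYPE('k) (whiskered_block G B W f)) \<and>
         (\<forall>f. new_vertices G (block_cut_verts G B) f
             \<longrightarrow> strongly_unmixed TYPE('k) (whiskered_block G B (block_cut_verts G B) f))"
proof -
  interpret block_of_graph G B
    using assms strongly_unmixed_two_parts[OF assms(1-3)] by unfold_locales
  show ?thesis
    using strongly_unmixed_whiskered[OF assms(3)] by blast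
qed

end
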